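(* Consider the two conditions: (c) for each $T\in(0,\infty)$ there is $C_1(T)>0$ so that $\|S^*(T)z\|_X\le C_1(T)\int_0^T\|B^*S^*(T-t)z\|_U\,dt$ for all $z\in D(A^* )$; (d) if $z\in X$ satisfies $\widetilde{B^*S^*}(T-\cdot)z=0$ over $E$ for some $T\in(0,\infty)$ and some measurable $E\subset(0,T)$ of positive measure, then $\widetilde{B^*S^*}(T-\cdot)z=0$ over $(0,T)$. Let $\mathcal W,\mathcal W_{2,2},\mathcal W_{3,2},\mathcal W_{3,3},\mathcal V,\mathcal V_{2,3},\mathcal V_{3,1},\mathcal V_{3,2},\gamma_1,\gamma_2$ be the sets defined in the context. Then: (i) Suppose that (c) holds. Then $\mathcal W=\mathcal W_{3,2}\cup\mathcal W_{3,3}$ and $\mathcal V=\mathcal V_{3,1}\cup\mathcal V_{3,2}$. In particular, $\gamma_1=\mathcal W_{2,2}=\emptyset$ and $\gamma_2=\mathcal V_{2,3}=\emptyset$. (ii) Suppose that (c) holds. Then for each $(M,y_0)\in\mathcal V_{3,1}$, $(TP)^{M,y_0}$ has no admissible control and does not hold the bang-bang property. If moreover (d) holds, then for each $(M,y_0)\in\mathcal V_{3,2}$, $(TP)^{M,y_0}$ has the bang-bang property. (iii) For each $(T,y_0)\in\mathcal W_{3,3}$, the null control is the unique minimal norm control to $(NP)^{T,y_0}$ and this problem has the bang-bang property. If (c) and (d) hold, then for each $(T,y_0)\in\mathcal W_{3,2}$, $(NP)^{T,y_0}$ has the bang-bang property and the null control is not a minimal norm control to this problem.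
   Context: Setting. $\mathbb R^+=[0,\infty)$. $X$ (state space) and $U$ (control space) are real Hilbert spaces. $A:D(A)\subset X\to X$ generates a $C_0$-semigroup $\{S(t)\}_{t\ge 0}$ on $X$; $S^*(t)$ is the adjoint semigroup, generated by $A^*$. $X_{-1}=D(A^* )'$ is the dual of $D(A^* )$ with respect to the pivot space $X$, and $S_{-1}(t)$ is the extension of $S(t)$ to $X_{-1}$. $B\in\mathcal L(U,X_{-1})$, $B\ne 0$, is an admissible control operator: for each $\hat t\in(0,\infty)$ there is $C(\hat t)>0$ with $\|\int_0^{\hat t}S_{-1}(\hat t-\tau)Bu(\tau)\,d\tau\|_X\le C(\hat t)\|u\|_{L^2(0,\hat t;U)}$ for all $u\in L^2_{loc}(\mathbb R^+;U)$. $B^*\in\mathcal L(D(A^* ),U)$ is its adjoint. For $y_0\in X$, $T\in(0,\infty)$, $v\in L^2(0,T;U)$, put $\hat y(t;y_0,v)=S(t)y_0+\int_0^tS_{-1}(t-\tau)Bv(\tau)\,d\tau$, $t\in[0,T]$. For $u\in L^\infty(\mathbb R^+;U)$, $y(t;y_0,u)$, $t\ge0$, denotes the same expression with $v$ replaced by $u$. Extension of $B^*S^*$. By admissibility, for each $T$ the operator $z\mapsto B^*S^*(T-\cdot)z$, $D(A^* )\to L^2(0,T;U)$, is bounded for the $X$-norm, and $\widetilde{B^*S^*}(T-\cdot)$ denotes its unique bounded linear extension $X\to L^2(0,T;U)$. Minimal norm problem. For $T\in(0,\infty)$, $y_0\in X\setminus\{0\}$, $(NP)^{T,y_0}$: $N(T,y_0)=\inf\{\|v\|_{L^\infty(0,T;U)}: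 v\in L^\infty(0,T;U),\ \hat y(T;y_0,v)=0\}$ ($\inf\emptyset=\infty$). An admissible control is $v\in L^\infty(0,T;U)$ with $\hat y(T;y_0,v)=0$; a minimal norm control is an admissible control $v^*$ with $\|v^*\|_{L^\infty(0,T;U)}=N(T,y_0)$. $(NP)^{T,y_0}$ has the bang-bang property if it has an admissible control and every minimal norm control $v^*$ satisfies $\|v^*(t)\|_U=N(T,y_0)$ for a.e. $t\in(0,T)$; without admissible controls the property is said not to hold. $T\mapsto N(T,y_0)$ is decreasing and extended by $N(\infty,y_0)=\lim_{t\to\infty}N(t,y_0)$, $N(0,y_0)=\lim_{t\to0^+}N(t,y_0)$. Minimal time problem. For $M\in(0,\infty)$, $y_0\in X\setminus\{0\}$, let $\mathcal U^M=\{u:\mathbb R^+\to U\text{ strongly measurable}:\|u(t)\|_U\le M\text{ a.e.}\}$. $(TP)^{M,y_0}$: $T(M,y_0)=\inf\{\hat t\in(0,\infty):\exists u\in\mathcal U^M\text{ s.t. }y(\hat t;y_0,u)=0\}$ ($\inf\emptyset=\infty$). An admissible control is $u\in\mathcal U^M$ with $y(\hat t;y_0,u)=0$ for some $\hat t\in(0,\infty)$. A minimal time control (when $T(M,y_0)<\infty$) is $u^*\in\mathcal U^M$ with $y(T(M,y_0);y_0,u^* )=0$ and $u^*=0$ over $(T(M,y_0),\infty)$. $(TP)^{M,y_0}$ has the bang-bang property if it has an admissible control and every minimal time control $u^*$ satisfies $\|u^*(t)\|_U=M$ for a.e. $t\in(0,T(M,y_0))$; without admissible controls the property is said not to hold.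 For $y_0\in X$: $T^0(y_0)=\inf\{\hat t\in\mathbb R^+:\exists u\in L^\infty(\mathbb R^+;U)\text{ s.t. }y(\hat t;y_0,u)=0\}$ and $T^1(y_0)=\inf\{\hat t\in\mathbb R^+: S(\hat t)y_0=0\}$ ($\inf\emptyset=\infty$). Sets. $\mathcal W=\{(T,y_0):0<T<\infty,\ y_0\in X\setminus\{0\}\}$; $\mathcal W_{2,2}=\{(T,y_0)\in\mathcal W:0<N(T^0(y_0),y_0)<\infty,\ T=T^0(y_0)\}$; $\mathcal W_{3,2}=\{(T,y_0)\in\mathcal W:N(T^0(y_0),y_0)=\infty,\ T^0(y_0)<\infty,\ T^0(y_0)<T<T^1(y_0)\}$; $\mathcal W_{3,3}=\{(T,y_0)\in\mathcal W:N(T^0(y_0),y_0)=\infty,\ T^0(y_0)<\infty,\ T^0(y_0)<T,\ T\ge T^1(y_0)\}$; $\gamma_1=\{(T^0(y_0),y_0)\in\mathcal W:0<N(T^0(y_0),y_0)<\infty\}$. $\mathcal V=\{(M,y_0):0<M<\infty,\ y_0\in X\setminus\{0\}\}$; $\mathcal V_{2,3}=\{(M,y_0)\in\mathcal V:0<N(T^0(y_0),y_0)<\infty,\ N(T^1(y_0),y_0)<M,\ M=N(T^0(y_0),y_0)\}$; $\mathcal V_{3,1}=\{(M,y_0)\in\mathcal V:N(T^0(y_0),y_0)=\infty,\ T^0(y_0)<\infty,\ M\le N(T^1(y_0),y_0)\}$; $\mathcal V_{3,2}=\{(M,y_0)\in\mathcal V:N(T^0(y_0),y_0)=\infty,\ T^0(y_0)<\infty,\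 M>N(T^1(y_0),y_0)\}$; $\gamma_2=\{(N(T^0(y_0),y_0),y_0)\in\mathcal V:0<N(T^0(y_0),y_0)<\infty,\ N(T^0(y_0),y_0)\ne N(T^1(y_0),y_0)\}$. *)

theory Defs
  imports "HOL-Analysis.Analysis" "HOL-Probability.Essential_Supremum"
begin

section \<open>Vector-valued functions\<close>

text \<open>
  The Hilbert spaces need not be separable, so strong measurability is defined as almost everywhere
  approximability by simple functions (Borel measurability would be weaker), and integrals
  of vector-valued functions are Henstock--Kurzweil integrals, which have no separability
  requirement and agree with the Bochner integral on every Bochner integrable function.
  Elements of Lebesgue spaces are represented by functions, and are compared almost everywhere.
\<close>

definition strongly_measurable :: "real measure \<Rightarrow> (real \<Rightarrow> 'u::real_normed_vector) \<Rightarrow> bool" where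
  "strongly_measurable M f \<longleftrightarrow>
     (\<exists>s. (\<forall>i::nat. simple_function M (s i)) \<and> (AE t in M. (\<lambda>i. s i t) \<longlonglongrightarrow> f t))"

definition L2 :: "real \<Rightarrow> (real \<Rightarrow> 'u::real_normed_vector) set" where
  "L2 T = {v. strongly_measurable (lebesgue_on {0<..<T}) v \<and>
              (\<lambda>t. (norm (v t))\<^sup>2) integrable_on {0..T}}"

definition L2_norm_on :: "real \<Rightarrow> (real \<Rightarrow> 'u::real_normed_vector) \<Rightarrow> real" where
  "L2_norm_on T v = sqrt (integral {0..T} (\<lambda>t. (norm (v t))\<^sup>2))"

definition L2_loc :: "(real \<Rightarrow> 'u::real_normed_vector) set" where
  "L2_loc = {u. \<forall>T>0. u \<in> L2 T}"

definition Linf_norm :: "real set \<Rightarrow> (real \<Rightarrow> 'u::real_normed_vector) \<Rightarrow> ereal" where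
  "Linf_norm I v = esssup (lebesgue_on I) (\<lambda>t. ereal (norm (v t)))"

definition Linf :: "real set \<Rightarrow> (real \<Rightarrow> 'u::real_normed_vector) set" where
  "Linf I = {v. strongly_measurable (lebesgue_on I) v \<and> Linf_norm I v < \<infinity>}"

section \<open>Semigroups and unbounded adjoints\<close>

definition C0_semigroup :: "(real \<Rightarrow> 'x::real_normed_vector \<Rightarrow>\<^sub>L 'x) \<Rightarrow> bool" where
  "C0_semigroup S \<longleftrightarrow> S 0 = id_blinfun \<and> (\<forall>s\<ge>0. \<forall>t\<ge>0. S (s + t) = S s o\<^sub>L S t) \<and>
     (\<forall>x. ((\<lambda>t. S t x) \<longlongrightarrow> x) (at_right 0))"

definition generates ::
  "'x set \<Rightarrow> ('x \<Rightarrow> 'x) \<Rightarrow> (real \<Rightarrow> 'x::real_normed_vector \<Rightarrow>\<^sub>L 'x) \<Rightarrow> bool" where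
  "generates D A S \<longleftrightarrow>
     D = {x. \<exists>y. ((\<lambda>h. (S h x - x) /\<^sub>R h) \<longlongrightarrow> y) (at_right 0)} \<and>
     (\<forall>x\<in>D. ((\<lambda>h. (S h x - x) /\<^sub>R h) \<longlongrightarrow> A x) (at_right 0))"

definition adj_dom :: "'x::real_inner set \<Rightarrow> ('x \<Rightarrow> 'x) \<Rightarrow> 'x set" where
  "adj_dom D A = {z. \<exists>w. \<forall>x\<in>D. A x \<bullet> z = x \<bullet> w}"

definition adj_op :: "'x::real_inner set \<Rightarrow> ('x \<Rightarrow> 'x) \<Rightarrow> 'x \<Rightarrow> 'x" where
  "adj_op D A z = (THE w. \<forall>x\<in>D. A x \<bullet> z = x \<bullet> w)"

text \<open>
  \<open>dual_pairing E n p\<close> says that \<open>f \<mapsto> p f\<close> identifies the normed space \<open>'v\<close> isometrically with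
  the space of all bounded linear functionals on the subspace \<open>E\<close> normed by \<open>n\<close>.
  Values of \<open>p f\<close> outside \<open>E\<close> are irrelevant.
\<close>

definition linear_functional_on :: "'x::real_vector set \<Rightarrow> ('x \<Rightarrow> real) \<Rightarrow> bool" where
  "linear_functional_on E \<phi> \<longleftrightarrow>
     (\<forall>z\<in>E. \<forall>w\<in>E. \<phi> (z + w) = \<phi> z + \<phi> w) \<and> (\<forall>c. \<forall>z\<in>E. \<phi> (c *\<^sub>R z) = c * \<phi> z)"

definition bounded_functional_on :: "'x set \<Rightarrow> ('x \<Rightarrow> real) \<Rightarrow> ('x \<Rightarrow> real) \<Rightarrow> bool" where
  "bounded_functional_on E n \<phi> \<longleftrightarrow> (\<exists>C. \<forall>z\<in>E. \<bar>\<phi> z\<bar> \<le> C * n z)"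

definition dual_pairing ::
  "'x::real_vector set \<Rightarrow> ('x \<Rightarrow> real) \<Rightarrow> ('v::real_normed_vector \<Rightarrow> 'x \<Rightarrow> real) \<Rightarrow> bool" where
  "dual_pairing E n p \<longleftrightarrow>
     (\<forall>f g. \<forall>z\<in>E. p (f + g) z = p f z + p g z) \<and>
     (\<forall>c f. \<forall>z\<in>E. p (c *\<^sub>R f) z = c * p f z) \<and>
     (\<forall>f. linear_functional_on E (p f) \<and> bounded_functional_on E n (p f) \<and>
          norm f = (SUP z\<in>{z\<in>E. n z \<le> 1}. \<bar>p f z\<bar>)) \<and>
     (\<forall>\<phi>. linear_functional_on E \<phi> \<and> bounded_functional_on E n \<phi> \<longrightarrow>
          (\<exists>f. \<forall>z\<in>E. p f z = \<phi> z))"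

section \<open>The control system\<close>

text \<open>
  The dual \<open>X\<^sub>-\<^sub>1 = D(A\<^sup>*)'\<close> depends on \<open>A\<close> and cannot be a function of the type of \<open>X\<close>; it is
  therefore an arbitrary Banach space \<open>'v\<close> together with a pairing \<open>dpair\<close> between \<open>'v\<close> and
  \<open>D(A\<^sup>*)\<close> that realizes \<open>'v\<close> as this dual.
\<close>

record (overloaded) ('x, 'u, 'v) control_system =
  dom :: "'x::real_normed_vector set"
  gen :: "'x \<Rightarrow> 'x"
  sgp :: "real \<Rightarrow> 'x \<Rightarrow>\<^sub>L 'x"
  dpair :: "'v::real_normed_vector \<Rightarrow> 'x \<Rightarrow> real"
  ctrl :: "'u::real_normed_vector \<Rightarrow>\<^sub>L 'v"

type_synonym ('x, 'u, 'v) csys = "('x, 'u, 'v) control_system"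

definition adj_domain ::
  "('x::{real_inner,banach}, 'u::{real_inner,banach}, 'v::banach) csys \<Rightarrow> 'x set" where
  "adj_domain P = adj_dom (dom P) (gen P)"

definition graph_norm ::
  "('x::{real_inner,banach}, 'u::{real_inner,banach}, 'v::banach) csys \<Rightarrow> 'x \<Rightarrow> real" where
  "graph_norm P z = sqrt ((norm z)\<^sup>2 + (norm (adj_op (dom P) (gen P) z))\<^sup>2)"

definition adj_sgp ::
  "('x::{real_inner,banach}, 'u::{real_inner,banach}, 'v::banach) csys \<Rightarrow> real \<Rightarrow> 'x \<Rightarrow> 'x" where
  "adj_sgp P t = adjoint (blinfun_apply (sgp P t))"

text \<open>The embedding of the pivot space \<open>X\<close> into \<open>X\<^sub>-\<^sub>1\<close>.\<close>

definition emb ::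
  "('x::{real_inner,banach}, 'u::{real_inner,banach}, 'v::banach) csys \<Rightarrow> 'x \<Rightarrow> 'v" where
  "emb P x = (THE f. \<forall>z\<in>adj_domain P. dpair P f z = x \<bullet> z)"

text \<open>The bounded extension \<open>S\<^sub>-\<^sub>1(t)\<close> of \<open>S(t)\<close> to \<open>X\<^sub>-\<^sub>1\<close>.\<close>

definition ext_sgp ::
  "('x::{real_inner,banach}, 'u::{real_inner,banach}, 'v::banach) csys \<Rightarrow> real \<Rightarrow> 'v \<Rightarrow>\<^sub>L 'v" where
  "ext_sgp P t = (THE R :: 'v \<Rightarrow>\<^sub>L 'v. \<forall>x. R (emb P x) = emb P (sgp P t x))"

definition adj_ctrl ::
  "('x::{real_inner,banach}, 'u::{real_inner,banach}, 'v::banach) csys \<Rightarrow> 'x \<Rightarrow> 'u" where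
  "adj_ctrl P z = (THE w. \<forall>u. dpair P (ctrl P u) z = u \<bullet> w)"

text \<open>
  For \<open>u\<close> in \<open>L2_loc\<close> the integrand is Bochner integrable in \<open>X\<^sub>-\<^sub>1\<close>, so that the integral below
  always exists in \<open>X\<^sub>-\<^sub>1\<close>; the requirement is that it is (the image of) an element of \<open>X\<close>,
  with the stated estimate.
\<close>

definition admissible_ctrl ::
  "('x::{real_inner,banach}, 'u::{real_inner,banach}, 'v::banach) csys \<Rightarrow> bool" where
  "admissible_ctrl P \<longleftrightarrow>
     (\<forall>T>0. \<exists>C>0. \<forall>u\<in>L2_loc. \<exists>x.
        ((\<lambda>\<tau>. ext_sgp P (T - \<tau>) (ctrl P (u \<tau>))) has_integral emb P x) {0..T} \<and>
        norm x \<le> C * L2_norm_on T u)"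

definition control_setting ::
  "('x::{real_inner,banach}, 'u::{real_inner,banach}, 'v::banach) csys \<Rightarrow> bool" where
  "control_setting P \<longleftrightarrow>
     C0_semigroup (sgp P) \<and> generates (dom P) (gen P) (sgp P) \<and>
     dual_pairing (adj_domain P) (graph_norm P) (dpair P) \<and>
     ctrl P \<noteq> 0 \<and> admissible_ctrl P"

text \<open>
  The state, as an element of \<open>X\<^sub>-\<^sub>1\<close>; by admissibility it lies in the image of the injective
  map \<open>emb P\<close>, so it vanishes in \<open>X\<^sub>-\<^sub>1\<close> iff it vanishes in \<open>X\<close>.
\<close>

definition state ::
  "('x::{real_inner,banach}, 'u::{real_inner,banach}, 'v::banach) csys \<Rightarrow> real \<Rightarrow> 'x \<Rightarrow>
     (real \<Rightarrow> 'u) \<Rightarrow> 'v" where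
  "state P t y0 v = emb P (sgp P t y0) +
     integral {0..t} (\<lambda>\<tau>. ext_sgp P (t - \<tau>) (ctrl P (v \<tau>)))"

text \<open>
  \<open>obs_extension P T G\<close>: \<open>G\<close> is a bounded linear operator from \<open>X\<close> to \<open>L\<^sup>2(0,T;U)\<close> (linear up to
  null sets) that extends \<open>z \<mapsto> B\<^sup>*S\<^sup>*(T-\<cdot>)z\<close>. It is unique up to null sets.
\<close>

definition obs_extension ::
  "('x::{real_inner,banach}, 'u::{real_inner,banach}, 'v::banach) csys \<Rightarrow> real \<Rightarrow>
     ('x \<Rightarrow> real \<Rightarrow> 'u) \<Rightarrow> bool" where
  "obs_extension P T G \<longleftrightarrow>
     (\<forall>z. G z \<in> L2 T) \<and>
     (\<forall>z w. AE t in lebesgue_on {0<..<T}. G (z + w) t = G z t + G w t) \<and>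
     (\<forall>c z. AE t in lebesgue_on {0<..<T}. G (c *\<^sub>R z) t = c *\<^sub>R G z t) \<and>
     (\<exists>C. \<forall>z. L2_norm_on T (G z) \<le> C * norm z) \<and>
     (\<forall>z\<in>adj_domain P.
        AE t in lebesgue_on {0<..<T}. G z t = adj_ctrl P (adj_sgp P (T - t) z))"

definition obs ::
  "('x::{real_inner,banach}, 'u::{real_inner,banach}, 'v::banach) csys \<Rightarrow> real \<Rightarrow>
     'x \<Rightarrow> real \<Rightarrow> 'u" where
  "obs P T = (SOME G. obs_extension P T G)"

section \<open>Minimal norm problems\<close>

definition NP_admissible ::
  "('x::{real_inner,banach}, 'u::{real_inner,banach}, 'v::banach) csys \<Rightarrow> real \<Rightarrow> 'x \<Rightarrow>
     (real \<Rightarrow> 'u) \<Rightarrow> bool" where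
  "NP_admissible P T y0 v \<longleftrightarrow> v \<in> Linf {0<..<T} \<and> state P T y0 v = 0"

definition NP_value ::
  "('x::{real_inner,banach}, 'u::{real_inner,banach}, 'v::banach) csys \<Rightarrow> real \<Rightarrow> 'x \<Rightarrow> ereal" where
  "NP_value P T y0 = Inf {Linf_norm {0<..<T} v | v. NP_admissible P T y0 v}"

text \<open>The function \<open>N(\<cdot>, y\<^sub>0)\<close> on \<open>[0,\<infinity>]\<close>.\<close>

definition min_norm ::
  "('x::{real_inner,banach}, 'u::{real_inner,banach}, 'v::banach) csys \<Rightarrow> ereal \<Rightarrow> 'x \<Rightarrow> ereal" where
  "min_norm P T y0 =
     (if T = \<infinity> then Lim at_top (\<lambda>t. NP_value P t y0)
      else if T = 0 then Lim (at_right 0) (\<lambda>t. NP_value P t y0)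
      else NP_value P (real_of_ereal T) y0)"

definition min_norm_control ::
  "('x::{real_inner,banach}, 'u::{real_inner,banach}, 'v::banach) csys \<Rightarrow> real \<Rightarrow> 'x \<Rightarrow>
     (real \<Rightarrow> 'u) \<Rightarrow> bool" where
  "min_norm_control P T y0 v \<longleftrightarrow>
     NP_admissible P T y0 v \<and> Linf_norm {0<..<T} v = min_norm P (ereal T) y0"

definition NP_bang_bang ::
  "('x::{real_inner,banach}, 'u::{real_inner,banach}, 'v::banach) csys \<Rightarrow> real \<Rightarrow> 'x \<Rightarrow> bool" where
  "NP_bang_bang P T y0 \<longleftrightarrow>
     (\<exists>v. NP_admissible P T y0 v) \<and>
     (\<forall>v. min_norm_control P T y0 v \<longrightarrow>
        (AE t in lebesgue_on {0<..<T}. ereal (norm (v t)) = min_norm P (ereal T) y0))"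

section \<open>Minimal time problems\<close>

definition controls_bounded_by :: "real \<Rightarrow> (real \<Rightarrow> 'u::real_normed_vector) set" where
  "controls_bounded_by M = {u. strongly_measurable (lebesgue_on {0..}) u \<and>
     (AE t in lebesgue_on {0..}. norm (u t) \<le> M)}"

definition TP_admissible ::
  "('x::{real_inner,banach}, 'u::{real_inner,banach}, 'v::banach) csys \<Rightarrow> real \<Rightarrow> 'x \<Rightarrow>
     (real \<Rightarrow> 'u) \<Rightarrow> bool" where
  "TP_admissible P M y0 u \<longleftrightarrow> u \<in> controls_bounded_by M \<and> (\<exists>t>0. state P t y0 u = 0)"

definition min_time ::
  "('x::{real_inner,banach}, 'u::{real_inner,banach}, 'v::banach) csys \<Rightarrow> real \<Rightarrow> 'x \<Rightarrow> ereal" where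
  "min_time P M y0 =
     Inf {ereal t | t. 0 < t \<and> (\<exists>u\<in>controls_bounded_by M. state P t y0 u = 0)}"

definition min_time_control ::
  "('x::{real_inner,banach}, 'u::{real_inner,banach}, 'v::banach) csys \<Rightarrow> real \<Rightarrow> 'x \<Rightarrow>
     (real \<Rightarrow> 'u) \<Rightarrow> bool" where
  "min_time_control P M y0 u \<longleftrightarrow>
     min_time P M y0 < \<infinity> \<and> u \<in> controls_bounded_by M \<and>
     state P (real_of_ereal (min_time P M y0)) y0 u = 0 \<and>
     (AE t in lebesgue. min_time P M y0 < ereal t \<longrightarrow> u t = 0)"

definition TP_bang_bang ::
  "('x::{real_inner,banach}, 'u::{real_inner,banach}, 'v::banach) csys \<Rightarrow> real \<Rightarrow> 'x \<Rightarrow> bool" where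
  "TP_bang_bang P M y0 \<longleftrightarrow>
     (\<exists>u. TP_admissible P M y0 u) \<and>
     (\<forall>u. min_time_control P M y0 u \<longrightarrow>
        (AE t in lebesgue. 0 < t \<and> ereal t < min_time P M y0 \<longrightarrow> norm (u t) = M))"

section \<open>Critical times and the decompositions\<close>

definition T0 ::
  "('x::{real_inner,banach}, 'u::{real_inner,banach}, 'v::banach) csys \<Rightarrow> 'x \<Rightarrow> ereal" where
  "T0 P y0 = Inf {ereal t | t. 0 \<le> t \<and> (\<exists>u\<in>Linf {0..}. state P t y0 u = 0)}"

definition T1 ::
  "('x::{real_inner,banach}, 'u::{real_inner,banach}, 'v::banach) csys \<Rightarrow> 'x \<Rightarrow> ereal" where
  "T1 P y0 = Inf {ereal t | t. 0 \<le> t \<and> sgp P t y0 = 0}"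

definition W_all ::
  "('x::{real_inner,banach}, 'u::{real_inner,banach}, 'v::banach) csys \<Rightarrow> (real \<times> 'x) set" where
  "W_all P = {(T, y0). 0 < T \<and> y0 \<noteq> 0}"

definition W22 ::
  "('x::{real_inner,banach}, 'u::{real_inner,banach}, 'v::banach) csys \<Rightarrow> (real \<times> 'x) set" where
  "W22 P = {(T, y0) \<in> W_all P.
     0 < min_norm P (T0 P y0) y0 \<and> min_norm P (T0 P y0) y0 < \<infinity> \<and> ereal T = T0 P y0}"

definition W32 ::
  "('x::{real_inner,banach}, 'u::{real_inner,banach}, 'v::banach) csys \<Rightarrow> (real \<times> 'x) set" where
  "W32 P = {(T, y0) \<in> W_all P.
     min_norm P (T0 P y0) y0 = \<infinity> \<and> T0 P y0 < \<infinity> \<and> T0 P y0 < ereal T \<and> ereal T < T1 P y0}"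

definition W33 ::
  "('x::{real_inner,banach}, 'u::{real_inner,banach}, 'v::banach) csys \<Rightarrow> (real \<times> 'x) set" where
  "W33 P = {(T, y0) \<in> W_all P.
     min_norm P (T0 P y0) y0 = \<infinity> \<and> T0 P y0 < \<infinity> \<and> T0 P y0 < ereal T \<and> T1 P y0 \<le> ereal T}"

definition gamma1 ::
  "('x::{real_inner,banach}, 'u::{real_inner,banach}, 'v::banach) csys \<Rightarrow> (real \<times> 'x) set" where
  "gamma1 P = {(T, y0). (T, y0) \<in> W_all P \<and> ereal T = T0 P y0 \<and>
     0 < min_norm P (T0 P y0) y0 \<and> min_norm P (T0 P y0) y0 < \<infinity>}"

definition V_all ::
  "('x::{real_inner,banach}, 'u::{real_inner,banach}, 'v::banach) csys \<Rightarrow> (real \<times> 'x) set" where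
  "V_all P = {(M, y0). 0 < M \<and> y0 \<noteq> 0}"

definition V23 ::
  "('x::{real_inner,banach}, 'u::{real_inner,banach}, 'v::banach) csys \<Rightarrow> (real \<times> 'x) set" where
  "V23 P = {(M, y0) \<in> V_all P.
     0 < min_norm P (T0 P y0) y0 \<and> min_norm P (T0 P y0) y0 < \<infinity> \<and>
     min_norm P (T1 P y0) y0 < ereal M \<and> ereal M = min_norm P (T0 P y0) y0}"

definition V31 ::
  "('x::{real_inner,banach}, 'u::{real_inner,banach}, 'v::banach) csys \<Rightarrow> (real \<times> 'x) set" where
  "V31 P = {(M, y0) \<in> V_all P.
     min_norm P (T0 P y0) y0 = \<infinity> \<and> T0 P y0 < \<infinity> \<and> ereal M \<le> min_norm P (T1 P y0) y0}"

definition V32 ::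
  "('x::{real_inner,banach}, 'u::{real_inner,banach}, 'v::banach) csys \<Rightarrow> (real \<times> 'x) set" where
  "V32 P = {(M, y0) \<in> V_all P.
     min_norm P (T0 P y0) y0 = \<infinity> \<and> T0 P y0 < \<infinity> \<and> min_norm P (T1 P y0) y0 < ereal M}"

definition gamma2 ::
  "('x::{real_inner,banach}, 'u::{real_inner,banach}, 'v::banach) csys \<Rightarrow> (real \<times> 'x) set" where
  "gamma2 P = {(M, y0). (M, y0) \<in> V_all P \<and> ereal M = min_norm P (T0 P y0) y0 \<and>
     0 < min_norm P (T0 P y0) y0 \<and> min_norm P (T0 P y0) y0 < \<infinity> \<and>
     min_norm P (T0 P y0) y0 \<noteq> min_norm P (T1 P y0) y0}"

section \<open>The two conditions\<close>

definition cond_c ::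
  "('x::{real_inner,banach}, 'u::{real_inner,banach}, 'v::banach) csys \<Rightarrow> bool" where
  "cond_c P \<longleftrightarrow>
     (\<forall>T>0. \<exists>C1>0. \<forall>z\<in>adj_domain P.
        norm (adj_sgp P T z) \<le>
          C1 * integral {0..T} (\<lambda>t. norm (adj_ctrl P (adj_sgp P (T - t) z))))"

definition cond_d ::
  "('x::{real_inner,banach}, 'u::{real_inner,banach}, 'v::banach) csys \<Rightarrow> bool" where
  "cond_d P \<longleftrightarrow>
     (\<forall>z. \<forall>T>0. \<forall>E. E \<in> sets lebesgue \<and> E \<subseteq> {0<..<T} \<and> 0 < emeasure lebesgue E \<and>
        (AE t in lebesgue_on E. obs P T z t = 0) \<longrightarrow>
        (AE t in lebesgue_on {0<..<T}. obs P T z t = 0))"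

end

theory Submission
  imports Defs
begin

text \<open>
  Under (c), duality gives bounded null controls in any positive time with cost proportional to the initial state:
  the image of a ball of \<open>L\<^sup>\<infinity>\<close> under the input map is closed and convex in the Hilbert space \<open>X\<close>, so a target
  outside it is separated from it by some \<open>z\<close>, which contradicts the \<open>L\<^sup>1\<close> observability inequality.
  Hence \<open>T\<^sup>0 = 0\<close>, and since controls of bounded size act little in a short time, the minimal norm blows up at \<open>0\<close>; this is (i).
  Null controls of small cost also make the minimal norm function left continuous, and strictly decreasing while it is
  positive, which reduces time optimal to norm optimal problems.

  For the bang-bang property, separate the target from slightly smaller balls. The separating directions, normalized in \<open>L\<^sup>1\<close>
  of the observation, form nested convex sets which (c) keeps bounded in \<open>X\<close> after an arbitrarily short time.
  Elements of almost minimal norm converge strongly, to a state whose observation vanishes wherever the optimal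
  control is not extremal, so (d) and (c) apply to it.
\<close>

section \<open>Hilbert space preliminaries\<close>

text \<open>Condition (c) bounds \<open>S' T z\<close>, not \<open>z\<close>, by the
  \<open>L^1\<close> norm of the observation. Separating directions normalized in that norm may be
  unbounded in the state space, and an \<open>L^1\<close> limit of their observations need not come
  from any state, so that (d) could not be applied to it. Giving up the last \<open>T - R\<close>
  units of time repairs both: with \<tau> = \<open>T - R\<close> the states
  \<open>S' \<tau> z\<close> are bounded, and their observation over \<open>(0,R)\<close> is the
  restriction of that of \<open>z\<close> over \<open>(0,T)\<close>. The conclusion is thus obtained
  on \<open>(0,R)\<close> for each \<open>R < T\<close>, and \<open>(0,T)\<close> is exhausted
  afterwards. The norm in (c) is the right one because \<open>M\<close> times the \<open>L^1\<close>
  norm of the observation is the support function of the set of states that controls bounded by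
  \<open>M\<close> can produce. Separation is tested on \<open>D'\<close> only, where the
  observation is a continuous function of time and no null sets interfere. The extension
  \<open>obs\<close>, known only up to null sets, enters where (d) is applied to the limit state,
  which may lie outside \<open>D'\<close>.\<close>

text \<open>The parallelogram identity turns near-minimizers of a quadratic functional into Cauchy
  sequences. This replaces every use of weak compactness below.\<close>

lemma nested_minimizing_sequence:
  fixes C :: "nat \<Rightarrow> 'a set" and I :: "'a \<Rightarrow> real"
  assumes ne: "\<And>n. C n \<noteq> {}" and decr: "\<And>m n. m \<le> n \<Longrightarrow> C n \<subseteq> C m"
    and lb: "\<And>x. x \<in> C 0 \<Longrightarrow> L \<le> I x" and ub: "\<And>n. \<exists>x\<in>C n. I x \<le> B"
    and mid: "\<And>n x y. x \<in> C n \<Longrightarrow> y \<in> C n \<Longrightarrow> mid x y \<in> C n"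
    and par: "\<And>x y. x \<in> C 0 \<Longrightarrow> y \<in> C 0 \<Longrightarrow> d x y = 2 * I x + 2 * I y - 4 * I (mid x y)"
  shows "\<exists>w. (\<forall>n. w n \<in> C n) \<and> (\<forall>e>0. \<exists>N. \<forall>m\<ge>N. \<forall>n\<ge>N. d (w m) (w n) < e) \<and>
     (\<forall>n. \<forall>x\<in>C n. I (w n) < I x + inverse (real (Suc n)))"
proof -
  define i where "i n = Inf (I ` C n)" for n
  have sub0: "C n \<subseteq> C 0" for n using decr by simp
  have bdd: "bdd_below (I ` C n)" for n
    using lb sub0 by (intro bdd_belowI[of _ L]) blast
  have i_le: "i n \<le> I x" if "x \<in> C n" for n x
    unfolding i_def using that bdd by (intro cInf_lower) auto
  have "\<exists>x\<in>C n. I x < i n + inverse (real (Suc n))" for n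
  proof -
    have "Inf (I ` C n) < i n + inverse (real (Suc n))" unfolding i_def by simp
    then show ?thesis using cInf_less_iff[of "I ` C n"] ne bdd by auto
  qed
  then obtain w where w: "\<And>n. w n \<in> C n" "\<And>n. I (w n) < i n + inverse (real (Suc n))"
    by metis
  have inc: "i m \<le> i n" if "m \<le> n" for m n
    unfolding i_def using that decr ne bdd by (intro cInf_superset_mono image_mono) auto
  have iB: "i n \<le> B" for n using ub[of n] i_le by force
  obtain l where l: "i \<longlonglongrightarrow> l"
  proof (rule incseq_convergent[of i B])
    show "incseq i" using inc by (simp add: incseq_def)
  qed (use iB in auto)
  have il: "i n \<le> l" for n
    using inc by (intro LIMSEQ_le_const[OF l]) auto
  have "\<exists>N. \<forall>m\<ge>N. \<forall>n\<ge>N. d (w m) (w n) < e" if "e > 0" for e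
  proof -
    \<comment> \<open>The infima \<open>i n\<close> increase to \<open>l\<close> since the sets
      shrink. For \<open>m, n \<ge> N\<close> the midpoint of \<open>w m\<close> and
      \<open>w n\<close> lies in \<open>C N\<close>, where \<open>I\<close> is at least
      \<open>i N\<close>, so the parallelogram identity bounds the distance by the
      \<open>N\<close>-th term of this null sequence.\<close>
    have "(\<lambda>n. 4 * l + 4 * inverse (real (Suc n)) - 4 * i n) \<longlonglongrightarrow> 4 * l + 4 * 0 - 4 * l"
      by (intro tendsto_intros l LIMSEQ_inverse_real_of_nat)
    then have "\<forall>\<^sub>F n in sequentially. 4 * l + 4 * inverse (real (Suc n)) - 4 * i n < e"
      by (rule order_tendstoD) (use that in simp)
    then obtain N where N: "4 * l + 4 * inverse (real (Suc N)) - 4 * i N < e"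
      by (meson eventually_sequentially le_refl)
    show ?thesis
    proof (intro exI allI impI)
      fix m n assume mn: "N \<le> m" "N \<le> n"
      have in0: "w m \<in> C 0" "w n \<in> C 0" using w sub0 by auto
      have "w m \<in> C N" "w n \<in> C N" using w mn decr by blast+
      then have 1: "i N \<le> I (mid (w m) (w n))" by (intro i_le mid)
      have 2: "I (w k) < l + inverse (real (Suc N))" if "N \<le> k" for k
      proof -
        have "inverse (real (Suc k)) \<le> inverse (real (Suc N))"
          using that by (intro le_imp_inverse_le) auto
        with w(2)[of k] il[of k] show ?thesis by linarith
      qed
      show "d (w m) (w n) < e"
        using par[OF in0] 1 2[OF mn(1)] 2[OF mn(2)] N by linarith
    qed
  qed
  moreover have "I (w n) < I x + inverse (real (Suc n))" if "x \<in> C n" for n x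
    using w(2)[of n] i_le[OF that] by linarith
  ultimately show ?thesis using w by blast
qed

lemma norm_parallelogram:
  fixes x y :: "'a::real_inner"
  shows "(norm (x - y))\<^sup>2 = 2 * (norm x)\<^sup>2 + 2 * (norm y)\<^sup>2 - 4 * (norm ((1/2) *\<^sub>R (x + y)))\<^sup>2"
  by (simp add: power2_norm_eq_inner inner_simps inner_commute algebra_simps)

text \<open>First variation at a minimum: divide by \<open>t\<close> and let \<open>t\<close> tend
  to 0. It yields both the Riesz representation and the angle inequality for projections.\<close>

lemma quadratic_nonneg_imp_linear_nonneg:
  fixes a b :: real
  assumes "\<And>t. 0 < t \<Longrightarrow> t \<le> 1 \<Longrightarrow> 0 \<le> a * t + b * t\<^sup>2"
  shows "0 \<le> a"
proof -
  have "((\<lambda>t. a + b * t) \<longlongrightarrow> a + b * 0) (at_right 0)" by (intro tendsto_intros)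
  moreover have "\<forall>\<^sub>F t in at_right 0. 0 \<le> a + b * t"
  proof (rule eventually_at_rightI[of 0 1])
    fix t :: real assume "t \<in> {0<..<1}"
    then have t: "0 < t" "t \<le> 1" by auto
    have "0 \<le> t * (a + b * t)" using assms[OF t] by (simp add: algebra_simps power2_eq_square)
    with t show "0 \<le> a + b * t" by (simp add: zero_le_mult_iff)
  qed simp
  ultimately show ?thesis
    using tendsto_lowerbound[of "\<lambda>t. a + b * t" "a + b * 0" "at_right 0" 0]
      trivial_limit_at_right_real[of "0::real"] by simp
qed

lemma Cauchy_if_norm_sq:
  fixes w :: "nat \<Rightarrow> 'a::real_normed_vector"
  assumes "\<forall>e>0. \<exists>N. \<forall>m\<ge>N. \<forall>n\<ge>N. (norm (w m - w n))\<^sup>2 < e"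
  shows "Cauchy w"
  unfolding Cauchy_def
proof (intro allI impI)
  fix e :: real assume "e > 0"
  then obtain N where N: "\<forall>m\<ge>N. \<forall>n\<ge>N. (norm (w m - w n))\<^sup>2 < e\<^sup>2"
    using assms by (meson zero_less_power)
  then show "\<exists>N. \<forall>m\<ge>N. \<forall>n\<ge>N. dist (w m) (w n) < e"
    using power2_less_imp_less[of _ e] \<open>e > 0\<close> by (metis dist_norm less_imp_le)
qed

text \<open>A minimizing sequence of \<open>|x|^2 - 2 \<phi> x\<close> in \<open>E\<close> is
  Cauchy. At its limit, a point of the closure of \<open>E\<close>, the first variation in each
  direction of \<open>E\<close> is nonnegative, and replacing \<open>z\<close> by \<open>-z\<close>
  turns this into the equality.\<close>

lemma riesz_on_subspace:
  fixes E :: "'a::{real_inner,banach} set"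
  assumes E: "subspace E" and lin: "linear_functional_on E \<phi>"
    and bound: "\<And>z. z \<in> E \<Longrightarrow> \<bar>\<phi> z\<bar> \<le> K * norm z"
  shows "\<exists>w. \<forall>z\<in>E. \<phi> z = z \<bullet> w"
proof -
  have add: "\<phi> (x + y) = \<phi> x + \<phi> y" and scale: "\<phi> (c *\<^sub>R x) = c * \<phi> x"
    if "x \<in> E" "y \<in> E" for x y c
    using lin that by (auto simp: linear_functional_on_def)
  define I where "I x = (norm x)\<^sup>2 - 2 * \<phi> x" for x
  have "\<exists>w. (\<forall>n::nat. w n \<in> E) \<and> (\<forall>e>0. \<exists>N. \<forall>m\<ge>N. \<forall>n\<ge>N. (norm (w m - w n))\<^sup>2 < e) \<and>
     (\<forall>n. \<forall>x\<in>E. I (w n) < I x + inverse (real (Suc n)))"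
  proof (rule nested_minimizing_sequence[where mid = "\<lambda>x y. (1/2) *\<^sub>R (x + y)" and L = "- K\<^sup>2" and B = 0])
    show "- K\<^sup>2 \<le> I x" if "x \<in> E" for x
    proof -
      have "0 \<le> (norm x - K)\<^sup>2" by simp
      then show ?thesis using bound[OF that] by (simp add: I_def power2_eq_square algebra_simps)
    qed
    show "\<exists>x\<in>E. I x \<le> 0"
      using subspace_0[OF E] scale[of 0 0 0] by (intro bexI[of _ 0]) (auto simp: I_def)
    show "(norm (x - y))\<^sup>2 = 2 * I x + 2 * I y - 4 * I ((1/2) *\<^sub>R (x + y))" if "x \<in> E" "y \<in> E" for x y
    proof -
      define q where "q = (1/2) *\<^sub>R (x + y)"
      have "\<phi> q = (1/2) * (\<phi> x + \<phi> y)"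
        using that E unfolding q_def by (simp only: add scale subspace_add)
      moreover have "(norm (x - y))\<^sup>2 = 2 * (norm x)\<^sup>2 + 2 * (norm y)\<^sup>2 - 4 * (norm q)\<^sup>2"
        unfolding q_def by (rule norm_parallelogram)
      ultimately show ?thesis unfolding I_def q_def[symmetric] by argo
    qed
  qed (use E in \<open>auto simp: subspace_add subspace_scale dest: subspace_0 simp del: scaleR_add_right\<close>)
  then obtain w where w: "\<And>n::nat. w n \<in> E" "Cauchy w"
      "\<And>n x. x \<in> E \<Longrightarrow> I (w n) < I x + inverse (real (Suc n))"
    using Cauchy_if_norm_sq by metis
  obtain p where p: "w \<longlonglongrightarrow> p" using w(2) Cauchy_convergent_iff convergent_def by blast
  have ge: "\<phi> z \<le> z \<bullet> p" if z: "z \<in> E" for z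
  proof -
    have "0 \<le> 2 * (z \<bullet> p - \<phi> z)"
    proof (rule quadratic_nonneg_imp_linear_nonneg[where b = "(norm z)\<^sup>2"])
      fix t :: real assume "0 < t" "t \<le> 1"
      have *: "- inverse (real (Suc n)) \<le> 2 * (z \<bullet> w n - \<phi> z) * t + (norm z)\<^sup>2 * t\<^sup>2" for n
      proof -
        have "I (w n) < I (w n + t *\<^sub>R z) + inverse (real (Suc n))"
          using w(1) z E by (intro w(3)) (simp add: subspace_add subspace_scale)
        moreover have "I (w n + t *\<^sub>R z) = I (w n) + 2 * (z \<bullet> w n - \<phi> z) * t + (norm z)\<^sup>2 * t\<^sup>2"
          using w(1) z E unfolding I_def
          by (simp add: add scale subspace_scale power2_norm_eq_inner inner_simps inner_commute
                algebra_simps power2_eq_square[of t])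
        ultimately show ?thesis by linarith
      qed
      have lim1: "(\<lambda>n. 2 * (z \<bullet> w n - \<phi> z) * t + (norm z)\<^sup>2 * t\<^sup>2) \<longlonglongrightarrow>
          2 * (z \<bullet> p - \<phi> z) * t + (norm z)\<^sup>2 * t\<^sup>2"
        by (intro tendsto_intros p)
      have lim2: "(\<lambda>n. - inverse (real (Suc n))) \<longlonglongrightarrow> - 0"
        by (intro tendsto_minus LIMSEQ_inverse_real_of_nat)
      have "- 0 \<le> 2 * (z \<bullet> p - \<phi> z) * t + (norm z)\<^sup>2 * t\<^sup>2"
        by (rule LIMSEQ_le[OF lim2 lim1]) (use * in blast)
      then show "0 \<le> 2 * (z \<bullet> p - \<phi> z) * t + (norm z)\<^sup>2 * t\<^sup>2" by simp
    qed
    then show ?thesis by simp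
  qed
  have "\<phi> z = z \<bullet> p" if z: "z \<in> E" for z
    using ge[OF z] ge[of "(-1) *\<^sub>R z"] scale[OF z z, of "-1"] E z subspace_scale[OF E z, of "-1"] by simp
  then show ?thesis by blast
qed

text \<open>The point \<open>p\<close> is the limit of a sequence minimizing the distance to
  \<open>x\<close>. Comparing \<open>p\<close> with the segment from \<open>p\<close> to
  \<open>c\<close>, which stays in the closure by convexity, gives the obtuse angle.\<close>

lemma exists_projection:
  fixes C :: "'a::{real_inner,banach} set"
  assumes C: "convex C" "C \<noteq> {}"
  shows "\<exists>p\<in>closure C. \<forall>c\<in>C. (x - p) \<bullet> (c - p) \<le> 0"
proof -
  define I where "I c = (norm (x - c))\<^sup>2" for c
  obtain c0 where c0: "c0 \<in> C" using C by blast
  have "\<exists>w. (\<forall>n::nat. w n \<in> C) \<and> (\<forall>e>0. \<exists>N. \<forall>m\<ge>N. \<forall>n\<ge>N. (norm (w m - w n))\<^sup>2 < e) \<and>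
     (\<forall>n. \<forall>x\<in>C. I (w n) < I x + inverse (real (Suc n)))"
  proof (rule nested_minimizing_sequence[where mid = "\<lambda>x y. (1/2) *\<^sub>R (x + y)" and L = 0 and B = "I c0"])
    show "(1/2) *\<^sub>R (y + z) \<in> C" if "y \<in> C" "z \<in> C" for y z
      using convexD[OF C(1) that, of "1/2" "1/2"] by (simp add: scaleR_add_right)
    show "(norm (y - z))\<^sup>2 = 2 * I y + 2 * I z - 4 * I ((1/2) *\<^sub>R (y + z))" for y z
      unfolding I_def by (simp add: power2_norm_eq_inner inner_simps inner_commute algebra_simps)
  qed (use C c0 in \<open>auto simp: I_def\<close>)
  then obtain w where w: "\<And>n::nat. w n \<in> C" "Cauchy w"
      "\<And>n x. x \<in> C \<Longrightarrow> I (w n) < I x + inverse (real (Suc n))"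
    using Cauchy_if_norm_sq by metis
  obtain p where p: "w \<longlonglongrightarrow> p" using w(2) Cauchy_convergent_iff convergent_def by blast
  have pC: "p \<in> closure C" using p w(1) closure_sequential by blast
  have min: "I p \<le> I c" if "c \<in> C" for c
  proof -
    have "(\<lambda>n. I (w n)) \<longlonglongrightarrow> I p" unfolding I_def by (intro tendsto_intros p)
    moreover have "(\<lambda>n. I c + inverse (real (Suc n))) \<longlonglongrightarrow> I c + 0"
      by (intro tendsto_intros LIMSEQ_inverse_real_of_nat)
    ultimately show ?thesis using LIMSEQ_le[of _ "I p" _ "I c + 0"] w(3)[OF that]
      by (simp add: less_imp_le)
  qed
  have min': "I p \<le> I c" if "c \<in> closure C" for c
  proof -
    obtain y where y: "\<And>n. y n \<in> C" "y \<longlonglongrightarrow> c" using \<open>c \<in> closure C\<close> closure_sequential by blast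
    have "(\<lambda>n. I (y n)) \<longlonglongrightarrow> I c" unfolding I_def by (intro tendsto_intros y)
    then show ?thesis using min y(1) by (intro LIMSEQ_le_const) auto
  qed
  have "(x - p) \<bullet> (c - p) \<le> 0" if c: "c \<in> C" for c
  proof -
    have "0 \<le> - 2 * ((x - p) \<bullet> (c - p))"
    proof (rule quadratic_nonneg_imp_linear_nonneg[where b = "(norm (c - p))\<^sup>2"])
      fix t :: real assume t: "0 < t" "t \<le> 1"
      have "(1 - t) *\<^sub>R p + t *\<^sub>R c \<in> closure C"
        using t c pC closure_subset[of C] by (intro convexD convex_closure C) auto
      from min'[OF this] have "I p \<le> I (p + t *\<^sub>R (c - p))" by (simp add: algebra_simps)
      moreover have "I (p + t *\<^sub>R (c - p)) = I p + (- 2 * ((x - p) \<bullet> (c - p)) * t + (norm (c - p))\<^sup>2 * t\<^sup>2)"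
        unfolding I_def
        by (simp add: power2_norm_eq_inner inner_simps inner_commute algebra_simps power2_eq_square[of t])
      ultimately show "0 \<le> - 2 * ((x - p) \<bullet> (c - p)) * t + (norm (c - p))\<^sup>2 * t\<^sup>2" by linarith
    qed
    then show ?thesis by simp
  qed
  then show ?thesis using pC by blast
qed

text \<open>Project \<open>x\<close> onto the closure. Since \<open>E\<close> is invariant under
  scaling, the angle inequality at \<open>p\<close> forces \<open>x - p\<close> to be orthogonal to
  \<open>E\<close>, hence zero.\<close>

lemma dense_subspaceI:
  fixes E :: "'a::{real_inner,banach} set"
  assumes E: "subspace E" and orth: "\<And>x. (\<And>z. z \<in> E \<Longrightarrow> x \<bullet> z = 0) \<Longrightarrow> x = 0"
  shows "closure E = UNIV"
proof -
  have "x \<in> closure E" for x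
  proof -
    obtain p where p: "p \<in> closure E" "\<And>c. c \<in> E \<Longrightarrow> (x - p) \<bullet> (c - p) \<le> 0"
      using exists_projection[of E x] subspace_imp_convex[OF E] subspace_0[OF E] by blast
    have bound: "(x - p) \<bullet> c \<le> 0" if c: "c \<in> E" for c
    proof (rule ccontr)
      assume "\<not> ?thesis"
      then have pos: "(x - p) \<bullet> c > 0" by simp
      define s where "s = (\<bar>(x - p) \<bullet> p\<bar> + 1) / ((x - p) \<bullet> c)"
      have "s *\<^sub>R c \<in> E" using c E by (simp add: subspace_scale)
      from p(2)[OF this] have "s * ((x - p) \<bullet> c) \<le> (x - p) \<bullet> p" by (simp add: inner_diff_right)
      then show False using pos by (simp add: s_def)
    qed
    have "(x - p) \<bullet> c = 0" if c: "c \<in> E" for c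
      using bound[OF c] bound[of "-c"] c E by (simp add: subspace_neg)
    then have "x - p = 0" by (rule orth)
    then show ?thesis using p(1) by simp
  qed
  then show ?thesis by auto
qed

text \<open>\<open>adjoint\<close> is a choice operator and has its meaning only once some adjoint
  is known to exist; the Riesz representation supplies one.\<close>

lemma adjoint_hilbert:
  fixes f :: "'a::{real_inner,banach} \<Rightarrow>\<^sub>L 'b::{real_inner,banach}"
  shows "f x \<bullet> y = x \<bullet> adjoint (blinfun_apply f) y"
proof -
  have "\<exists>w. \<forall>x. f x \<bullet> y = x \<bullet> w" for y
  proof -
    have "\<exists>w. \<forall>x\<in>UNIV. f x \<bullet> y = x \<bullet> w"
    proof (rule riesz_on_subspace[where K = "norm f * norm y"])
      show "linear_functional_on UNIV (\<lambda>x. f x \<bullet> y)"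
        by (simp add: linear_functional_on_def blinfun.add_right blinfun.scaleR_right inner_left_distrib)
      show "\<bar>f z \<bullet> y\<bar> \<le> norm f * norm y * norm z" for z
      proof -
        have "\<bar>f z \<bullet> y\<bar> \<le> norm (f z) * norm y" by (rule Cauchy_Schwarz_ineq2)
        also have "\<dots> \<le> norm f * norm z * norm y"
          by (intro mult_right_mono norm_blinfun) simp
        finally show ?thesis by (simp add: ac_simps)
      qed
    qed simp
    then show ?thesis by simp
  qed
  then obtain g where g: "\<forall>x y. f x \<bullet> y = x \<bullet> g y" by metis
  show ?thesis unfolding adjoint_def using someI[of "\<lambda>g. \<forall>x y. f x \<bullet> y = x \<bullet> g y", OF g] by blast
qed

text \<open>A gliding hump instead of Baire category. Operators of norm above \<open>4^k\<close> are
  met at points moved by at most \<open>3^-k\<close>. The later moves displace the limit by at most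
  half of \<open>3^-k\<close>, and \<open>2/3 - 1/2 = 1/6\<close> of the hump survives, so the orbit
  of the limit exceeds \<open>(4/3)^k / 6\<close> for every \<open>k\<close>.\<close>

lemma uniform_boundedness:
  fixes F :: "nat \<Rightarrow> 'a::banach \<Rightarrow>\<^sub>L 'b::real_normed_vector"
  assumes pw: "\<And>x. Bseq (\<lambda>n. F n x)"
  shows "Bseq F"
proof (rule ccontr)
  assume nb: "\<not> Bseq F"
  have "\<exists>n. 4 ^ k < norm (F n)" for k :: nat
  proof (rule ccontr)
    assume "\<not> ?thesis"
    then have "\<And>n. norm (F n) \<le> 4 ^ k" by (simp add: not_less)
    then show False using nb BseqI' by blast
  qed
  then obtain n where n: "\<And>k::nat. 4 ^ k < norm (F (n k))" by metis
  have step: "\<exists>y. norm (y - x) \<le> (1/3) ^ k \<and> (2/3) * (1/3) ^ k * norm (F (n k)) \<le> norm (F (n k) y)"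
    for x and k :: nat
  proof -
    let ?T = "F (n k)" and ?r = "(1/3::real) ^ k"
    have pos: "norm ?T > 0" using n[of k] by (meson less_trans zero_less_numeral zero_less_power)
    have "\<exists>\<xi>. norm \<xi> \<le> 1 \<and> 2/3 * norm ?T \<le> norm (?T \<xi>)"
    proof (rule ccontr)
      assume contra: "\<not> ?thesis"
      have "norm ?T \<le> 2/3 * norm ?T"
      proof (rule norm_blinfun_bound)
        show "norm (?T x) \<le> 2/3 * norm ?T * norm x" for x
        proof (cases "x = 0")
          case False
          have "norm (?T (x /\<^sub>R norm x)) \<le> 2/3 * norm ?T"
            using contra[simplified, rule_format, of "x /\<^sub>R norm x"] False by simp
          with False show ?thesis by (simp add: blinfun.scaleR_right field_simps)
        qed simp
      qed simp
      with pos show False by simp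
    qed
    then obtain \<xi> where \<xi>: "norm \<xi> \<le> 1" "2/3 * norm ?T \<le> norm (?T \<xi>)" by blast
    have big: "(2/3) * ?r * norm ?T \<le> ?r * norm (?T \<xi>)" using \<xi>(2)
      by (simp add: mult.commute mult.left_commute)
    \<comment> \<open>The images of the two points \<open>x + r \<xi>\<close> and
      \<open>x - r \<xi>\<close> differ by twice the image of \<open>r \<xi>\<close>, so one of them
      is at least as large as the latter.\<close>
    have "2 * (?r * norm (?T \<xi>)) = norm (?T (x + ?r *\<^sub>R \<xi>) - ?T (x - ?r *\<^sub>R \<xi>))"
      by (simp add: blinfun.add_right blinfun.diff_right blinfun.scaleR_right flip: scaleR_2)
    also have "\<dots> \<le> norm (?T (x + ?r *\<^sub>R \<xi>)) + norm (?T (x - ?r *\<^sub>R \<xi>))" by (rule norm_triangle_ineq4)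
    finally have "(2/3) * ?r * norm ?T \<le> norm (?T (x + ?r *\<^sub>R \<xi>)) \<or> (2/3) * ?r * norm ?T \<le> norm (?T (x - ?r *\<^sub>R \<xi>))"
      using big by linarith
    moreover have "norm (?r *\<^sub>R \<xi>) \<le> ?r" using \<xi>(1) by (simp add: mult_left_le)
    ultimately show ?thesis
      by (elim disjE) (rule exI[of _ "x + ?r *\<^sub>R \<xi>"] exI[of _ "x - ?r *\<^sub>R \<xi>"], simp)+
  qed
  then obtain g where g: "\<And>x k. norm (g x k - x) \<le> (1/3) ^ k"
     "\<And>x k. (2/3) * (1/3) ^ k * norm (F (n k)) \<le> norm (F (n k) (g x k))" by metis
  define y where "y = rec_nat 0 (\<lambda>k x. g x k)"
  have yS: "y (Suc k) = g (y k) k" for k by (simp add: y_def)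
  have dy: "norm (y (Suc k) - y k) \<le> (1/3) ^ k" for k using g(1) yS by simp
  have geo: "summable (\<lambda>k. (1/3::real) ^ k)" by (rule summable_geometric) simp
  then have sm: "summable (\<lambda>k. norm (y (Suc k) - y k))"
    using dy by (rule_tac summable_comparison_test[of _ "\<lambda>k. (1/3) ^ k"]) auto
  have "(\<lambda>k. y k) \<longlonglongrightarrow> (\<Sum>k. y (Suc k) - y k) + y 0"
  proof -
    have "(\<lambda>k. \<Sum>i<k. y (Suc i) - y i) \<longlonglongrightarrow> (\<Sum>k. y (Suc k) - y k)"
      by (rule summable_LIMSEQ[OF summable_norm_cancel[OF sm]])
    then have "(\<lambda>k. (\<Sum>i<k. y (Suc i) - y i) + y 0) \<longlonglongrightarrow> (\<Sum>k. y (Suc k) - y k) + y 0"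
      by (intro tendsto_intros)
    then show ?thesis by (simp add: sum_lessThan_telescope)
  qed
  then obtain x where x: "y \<longlonglongrightarrow> x" by blast
  \<comment> \<open>The subtracted remainder of the geometric sum is kept so that the induction
    closes.\<close>
  have tail: "norm (y (k + m) - y k) \<le> (3/2) * (1/3) ^ k - (3/2) * (1/3) ^ (k + m)" for k m
  proof (induction m)
    case (Suc m)
    have "norm (y (k + Suc m) - y k) \<le> norm (y (Suc (k + m)) - y (k + m)) + norm (y (k + m) - y k)"
      using norm_triangle_ineq[of "y (Suc (k + m)) - y (k + m)" "y (k + m) - y k"] by simp
    with dy[of "k + m"] Suc show ?case by simp
  qed simp
  have close: "norm (x - y k) \<le> (3/2) * (1/3) ^ k" for k
  proof (rule LIMSEQ_le_const2)
    show "(\<lambda>m. norm (y (m + k) - y k)) \<longlonglongrightarrow> norm (x - y k)"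
      by (intro tendsto_intros LIMSEQ_ignore_initial_segment x)
    have "norm (y (m + k) - y k) \<le> (3/2) * (1/3) ^ k" for m
      using tail[of k m] zero_le_power[of "1/3::real" "k+m"] by (simp only: add.commute[of m k]) linarith
    then show "\<exists>N. \<forall>m\<ge>N. norm (y (m + k) - y k) \<le> (3/2) * (1/3) ^ k" by blast
  qed
  obtain K where K: "\<And>m. norm (F m x) \<le> K" using pw[of x] by (auto simp: Bseq_def)
  have lower: "(1/6) * (4/3) ^ k \<le> K" for k
  proof -
    let ?T = "F (n k)" and ?r = "(1/3::real) ^ k"
    have "norm (?T (y (Suc k))) \<le> norm (?T x) + norm (?T (x - y (Suc k)))"
      using norm_triangle_ineq4[of "?T x" "?T (x - y (Suc k))"] by (simp add: blinfun.diff_right)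
    moreover have "norm (?T (x - y (Suc k))) \<le> norm ?T * ((3/2) * (1/3) ^ Suc k)"
      using norm_blinfun[of ?T "x - y (Suc k)"] close[of "Suc k"]
      by (meson mult_left_mono norm_ge_zero order_trans)
    moreover have "(2/3) * ?r * norm ?T \<le> norm (?T (y (Suc k)))" using g(2) yS by simp
    ultimately have "(1/6) * (?r * norm ?T) \<le> K" using K[of "n k"] by (simp add: algebra_simps)
    moreover have "?r * 4 ^ k \<le> ?r * norm ?T" using n[of k] by (intro mult_left_mono) auto
    moreover have "?r * 4 ^ k = (4/3) ^ k" by (simp add: power_mult_distrib[symmetric])
    ultimately show ?thesis by linarith
  qed
  obtain k where "6 * K < (4/3::real) ^ k" using real_arch_pow[of "4/3" "6 * K"] by auto
  with lower[of k] show False by linarith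
qed

section \<open>Semigroups on Hilbert spaces and their adjoints\<close>

locale hilbert_semigroup =
  fixes S :: "real \<Rightarrow> 'x::{real_inner,banach} \<Rightarrow>\<^sub>L 'x" and D :: "'x set" and A :: "'x \<Rightarrow> 'x"
  assumes C0: "C0_semigroup S" and gen: "generates D A S"
begin

lemma S_0 [simp]: "S 0 x = x"
  using C0 by (simp add: C0_semigroup_def)

lemma S_add: "0 \<le> s \<Longrightarrow> 0 \<le> t \<Longrightarrow> S (s + t) x = S s (S t x)"
  using C0 by (simp add: C0_semigroup_def)

lemma S_comm: "0 \<le> s \<Longrightarrow> 0 \<le> t \<Longrightarrow> S s (S t x) = S t (S s x)"
  using S_add[of s t x] S_add[of t s x] by (simp add: add.commute)

lemma S_right: "((\<lambda>t. S t x) \<longlongrightarrow> x) (at_right 0)"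
  using C0 by (simp add: C0_semigroup_def)

text \<open>Otherwise operators \<open>S (t n)\<close> with \<open>t n\<close> tending to 0 would
  have unbounded norms while converging pointwise, against uniform boundedness.\<close>

lemma local_bound_0: "\<exists>\<delta>>0. \<exists>K\<ge>1. \<forall>t. 0 \<le> t \<and> t \<le> \<delta> \<longrightarrow> norm (S t) \<le> K"
proof (rule ccontr)
  assume contra: "\<not> ?thesis"
  have "\<exists>t. 0 \<le> t \<and> t \<le> inverse (real (Suc n)) \<and> real (Suc n) < norm (S t)" for n
    using contra by (metis (no_types, lifting) inverse_positive_iff_positive le_add1 not_le of_nat_0_less_iff
        of_nat_1 of_nat_le_iff plus_1_eq_Suc zero_less_Suc)
  then obtain t where t: "\<And>n. 0 \<le> t n" "\<And>n. t n \<le> inverse (real (Suc n))" "\<And>n. real (Suc n) < norm (S (t n))"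
    by metis
  have t0: "t \<longlonglongrightarrow> 0"
    by (rule tendsto_sandwich[of "\<lambda>_. 0" _ _ "\<lambda>n. inverse (real (Suc n))"])
       (use t LIMSEQ_inverse_real_of_nat in auto)
  have "Bseq (\<lambda>n. S (t n) x)" for x
  proof -
    have "((\<lambda>s. S s x) \<longlongrightarrow> S 0 x) (at 0 within {0..})"
      using S_right[of x] by (simp add: at_within_Ici_at_right)
    then have "continuous (at 0 within {0..}) (\<lambda>s. S s x)" by (simp add: continuous_within)
    then have "(\<lambda>n. S (t n) x) \<longlonglongrightarrow> S 0 x"
      using t t0 unfolding continuous_within_sequentially by (auto simp: o_def)
    then show ?thesis using convergent_def convergent_imp_Bseq by blast
  qed
  then have "Bseq (\<lambda>n. S (t n))" by (rule uniform_boundedness)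
  then obtain K where K: "\<And>n. norm (S (t n)) \<le> K" by (auto simp: Bseq_def)
  obtain n where "K < real n" using reals_Archimedean2 by blast
  with K[of n] t(3)[of n] show False by simp
qed

lemma local_bound: "\<exists>K\<ge>1. \<forall>t. 0 \<le> t \<and> t \<le> T \<longrightarrow> norm (S t) \<le> K"
proof -
  obtain \<delta> K where dK: "\<delta> > 0" "K \<ge> 1" and K: "\<And>t. 0 \<le> t \<Longrightarrow> t \<le> \<delta> \<Longrightarrow> norm (S t) \<le> K"
    using local_bound_0 by metis
  have *: "norm (S t) \<le> K ^ Suc n" if "0 \<le> t" "t \<le> real (Suc n) * \<delta>" for n t
    using that
  proof (induction n arbitrary: t)
    case (Suc n)
    show ?case
    proof (cases "t \<le> \<delta>")
      case True
      have "K ^ 1 \<le> K ^ Suc (Suc n)" using dK by (intro power_increasing) auto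
      with K[of t] True Suc.prems show ?thesis by simp
    next
      case False
      have "S t = S \<delta> o\<^sub>L S (t - \<delta>)"
        using S_add[of \<delta> "t - \<delta>"] False dK by (intro blinfun_eqI) simp
      then have "norm (S t) \<le> norm (S \<delta>) * norm (S (t - \<delta>))" by (simp add: norm_blinfun_compose)
      also have "\<dots> \<le> K * K ^ Suc n"
        using False dK Suc.prems K[of \<delta>]
        by (intro mult_mono Suc.IH) (auto simp: algebra_simps)
      finally show ?thesis by simp
    qed
  qed (use K in simp)
  obtain n where n: "T / \<delta> < real n" using reals_Archimedean2 by blast
  have "T \<le> real (Suc n) * \<delta>" using n dK by (simp add: field_simps)
  then show ?thesis using *[of _ n] dK
    by (intro exI[of _ "K ^ Suc n"]) (auto simp del: power_Suc of_nat_Suc intro: one_le_power)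
qed

lemma S_bound:
  obtains K where "K \<ge> 1" "\<And>t x. 0 \<le> t \<Longrightarrow> t \<le> T \<Longrightarrow> norm (S t x) \<le> K * norm x"
proof -
  obtain K where K: "K \<ge> 1" "\<And>t. 0 \<le> t \<Longrightarrow> t \<le> T \<Longrightarrow> norm (S t) \<le> K" using local_bound by metis
  have "norm (S t x) \<le> K * norm x" if "0 \<le> t" "t \<le> T" for t x
    using norm_blinfun[of "S t" x] K(2)[OF that] by (meson mult_right_mono norm_ge_zero order_trans)
  with K(1) show ?thesis using that by blast
qed

lemma S_cont: "continuous_on {0..} (\<lambda>t. S t x)"
  unfolding continuous_on_eq_continuous_within
proof
  fix t :: real assume "t \<in> {0..}"
  then have t: "0 \<le> t" by simp
  obtain K where K: "K \<ge> 1" "\<And>s x. 0 \<le> s \<Longrightarrow> s \<le> t + 1 \<Longrightarrow> norm (S s x) \<le> K * norm x"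
    using S_bound by blast
  show "continuous (at t within {0..}) (\<lambda>t. S t x)"
    unfolding continuous_within Lim_within
  proof (intro allI impI)
    fix e :: real assume e: "e > 0"
    have "\<forall>\<^sub>F h in at_right 0. dist (S h x) x < e / K"
      using S_right[of x] e K(1) by (intro tendstoD) auto
    then obtain d where d: "d > 0" "\<And>h. 0 < h \<Longrightarrow> h < d \<Longrightarrow> dist (S h x) x < e / K"
      unfolding eventually_at_right_field by auto
    have *: "norm (S b x - S a x) < e" if "0 \<le> a" "a < b" "b \<le> t + 1" "b - a < d" for a b
    proof -
      have "S b x - S a x = S a (S (b - a) x - x)"
        using S_add[of a "b - a" x] that by (simp add: blinfun.diff_right)
      then have "norm (S b x - S a x) \<le> K * norm (S (b - a) x - x)" using K(2) that by simp
      also have "\<dots> < K * (e / K)" using d(2)[of "b - a"] that K(1)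
        by (intro mult_strict_left_mono) (auto simp: dist_norm)
      finally show ?thesis using K(1) by simp
    qed
    show "\<exists>d>0. \<forall>s\<in>{0..}. 0 < dist s t \<and> dist s t < d \<longrightarrow> dist (S s x) (S t x) < e"
    proof (intro exI[of _ "min d 1"] conjI ballI impI)
      fix s :: real assume s: "s \<in> {0..}" "0 < dist s t \<and> dist s t < min d 1"
      show "dist (S s x) (S t x) < e"
      proof (cases "s < t")
        case True
        then show ?thesis using *[of s t] s by (auto simp: dist_norm norm_minus_commute)
      next
        case False
        then show ?thesis using *[of t s] s t by (auto simp: dist_norm)
      qed
    qed (use d in simp)
  qed
qed

section \<open>The integrated semigroup and the generator\<close>

lemma S_cont_on: "0 \<le> a \<Longrightarrow> continuous_on {a..b} (\<lambda>t. S t x)"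
  by (rule continuous_on_subset[OF S_cont]) auto

lemma S_integrable: "0 \<le> a \<Longrightarrow> (\<lambda>t. S t x) integrable_on {a..b}"
  by (intro integrable_continuous_interval S_cont_on)

text \<open>The integrated semigroup. It maps the whole space into \<open>D\<close>, with
  \<open>A (K h x) = S h x - x\<close>, and also \<open>K h (A x) = S h x - x\<close> on
  \<open>D\<close>. These identities are the source of the density of both domains and of the
  Lipschitz estimate for adjoint orbits.\<close>

definition K :: "real \<Rightarrow> 'x \<Rightarrow> 'x" where "K h x = integral {0..h} (\<lambda>s. S s x)"

lemma K_bounded_linear: "bounded_linear (K h)"
proof -
  obtain C where C: "C \<ge> 1" "\<And>t x. 0 \<le> t \<Longrightarrow> t \<le> h \<Longrightarrow> norm (S t x) \<le> C * norm x"
    using S_bound by blast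
  show ?thesis
  \<comment> \<open>The factor \<open>max 0 h\<close> covers negative \<open>h\<close>, for which
    the integral runs over the empty interval.\<close>
  proof (rule bounded_linear_intro[where K = "C * max 0 h"])
    show "K h (x + y) = K h x + K h y" for x y
      unfolding K_def by (simp add: blinfun.add_right integral_add S_integrable)
    show "K h (c *\<^sub>R x) = c *\<^sub>R K h x" for c x
      unfolding K_def by (simp add: blinfun.scaleR_right)
    show "norm (K h x) \<le> norm x * (C * max 0 h)" for x
    proof (cases "0 \<le> h")
      case True
      have "norm (K h x) \<le> (C * norm x) * (h - 0)"
        unfolding K_def by (rule integral_bound) (use True C S_cont_on in auto)
      then show ?thesis using True by (simp add: ac_simps)
    qed (simp add: K_def)
  qed
qed

lemma D_def': "x \<in> D \<longleftrightarrow> (\<exists>y. ((\<lambda>h. (S h x - x) /\<^sub>R h) \<longlongrightarrow> y) (at_right 0))"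
  using gen by (auto simp: generates_def)

lemma A_lim: "x \<in> D \<Longrightarrow> ((\<lambda>h. (S h x - x) /\<^sub>R h) \<longlongrightarrow> A x) (at_right 0)"
  using gen by (auto simp: generates_def)

lemma DI: "((\<lambda>h. (S h x - x) /\<^sub>R h) \<longlongrightarrow> y) (at_right 0) \<Longrightarrow> x \<in> D \<and> A x = y"
  using D_def' A_lim tendsto_unique[OF trivial_limit_at_right_real] by blast

lemma A_scale: "x \<in> D \<Longrightarrow> c *\<^sub>R x \<in> D \<and> A (c *\<^sub>R x) = c *\<^sub>R A x"
  by (rule DI) (use tendsto_scaleR[OF tendsto_const A_lim] in \<open>simp add: blinfun.scaleR_right algebra_simps\<close>)

lemma A_S: assumes "0 \<le> t" "x \<in> D" shows "S t x \<in> D \<and> A (S t x) = S t (A x)"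
proof (rule DI)
  have "((\<lambda>h. S t ((S h x - x) /\<^sub>R h)) \<longlongrightarrow> S t (A x)) (at_right 0)"
    by (intro tendsto_intros A_lim assms)
  moreover have "\<forall>\<^sub>F h in at_right 0. S t ((S h x - x) /\<^sub>R h) = (S h (S t x) - S t x) /\<^sub>R h"
    using S_comm[of _ t x] assms
    by (intro eventually_at_rightI[of 0 1]) (auto simp: blinfun.scaleR_right blinfun.diff_right)
  ultimately show "((\<lambda>h. (S h (S t x) - S t x) /\<^sub>R h) \<longlongrightarrow> S t (A x)) (at_right 0)"
    using tendsto_cong by fast
qed

lemma average_tendsto:
  assumes t: "0 \<le> t" shows "((\<lambda>r. integral {t..t + r} (\<lambda>s. S s x) /\<^sub>R r) \<longlongrightarrow> S t x) (at_right 0)"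
proof (rule tendstoI)
  fix e :: real assume e: "e > 0"
  have "continuous (at t within {0..}) (\<lambda>s. S s x)"
    using S_cont t by (simp add: continuous_on_eq_continuous_within)
  then obtain d where d: "d > 0" "\<And>s. 0 \<le> s \<Longrightarrow> dist s t < d \<Longrightarrow> dist (S s x) (S t x) < e / 2"
    using e unfolding continuous_within_eps_delta by (metis atLeast_iff half_gt_zero)
  show "\<forall>\<^sub>F r in at_right 0. dist (integral {t..t + r} (\<lambda>s. S s x) /\<^sub>R r) (S t x) < e"
  proof (rule eventually_at_rightI[of 0 d])
    fix r assume r: "r \<in> {0<..<d}"
    have "norm (integral {t..t + r} (\<lambda>s. S s x - S t x)) \<le> e / 2 * (t + r - t)"
    proof (rule integral_bound)
      show "continuous_on {t..t + r} (\<lambda>s. S s x - S t x)"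
        by (intro continuous_intros S_cont_on t)
      show "norm (S s x - S t x) \<le> e / 2" if "s \<in> {t..t + r}" for s
        using d(2)[of s] that r t by (auto simp: dist_norm)
    qed (use r in simp)
    moreover have "integral {t..t + r} (\<lambda>s. S s x - S t x) = integral {t..t + r} (\<lambda>s. S s x) - r *\<^sub>R S t x"
      using r t by (subst integral_diff) (auto intro: S_integrable)
    ultimately have "norm (r *\<^sub>R (integral {t..t + r} (\<lambda>s. S s x) /\<^sub>R r - S t x)) \<le> e / 2 * r"
      using r by (simp add: scaleR_diff_right)
    then have "r * norm (integral {t..t + r} (\<lambda>s. S s x) /\<^sub>R r - S t x) \<le> r * (e / 2)"
      using r by (simp add: mult.commute)
    then have "norm (integral {t..t + r} (\<lambda>s. S s x) /\<^sub>R r - S t x) \<le> e / 2"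
      using r by (subst (asm) mult_le_cancel_left_pos) auto
    then show "dist (integral {t..t + r} (\<lambda>s. S s x) /\<^sub>R r) (S t x) < e"
      using e by (simp add: dist_norm)
  qed (use d in simp)
qed

text \<open>The second interval is written \<open>{0..0 + r}\<close> so that
  \<open>average_tendsto\<close> applies in the same form at the times \<open>h\<close> and
  \<open>0\<close>.\<close>

lemma S_K: assumes "0 \<le> h" "0 \<le> r"
  shows "S r (K h x) - K h x = integral {h..h + r} (\<lambda>s. S s x) - integral {0..0 + r} (\<lambda>s. S s x)"
proof -
  have "S r (K h x) = integral {0..h} (\<lambda>s. S r (S s x))"
    unfolding K_def using integral_linear[OF S_integrable[of 0 x h] blinfun.bounded_linear_right[of "S r"]]
    by (simp add: o_def)
  also have "\<dots> = integral {0..h} (\<lambda>s. S (s + r) x)"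
    using assms by (intro integral_cong) (simp add: S_add S_comm)
  also have "\<dots> = integral {r..h + r} (\<lambda>s. S s x)"
    using integral_shift_Icc_real[of 0 h "\<lambda>s. S s x" r] by (simp add: o_def add.commute)
  finally have 1: "S r (K h x) = integral {r..h + r} (\<lambda>s. S s x)" .
  have 2: "integral {0..r} (\<lambda>s. S s x) + integral {r..h + r} (\<lambda>s. S s x) = integral {0..h + r} (\<lambda>s. S s x)"
    using assms by (intro Henstock_Kurzweil_Integration.integral_combine S_integrable) auto
  have 3: "integral {0..h} (\<lambda>s. S s x) + integral {h..h + r} (\<lambda>s. S s x) = integral {0..h + r} (\<lambda>s. S s x)"
    using assms by (intro Henstock_Kurzweil_Integration.integral_combine S_integrable) auto
  show ?thesis using 1 2 3 unfolding K_def by (simp add: algebra_simps)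
qed

lemma K_lim: assumes h: "0 \<le> h"
  shows "((\<lambda>r. (S r (K h x) - K h x) /\<^sub>R r) \<longlongrightarrow> S h x - x) (at_right 0)"
proof -
  have "((\<lambda>r. integral {h..h + r} (\<lambda>s. S s x) /\<^sub>R r - integral {0..0 + r} (\<lambda>s. S s x) /\<^sub>R r) \<longlongrightarrow> S h x - S 0 x) (at_right 0)"
    by (intro tendsto_intros average_tendsto h) simp
  moreover have "\<forall>\<^sub>F r in at_right 0. integral {h..h + r} (\<lambda>s. S s x) /\<^sub>R r - integral {0..0 + r} (\<lambda>s. S s x) /\<^sub>R r
      = (S r (K h x) - K h x) /\<^sub>R r"
    using h by (intro eventually_at_rightI[of 0 1]) (auto simp: S_K scaleR_diff_right)
  ultimately show ?thesis using tendsto_cong by force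
qed

lemma A_K: "0 \<le> h \<Longrightarrow> K h x \<in> D \<and> A (K h x) = S h x - x"
  by (intro DI K_lim)

lemma K_A: assumes h: "0 \<le> h" and x: "x \<in> D" shows "K h (A x) = S h x - x"
proof -
  interpret K: bounded_linear "K h" by (rule K_bounded_linear)
  have comm: "K h (S r x) = S r (K h x)" if "0 \<le> r" for r
  proof -
    have "S r (K h x) = integral {0..h} (\<lambda>s. S r (S s x))"
      unfolding K_def using integral_linear[OF S_integrable[of 0 x h] blinfun.bounded_linear_right[of "S r"]]
      by (simp add: o_def)
    also have "\<dots> = K h (S r x)"
      unfolding K_def using that by (intro integral_cong) (simp add: S_comm)
    finally show ?thesis by simp
  qed
  have "((\<lambda>r. K h ((S r x - x) /\<^sub>R r)) \<longlongrightarrow> K h (A x)) (at_right 0)"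
    by (intro K.tendsto A_lim x)
  moreover have "\<forall>\<^sub>F r in at_right 0. K h ((S r x - x) /\<^sub>R r) = (S r (K h x) - K h x) /\<^sub>R r"
    by (intro eventually_at_rightI[of 0 1]) (auto simp: K.scaleR K.diff comm)
  ultimately have "((\<lambda>r. (S r (K h x) - K h x) /\<^sub>R r) \<longlongrightarrow> K h (A x)) (at_right 0)"
    using tendsto_cong by fast
  then show ?thesis using K_lim[OF h] tendsto_unique[OF trivial_limit_at_right_real] by blast
qed

lemma closure_D: "closure D = UNIV"
proof -
  have "x \<in> closure D" for x
  proof -
    have lim: "((\<lambda>r. K r x /\<^sub>R r) \<longlongrightarrow> x) (at_right 0)"
      using average_tendsto[of 0 x] by (simp add: K_def)
    have "\<forall>\<^sub>F r in at_right 0. K r x /\<^sub>R r \<in> closure D"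
      using A_K A_scale closure_subset[of D] by (intro eventually_at_rightI[of 0 1]) auto
    then show ?thesis
      using Lim_in_closed_set[OF closed_closure _ trivial_limit_at_right_real lim] by blast
  qed
  then show ?thesis by blast
qed

section \<open>Adjoint generator and adjoint semigroup\<close>

abbreviation "D' \<equiv> adj_dom D A"
abbreviation "A' \<equiv> adj_op D A"
abbreviation "S' t \<equiv> adjoint (blinfun_apply (S t))"

lemma S'_inner: "S t x \<bullet> z = x \<bullet> S' t z"
  by (rule adjoint_hilbert)

lemma eq_if_inner_D: assumes "\<And>x. x \<in> D \<Longrightarrow> x \<bullet> a = x \<bullet> b" shows "a = b"
proof -
  have "x \<bullet> (a - b) = 0" for x
  proof -
    obtain y where y: "\<And>n. y n \<in> D" "y \<longlonglongrightarrow> x" using closure_D closure_sequential[of x D] by blast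
    have "(\<lambda>n. y n \<bullet> (a - b)) \<longlonglongrightarrow> x \<bullet> (a - b)" by (intro tendsto_intros y)
    moreover have "y n \<bullet> (a - b) = 0" for n using assms[OF y(1)] by (simp add: inner_diff_right)
    ultimately show ?thesis by (simp add: LIMSEQ_const_iff)
  qed
  from this[of "a - b"] show ?thesis by simp
qed

lemma D'_I: assumes "\<And>x. x \<in> D \<Longrightarrow> A x \<bullet> z = x \<bullet> w" shows "z \<in> D' \<and> A' z = w"
proof
  show "z \<in> D'" using assms by (auto simp: adj_dom_def)
  show "A' z = w" unfolding adj_op_def
    using assms eq_if_inner_D by (intro the_equality) auto
qed

lemma A'_inner: assumes "z \<in> D'" "x \<in> D" shows "A x \<bullet> z = x \<bullet> A' z"
proof -
  obtain w where w: "\<forall>x\<in>D. A x \<bullet> z = x \<bullet> w" using assms by (auto simp: adj_dom_def)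
  with D'_I[of z w] assms show ?thesis by auto
qed

lemma A'_add: "z \<in> D' \<Longrightarrow> w \<in> D' \<Longrightarrow> z + w \<in> D' \<and> A' (z + w) = A' z + A' w"
  by (rule D'_I) (simp add: inner_add_right A'_inner)

lemma A'_scale: "z \<in> D' \<Longrightarrow> c *\<^sub>R z \<in> D' \<and> A' (c *\<^sub>R z) = c *\<^sub>R A' z"
  by (rule D'_I) (simp add: A'_inner)

lemma A'_0: "0 \<in> D' \<and> A' 0 = 0"
  by (rule D'_I) simp

lemma subspace_D': "subspace D'"
  by (rule subspaceI) (use A'_0 A'_add A'_scale in auto)

lemma A'_diff: "z \<in> D' \<Longrightarrow> w \<in> D' \<Longrightarrow> z - w \<in> D' \<and> A' (z - w) = A' z - A' w"
  using A'_add[of z "(-1) *\<^sub>R w"] A'_scale[of w "-1"] by simp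

lemma eq_if_inner: fixes a b :: 'x assumes "\<And>x. x \<bullet> a = x \<bullet> b" shows "a = b"
  by (rule eq_if_inner_D) (rule assms)

lemma S'_linear: "linear (S' t)"
proof (rule linearI)
  show "S' t (a + b) = S' t a + S' t b" for a b
    by (rule eq_if_inner) (simp add: inner_add_right flip: S'_inner)
  show "S' t (c *\<^sub>R a) = c *\<^sub>R S' t a" for a c
    by (rule eq_if_inner) (simp flip: S'_inner)
qed

lemma S'_diff: "S' t (a - b) = S' t a - S' t b"
  by (rule linear_diff[OF S'_linear])

lemma S'_add: "0 \<le> s \<Longrightarrow> 0 \<le> t \<Longrightarrow> S' (s + t) z = S' s (S' t z)"
  by (rule eq_if_inner) (simp add: S_add S_comm flip: S'_inner)

lemma S'_bound:
  obtains C where "C \<ge> 1" "\<And>t z. 0 \<le> t \<Longrightarrow> t \<le> T \<Longrightarrow> norm (S' t z) \<le> C * norm z"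
proof -
  obtain C where C: "C \<ge> 1" "\<And>t x. 0 \<le> t \<Longrightarrow> t \<le> T \<Longrightarrow> norm (S t x) \<le> C * norm x"
    using S_bound by blast
  have "norm (S' t z) \<le> C * norm z" if "0 \<le> t" "t \<le> T" for t z
  proof (cases "S' t z = 0")
    case False
    have "norm (S' t z) * norm (S' t z) = S t (S' t z) \<bullet> z"
      by (simp add: S'_inner power2_norm_eq_inner flip: power2_eq_square)
    also have "\<dots> \<le> norm (S t (S' t z)) * norm z" by (rule norm_cauchy_schwarz)
    also have "\<dots> \<le> C * norm (S' t z) * norm z" using C(2)[OF that] by (intro mult_right_mono) auto
    also have "\<dots> = norm (S' t z) * (C * norm z)" by simp
    finally show ?thesis using False by (subst (asm) mult_le_cancel_left_pos) auto
  qed (use C in simp)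
  with C(1) show ?thesis using that by blast
qed

lemma A'_S': "0 \<le> t \<Longrightarrow> z \<in> D' \<Longrightarrow> S' t z \<in> D' \<and> A' (S' t z) = S' t (A' z)"
proof (rule D'_I)
  fix x assume *: "0 \<le> t" "z \<in> D'" "x \<in> D"
  then have "S t (A x) \<bullet> z = S t x \<bullet> A' z" using A_S[of t x] A'_inner[of z "S t x"] by simp
  then show "A x \<bullet> S' t z = x \<bullet> S' t (A' z)" by (simp add: S'_inner)
qed

text \<open>By \<open>K_A\<close> the adjoint of \<open>K h\<close> takes values in
  \<open>D'\<close>. If \<open>x\<close> is orthogonal to \<open>D'\<close>, then
  \<open>K h x\<close> vanishes for every \<open>h\<close>, although the averages
  \<open>K r x / r\<close> tend to \<open>x\<close>.\<close>

lemma closure_D': "closure D' = UNIV"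
proof (rule dense_subspaceI[OF subspace_D'])
  fix x assume orth: "\<And>z. z \<in> D' \<Longrightarrow> x \<bullet> z = 0"
  have K0: "K h x = 0" if h: "0 \<le> h" for h
  proof -
    define Kb where "Kb = Blinfun (K h)"
    have Kb: "blinfun_apply Kb = K h" unfolding Kb_def
      by (rule bounded_linear_Blinfun_apply[OF K_bounded_linear])
    have "adjoint (K h) z \<in> D'" for z
    proof -
      have "A y \<bullet> adjoint (K h) z = y \<bullet> (S' h z - z)" if "y \<in> D" for y
        using adjoint_hilbert[of Kb "A y" z] K_A[OF h that]
        by (simp add: Kb inner_diff_left inner_diff_right S'_inner)
      then show ?thesis using D'_I by blast
    qed
    then have "K h x \<bullet> z = 0" for z
      using adjoint_hilbert[of Kb x z] orth by (simp add: Kb)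
    from this[of "K h x"] show ?thesis by simp
  qed
  have "((\<lambda>r. K r x /\<^sub>R r) \<longlongrightarrow> x) (at_right 0)"
    using average_tendsto[of 0 x] by (simp add: K_def)
  moreover have "\<forall>\<^sub>F r in at_right 0. K r x /\<^sub>R r = 0"
    using K0 by (intro eventually_at_rightI[of 0 1]) auto
  ultimately have "((\<lambda>r::real. 0::'x) \<longlongrightarrow> x) (at_right 0)" using tendsto_cong by fast
  then show "x = 0" using tendsto_unique[OF trivial_limit_at_right_real tendsto_const] by blast
qed

lemma D'_approx: obtains y where "\<And>n::nat. y n \<in> D'" "y \<longlonglongrightarrow> z"
  using closure_D' closure_sequential[of z D'] by blast

text \<open>Test the difference \<open>x = S' h z - z\<close> against itself: its square is
  \<open>(S h x - x) \<bullet> z = A (K h x) \<bullet> z = K h x \<bullet> A' z\<close>, and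
  \<open>K h x\<close> is of size \<open>h\<close>.\<close>

lemma S'_diff_bound:
  assumes "0 \<le> h" "z \<in> D'" "C \<ge> 0" "\<And>t x. 0 \<le> t \<Longrightarrow> t \<le> h \<Longrightarrow> norm (S t x) \<le> C * norm x"
  shows "norm (S' h z - z) \<le> C * h * norm (A' z)"
proof (cases "S' h z - z = 0")
  case False
  let ?x = "S' h z - z"
  have "norm ?x * norm ?x = (S h ?x - ?x) \<bullet> z"
    by (simp only: inner_diff_left[of "S h ?x" ?x z] S'_inner inner_diff_right[of ?x "S' h z" z, symmetric])
      (simp add: power2_norm_eq_inner flip: power2_eq_square)
  also have "\<dots> = K h ?x \<bullet> A' z" using A_K[OF assms(1), of ?x] A'_inner[OF assms(2)] by metis
  also have "\<dots> \<le> norm (K h ?x) * norm (A' z)" by (rule norm_cauchy_schwarz)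
  also have "\<dots> \<le> (C * norm ?x * (h - 0)) * norm (A' z)"
    unfolding K_def using assms S_cont_on
    by (intro mult_right_mono integral_bound) auto
  also have "\<dots> = norm ?x * (C * h * norm (A' z))" by simp
  finally show ?thesis using False by (subst (asm) mult_le_cancel_left_pos) auto
qed (use assms in simp)

text \<open>Strong continuity passes to the adjoint: orbits starting in \<open>D'\<close> are
  Lipschitz on bounded intervals, \<open>D'\<close> is dense, and the adjoint semigroup is locally
  bounded.\<close>

lemma S'_cont: "continuous_on {0..} (\<lambda>t. S' t z)"
  unfolding continuous_on_eq_continuous_within
proof
  fix t :: real assume "t \<in> {0..}"
  then have t: "0 \<le> t" by simp
  obtain C where C: "C \<ge> 1" "\<And>s x. 0 \<le> s \<Longrightarrow> s \<le> t + 1 \<Longrightarrow> norm (S' s x) \<le> C * norm x"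
    using S'_bound by blast
  obtain C' where C': "C' \<ge> 1" "\<And>s x. 0 \<le> s \<Longrightarrow> s \<le> t + 1 \<Longrightarrow> norm (S s x) \<le> C' * norm x"
    using S_bound by blast
  show "continuous (at t within {0..}) (\<lambda>t. S' t z)"
    unfolding continuous_within Lim_within
  proof (intro allI impI)
    fix e :: real assume e: "e > 0"
    obtain y where y: "y \<in> D'" "dist y z < e / (4 * C)"
      using closure_D' closure_approachable[of z D'] e C(1) by (metis UNIV_I divide_pos_pos
         less_le_trans mult_pos_pos zero_less_numeral zero_less_one)
    define L where "L = C * C' * norm (A' y) + 1"
    have L: "L > 0" using C(1) C'(1) by (simp add: L_def add_nonneg_pos)
    have *: "norm (S' b z - S' a z) < e" if ab: "0 \<le> a" "a \<le> b" "b \<le> t + 1" "b - a < e / (2 * L)" for a b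
    proof -
      have "S' b y - S' a y = S' a (S' (b - a) y - y)"
        using S'_add[of a "b - a" y] that by (simp add: S'_diff)
      then have "norm (S' b y - S' a y) \<le> C * norm (S' (b - a) y - y)" using C(2) ab by simp
      also have "\<dots> \<le> C * (C' * (b - a) * norm (A' y))"
        using C(1) C' ab y by (intro mult_left_mono S'_diff_bound) auto
      also have "\<dots> = (b - a) * (L - 1)" by (simp add: L_def)
      also have "\<dots> \<le> (b - a) * L" using ab by (intro mult_left_mono) auto
      also have "\<dots> < e / (2 * L) * L" using ab L by (intro mult_strict_right_mono) auto
      also have "\<dots> = e / 2" using L by simp
      finally have 1: "norm (S' b y - S' a y) < e / 2" .
      have 2: "norm (S' s z - S' s y) < e / 4" if "0 \<le> s" "s \<le> t + 1" for s
      proof -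
        have "norm (S' s z - S' s y) \<le> C * norm (z - y)" using C(2)[OF that] by (simp flip: S'_diff)
        also have "\<dots> < C * (e / (4 * C))" using y C(1)
          by (intro mult_strict_left_mono) (auto simp: dist_norm norm_minus_commute)
        finally show ?thesis using C(1) by simp
      qed
      have "norm (S' b z - S' a z) = norm ((S' b z - S' b y) + (S' b y - S' a y) - (S' a z - S' a y))" by simp
      then have "norm (S' b z - S' a z) \<le> norm (S' b z - S' b y) + norm (S' b y - S' a y) + norm (S' a z - S' a y)"
        using norm_triangle_ineq4[of "(S' b z - S' b y) + (S' b y - S' a y)" "S' a z - S' a y"]
          norm_triangle_ineq[of "S' b z - S' b y" "S' b y - S' a y"] by linarith
      then show ?thesis using 1 2[of a] 2[of b] ab by simp
    qed
    show "\<exists>d>0. \<forall>s\<in>{0..}. 0 < dist s t \<and> dist s t < d \<longrightarrow> dist (S' s z) (S' t z) < e"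
    proof (intro exI[of _ "min (e / (2 * L)) 1"] conjI ballI impI)
      fix s :: real assume s: "s \<in> {0..}" "0 < dist s t \<and> dist s t < min (e / (2 * L)) 1"
      show "dist (S' s z) (S' t z) < e"
      proof (cases "s < t")
        case True
        then show ?thesis using *[of s t] s by (auto simp: dist_norm norm_minus_commute)
      next
        case False
        then show ?thesis using *[of t s] s t by (auto simp: dist_norm)
      qed
    qed (use e L in simp)
  qed
qed

end

section \<open>Strong measurability and square integrability\<close>

lemma finite_measure_lebesgue_on_Ioo: "finite_measure (lebesgue_on {0<..<T::real})"
  by (intro finite_measure_lebesgue_on lmeasurable_open) auto

lemma strongly_measurable_AE_cong:
  "strongly_measurable M f \<Longrightarrow> (AE t in M. f t = g t) \<Longrightarrow> strongly_measurable M g"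
proof -
  assume "strongly_measurable M f" and eq: "AE t in M. f t = g t"
  then obtain s where s: "\<forall>i::nat. simple_function M (s i)" "AE t in M. (\<lambda>i. s i t) \<longlonglongrightarrow> f t"
    unfolding strongly_measurable_def by blast
  from s(2) eq have "AE t in M. (\<lambda>i. s i t) \<longlonglongrightarrow> g t" by eventually_elim simp
  with s(1) show ?thesis unfolding strongly_measurable_def by blast
qed

lemma strongly_measurable_simple: "simple_function M f \<Longrightarrow> strongly_measurable M f"
  unfolding strongly_measurable_def by (intro exI[of _ "\<lambda>_. f"]) auto

lemma strongly_measurable_map2:
  assumes "strongly_measurable M f" "strongly_measurable M g"
    and h: "\<And>X Y x y. X \<longlonglongrightarrow> x \<Longrightarrow> Y \<longlonglongrightarrow> y \<Longrightarrow> (\<lambda>i. h (X i) (Y i)) \<longlonglongrightarrow> h x y"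
  shows "strongly_measurable M (\<lambda>t. h (f t) (g t))"
proof -
  obtain s s' where s: "\<And>i::nat. simple_function M (s i)" "AE t in M. (\<lambda>i. s i t) \<longlonglongrightarrow> f t"
     and s': "\<And>i::nat. simple_function M (s' i)" "AE t in M. (\<lambda>i. s' i t) \<longlonglongrightarrow> g t"
    using assms(1,2) unfolding strongly_measurable_def by auto
  have "AE t in M. (\<lambda>i. h (s i t) (s' i t)) \<longlonglongrightarrow> h (f t) (g t)"
    using s(2) s'(2) by eventually_elim (rule h)
  moreover have "simple_function M (\<lambda>t. h (s i t) (s' i t))" for i
    by (rule simple_function_compose2[OF s(1) s'(1)])
  ultimately show ?thesis
    unfolding strongly_measurable_def by (intro exI[of _ "\<lambda>i t. h (s i t) (s' i t)"]) auto
qed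

lemma strongly_measurable_add:
  "strongly_measurable M f \<Longrightarrow> strongly_measurable M g \<Longrightarrow> strongly_measurable M (\<lambda>t. f t + g t)"
  by (rule strongly_measurable_map2[where h = "(+)"]) (simp_all add: tendsto_add)

lemma strongly_measurable_diff:
  "strongly_measurable M f \<Longrightarrow> strongly_measurable M g \<Longrightarrow> strongly_measurable M (\<lambda>t. f t - g t)"
  by (rule strongly_measurable_map2[where h = "(-)"]) (simp_all add: tendsto_diff)

lemma strongly_measurable_scaleR:
  "strongly_measurable M f \<Longrightarrow> strongly_measurable M (\<lambda>t. c *\<^sub>R f t)"
  by (rule strongly_measurable_map2[where g = f and h = "\<lambda>x y. c *\<^sub>R x"]) (simp_all add: tendsto_scaleR)

lemma strongly_measurable_norm:
  "strongly_measurable M f \<Longrightarrow> strongly_measurable M (\<lambda>t. norm (f t))"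
  by (rule strongly_measurable_map2[where g = f and h = "\<lambda>x y. norm x"]) (simp_all add: tendsto_norm)

lemma strongly_measurable_0 [simp]: "strongly_measurable M (\<lambda>_. 0)"
  by (rule strongly_measurable_simple) simp

text \<open>An Egorov argument for one tolerance. The exceptional sets are built from differences of
  two approximants instead of differences with \<open>f\<close>; they are simple functions, so
  measurability is immediate.\<close>

lemma strongly_measurable_approx:
  fixes f :: "real \<Rightarrow> 'u::real_normed_vector"
  assumes "finite_measure M" and f: "strongly_measurable M f" and e: "e > 0"
  shows "\<exists>s A. simple_function M s \<and> A \<in> sets M \<and> measure M A < e \<and>
     (AE t in M. t \<notin> A \<longrightarrow> norm (s t - f t) < e)"
proof -
  interpret finite_measure M by fact
  obtain s where s: "\<And>i::nat. simple_function M (s i)" and lim: "AE t in M. (\<lambda>i. s i t) \<longlonglongrightarrow> f t"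
    using f unfolding strongly_measurable_def by auto
  have [measurable]: "(\<lambda>t. norm (s j t - s k t)) \<in> borel_measurable M" for j k
    by (intro borel_measurable_simple_function simple_function_compose2[OF s s])
  define B where "B i = {t \<in> space M. \<exists>j\<ge>i. \<exists>k\<ge>i. e / 2 < norm (s j t - s k t)}" for i
  have B[measurable]: "B i \<in> sets M" for i unfolding B_def by measurable
  have "(\<lambda>i. measure M (B i)) \<longlonglongrightarrow> measure M (\<Inter>i. B i)"
  proof (rule finite_Lim_measure_decseq)
    show "decseq B" unfolding decseq_def B_def by (blast intro: order_trans)
  qed auto
  moreover have "measure M (\<Inter>i. B i) = 0"
  proof -
    have "AE t in M. t \<notin> (\<Inter>i. B i)"
      using lim
    proof eventually_elim
      fix t assume "(\<lambda>i. s i t) \<longlonglongrightarrow> f t"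
      then have "Cauchy (\<lambda>i. s i t)" by (rule LIMSEQ_imp_Cauchy)
      then obtain N where "\<forall>m\<ge>N. \<forall>n\<ge>N. norm (s m t - s n t) < e / 2"
        using e unfolding Cauchy_def dist_norm by (meson half_gt_zero)
      then have "t \<notin> B N" by (force simp: B_def)
      then show "t \<notin> (\<Inter>i. B i)" by blast
    qed
    then have "(\<Inter>i. B i) \<in> null_sets M" by (subst AE_iff_null_sets) auto
    then show ?thesis by (simp add: measure_def null_setsD1)
  qed
  ultimately have "\<forall>\<^sub>F i in sequentially. measure M (B i) < e"
    using e by (intro order_tendstoD) auto
  then obtain i where i: "measure M (B i) < e" by (meson eventually_sequentially le_refl)
  have "AE t in M. t \<notin> B i \<longrightarrow> norm (s i t - f t) < e"
    using lim AE_space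
  proof eventually_elim
    fix t assume l: "(\<lambda>i. s i t) \<longlonglongrightarrow> f t" and sp: "t \<in> space M"
    show "t \<notin> B i \<longrightarrow> norm (s i t - f t) < e"
    proof
      assume "t \<notin> B i"
      then have "\<forall>k\<ge>i. norm (s i t - s k t) \<le> e / 2" using sp by (auto simp: B_def not_less)
      moreover have "(\<lambda>k. norm (s i t - s k t)) \<longlonglongrightarrow> norm (s i t - f t)" by (intro tendsto_intros l)
      ultimately have "norm (s i t - f t) \<le> e / 2" by (intro LIMSEQ_le_const2) auto
      then show "norm (s i t - f t) < e" using e by linarith
    qed
  qed
  with s[of i] B[of i] i show ?thesis by blast
qed

text \<open>Simple approximations up to exceptional sets of summable measure converge almost everywhere, by Borel--Cantelli.\<close>

lemma strongly_measurable_lim: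
  fixes f :: "nat \<Rightarrow> real \<Rightarrow> 'u::real_normed_vector"
  assumes fin: "finite_measure M" and f: "\<And>n. strongly_measurable M (f n)"
    and lim: "AE t in M. (\<lambda>n. f n t) \<longlonglongrightarrow> g t"
  shows "strongly_measurable M g"
proof -
  interpret finite_measure M by fact
  have "\<exists>p. simple_function M (fst p) \<and> snd p \<in> sets M \<and> measure M (snd p) < (1/2) ^ n \<and>
     (AE t in M. t \<notin> snd p \<longrightarrow> norm (fst p t - f n t) < (1/2) ^ n)" for n :: nat
    using strongly_measurable_approx[OF fin f, of "(1/2) ^ n" n] by auto
  then obtain p where p: "\<forall>n. simple_function M (fst (p n)) \<and> snd (p n) \<in> sets M \<and>
     measure M (snd (p n)) < (1/2) ^ n \<and>
     (AE t in M. t \<notin> snd (p n) \<longrightarrow> norm (fst (p n) t - f n t) < (1/2) ^ n)"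
    using choice[of "\<lambda>n p. simple_function M (fst p) \<and> snd p \<in> sets M \<and> measure M (snd p) < (1/2) ^ n \<and>
     (AE t in M. t \<notin> snd p \<longrightarrow> norm (fst p t - f n t) < (1/2) ^ n)"] by blast
  define s A where "s n = fst (p n)" and "A n = snd (p n)" for n
  have s: "\<And>n. simple_function M (s n)" and A: "\<And>n. A n \<in> sets M"
      and small: "\<And>n. measure M (A n) < (1/2) ^ n"
      and close: "\<And>n. AE t in M. t \<notin> A n \<longrightarrow> norm (s n t - f n t) < (1/2) ^ n"
    using p by (auto simp: s_def A_def)
  have "AE t in M. \<forall>\<^sub>F n in sequentially. t \<in> space M - A n"
  proof (rule borel_cantelli_AE1)
    show "summable (\<lambda>n. measure M (A n))"
      using small by (intro summable_comparison_test'[OF summable_geometric[of "1/2"], of 0]) (simp_all add: less_imp_le)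
  qed (use A in \<open>auto simp: emeasure_eq_measure\<close>)
  moreover have "AE t in M. \<forall>n. t \<notin> A n \<longrightarrow> norm (s n t - f n t) < (1/2) ^ n"
    using close by (simp add: AE_all_countable)
  ultimately have "AE t in M. (\<lambda>n. s n t) \<longlonglongrightarrow> g t"
    using lim
  proof eventually_elim
    fix t assume 1: "\<forall>\<^sub>F n in sequentially. t \<in> space M - A n"
      and 2: "\<forall>n. t \<notin> A n \<longrightarrow> norm (s n t - f n t) < (1/2) ^ n" and 3: "(\<lambda>n. f n t) \<longlonglongrightarrow> g t"
    have "(\<lambda>n. s n t - f n t) \<longlonglongrightarrow> 0"
    proof (rule Lim_null_comparison)
      show "\<forall>\<^sub>F n in sequentially. norm (s n t - f n t) \<le> (1/2) ^ n"
        by (rule eventually_mono[OF 1]) (use 2 in \<open>simp add: less_imp_le\<close>)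
      show "(\<lambda>n. (1/2::real) ^ n) \<longlonglongrightarrow> 0" by (rule LIMSEQ_power_zero) simp
    qed
    from tendsto_add[OF this 3] show "(\<lambda>n. s n t) \<longlonglongrightarrow> g t" by simp
  qed
  with s show ?thesis unfolding strongly_measurable_def by (intro exI[of _ s]) simp
qed

section \<open>Restriction, extension and translation of strongly measurable functions\<close>

lemma simple_function_lebesgue_on_subset:
  assumes "simple_function (lebesgue_on S) f" "S \<in> sets lebesgue" "T \<in> sets lebesgue" "T \<subseteq> S"
  shows "simple_function (lebesgue_on T) f"
  unfolding simple_function_def
proof (intro conjI ballI)
  show "finite (f ` space (lebesgue_on T))"
    by (rule finite_subset[of _ "f ` S"]) (use simple_functionD(1)[OF assms(1)] assms(4) in auto)
  fix x
  have "f -` {x} \<inter> space (lebesgue_on S) \<in> sets (lebesgue_on S)"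
    by (rule simple_functionD(2)[OF assms(1)])
  then have "f -` {x} \<inter> S \<in> sets lebesgue" using assms(2) by (simp add: sets_restrict_space_iff)
  then have "(f -` {x} \<inter> S) \<inter> T \<in> sets lebesgue" using assms(3) by blast
  moreover have "(f -` {x} \<inter> S) \<inter> T = f -` {x} \<inter> T" using assms(4) by blast
  ultimately show "f -` {x} \<inter> space (lebesgue_on T) \<in> sets (lebesgue_on T)"
    using assms(3) by (simp add: sets_restrict_space_iff)
qed

lemma AE_lebesgue_on_iff: "S \<in> sets lebesgue \<Longrightarrow> (AE t in lebesgue_on S. P t) \<longleftrightarrow> (AE t in lebesgue. t \<in> S \<longrightarrow> P t)"
  by (simp add: AE_restrict_space_iff)

lemma AE_lebesgue_on_subset:
  assumes "AE t in lebesgue_on S. P t" "S \<in> sets lebesgue" "T \<in> sets lebesgue" "T \<subseteq> S"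
  shows "AE t in lebesgue_on T. P t"
  using assms by (auto simp: AE_lebesgue_on_iff)

lemma strongly_measurable_subset:
  assumes "strongly_measurable (lebesgue_on S) f" "S \<in> sets lebesgue" "T \<in> sets lebesgue" "T \<subseteq> S"
  shows "strongly_measurable (lebesgue_on T) f"
  using assms simple_function_lebesgue_on_subset AE_lebesgue_on_subset
  unfolding strongly_measurable_def by meson

lemma strongly_measurable_restrict:
  fixes S :: "real set"
  assumes "strongly_measurable lebesgue f" "S \<in> sets lebesgue"
  shows "strongly_measurable (lebesgue_on S) f"
  using strongly_measurable_subset[of UNIV f S] assms by (simp add: lebesgue_on_UNIV_eq)

lemma strongly_measurable_extend:
  fixes S :: "real set"
  assumes f: "strongly_measurable (lebesgue_on S) f" and S: "S \<in> sets lebesgue"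
  shows "strongly_measurable lebesgue (\<lambda>t. if t \<in> S then f t else 0)"
proof -
  obtain s where s: "\<And>i::nat. simple_function (lebesgue_on S) (s i)"
     and lim: "AE t in lebesgue_on S. (\<lambda>i. s i t) \<longlonglongrightarrow> f t"
    using f unfolding strongly_measurable_def by auto
  have "simple_function lebesgue (\<lambda>t. if t \<in> S then s i t else 0)" for i
    unfolding simple_function_def
  proof (intro conjI ballI)
    show "finite ((\<lambda>t. if t \<in> S then s i t else 0) ` space lebesgue)"
      by (rule finite_subset[of _ "insert 0 (s i ` S)"]) (use simple_functionD(1)[OF s[of i]] in auto)
    fix x
    have "s i -` {x} \<inter> S \<in> sets lebesgue"
      using simple_functionD(2)[OF s[of i], of "{x}"] S by (simp add: sets_restrict_space_iff)
    moreover have "(\<lambda>t. if t \<in> S then s i t else 0) -` {x} \<inter> space lebesgue =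
        (s i -` {x} \<inter> S) \<union> (if x = 0 then - S else {})" by (auto split: if_splits)
    moreover have "- S \<in> sets lebesgue" using sets.compl_sets[OF S] by (simp add: Compl_eq_Diff_UNIV)
    ultimately show "(\<lambda>t. if t \<in> S then s i t else 0) -` {x} \<inter> space lebesgue \<in> sets lebesgue"
      using S by auto
  qed
  moreover have "AE t in lebesgue. (\<lambda>i. if t \<in> S then s i t else 0) \<longlonglongrightarrow> (if t \<in> S then f t else 0)"
    using lim unfolding AE_lebesgue_on_iff[OF S] by eventually_elim auto
  ultimately show ?thesis
    unfolding strongly_measurable_def by (intro exI[of _ "\<lambda>i t. if t \<in> S then s i t else 0"]) auto
qed

lemma strongly_measurable_If:
  fixes S :: "real set"
  assumes f: "strongly_measurable lebesgue f" and g: "strongly_measurable lebesgue g" and S: "S \<in> sets lebesgue"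
  shows "strongly_measurable lebesgue (\<lambda>t. if t \<in> S then f t else g t)"
proof -
  have "- S \<in> sets lebesgue" using sets.compl_sets[OF S] by (simp add: Compl_eq_Diff_UNIV)
  then have "strongly_measurable lebesgue (\<lambda>t. (if t \<in> S then f t else 0) + (if t \<in> - S then g t else 0))"
    using f g S by (intro strongly_measurable_add strongly_measurable_extend strongly_measurable_restrict) auto
  then show ?thesis by (rule strongly_measurable_AE_cong) auto
qed

lemma AE_lebesgue_translate:
  assumes "AE t in lebesgue. P t"
  shows "AE t in lebesgue. P (t + c :: real)"
proof -
  obtain N where N: "{t. \<not> P t} \<subseteq> N" "negligible N"
    using assms by (auto simp: eventually_ae_filter negligible_iff_null_sets)
  have "negligible ((+) (- c) ` N)" by (rule negligible_translation[OF N(2)])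
  moreover have "{t. \<not> P (t + c)} \<subseteq> (+) (- c) ` N" using N(1) by (force simp: image_iff)
  ultimately show ?thesis by (auto simp: eventually_ae_filter negligible_iff_null_sets)
qed

lemma strongly_measurable_translate:
  assumes "strongly_measurable lebesgue f"
  shows "strongly_measurable lebesgue (\<lambda>t. f (t + c))"
proof -
  obtain s where s: "\<And>i::nat. simple_function lebesgue (s i)" "AE t in lebesgue. (\<lambda>i. s i t) \<longlonglongrightarrow> f t"
    using assms unfolding strongly_measurable_def by auto
  have "simple_function lebesgue (\<lambda>t. s i (t + c))" for i
    unfolding simple_function_def
  proof (intro conjI ballI)
    show "finite ((\<lambda>t. s i (t + c)) ` space lebesgue)"
      by (rule finite_subset[of _ "s i ` UNIV"]) (use simple_functionD(1)[OF s(1)[of i]] in auto)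
    fix x
    have "s i -` {x} \<in> sets lebesgue" using simple_functionD(2)[OF s(1)[of i], of "{x}"] by simp
    then have "(\<lambda>t. - c + t) ` (s i -` {x}) \<in> sets lebesgue" by (rule lebesgue_sets_translation)
    moreover have "(\<lambda>t. - c + t) ` (s i -` {x}) = (\<lambda>t. s i (t + c)) -` {x}"
      by (force simp: image_iff)
    ultimately show "(\<lambda>t. s i (t + c)) -` {x} \<inter> space lebesgue \<in> sets lebesgue" by simp
  qed
  with AE_lebesgue_translate[OF s(2), of c] show ?thesis
    unfolding strongly_measurable_def by (intro exI[of _ "\<lambda>i t. s i (t + c)"]) auto
qed

text \<open>The approximation by simple functions holds almost everywhere only; after extension by
  zero to the whole line, completeness of Lebesgue measure absorbs the null set.\<close>

lemma strongly_measurable_real_imp_borel: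
  fixes f :: "real \<Rightarrow> real"
  assumes f: "strongly_measurable (lebesgue_on S) f" and S: "S \<in> sets lebesgue"
  shows "f \<in> borel_measurable (lebesgue_on S)"
proof -
  let ?f = "\<lambda>t. if t \<in> S then f t else 0"
  obtain s where s: "\<And>i::nat. simple_function lebesgue (s i)" "AE t in lebesgue. (\<lambda>i. s i t) \<longlonglongrightarrow> ?f t"
    using strongly_measurable_extend[OF assms] unfolding strongly_measurable_def by auto
  have [measurable]: "s i \<in> borel_measurable lebesgue" for i
    by (rule borel_measurable_simple_function[OF s(1)])
  have "(\<lambda>t. lim (\<lambda>i. s i t)) \<in> borel_measurable lebesgue" by measurable
  moreover have "AE t in lebesgue. lim (\<lambda>i. s i t) = ?f t" using s(2) by eventually_elim (rule limI)
  ultimately have "?f \<in> borel_measurable lebesgue" by (rule borel_measurable_AE)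
  then have "?f \<in> borel_measurable (lebesgue_on S)" by (rule measurable_restrict_space1)
  then show ?thesis using S by (subst measurable_cong[of _ _ ?f]) auto
qed

lemma strongly_measurable_norm_borel:
  assumes "strongly_measurable (lebesgue_on S) f" "S \<in> sets lebesgue"
  shows "(\<lambda>t. norm (f t)) \<in> borel_measurable (lebesgue_on S)"
  by (intro strongly_measurable_real_imp_borel strongly_measurable_norm assms)

text \<open>Round time down to a grid of mesh \<open>1/(n+1)\<close>. On a bounded interval only
  finitely many grid points occur, so composing with \<open>g\<close> gives simple functions,
  whatever the size of the range space.\<close>

lemma strongly_measurable_continuous:
  fixes g :: "real \<Rightarrow> 'u::real_normed_vector"
  assumes g: "continuous_on {0..T} g"
  shows "strongly_measurable (lebesgue_on {0<..<T}) g"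
proof -
  define N where "N n = real (Suc n)" for n
  have N: "N n > 0" for n by (simp add: N_def)
  define q where "q n t = real_of_int \<lfloor>N n * t\<rfloor> / N n" for n t
  have q: "q n t \<le> t" "t - q n t \<le> inverse (N n)" "0 \<le> t \<Longrightarrow> 0 \<le> q n t" for n t
  proof -
    have "real_of_int \<lfloor>N n * t\<rfloor> \<le> N n * t" by (rule of_int_floor_le)
    then show "q n t \<le> t" unfolding q_def using N[of n] by (simp add: pos_divide_le_eq mult.commute)
    have "N n * t \<le> real_of_int \<lfloor>N n * t\<rfloor> + 1" by linarith
    then have "t \<le> (real_of_int \<lfloor>N n * t\<rfloor> + 1) / N n"
      using N[of n] by (simp add: pos_le_divide_eq mult.commute)
    then show "t - q n t \<le> inverse (N n)" unfolding q_def
      by (simp add: add_divide_distrib inverse_eq_divide)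
    show "0 \<le> q n t" if "0 \<le> t" using that N[of n] unfolding q_def by simp
  qed
  have "simple_function (lebesgue_on {0<..<T}) (q n)" for n
  proof (rule simple_function_borel_measurable)
    have "q n \<in> borel_measurable borel" unfolding q_def by measurable
    then show "q n \<in> borel_measurable (lebesgue_on {0<..<T})"
      by (intro measurable_restrict_space1 measurable_completion) simp
    have "q n ` {0<..<T} \<subseteq> (\<lambda>i. real_of_int i / N n) ` {0..\<lceil>N n * T\<rceil>}"
    proof
      fix y assume "y \<in> q n ` {0<..<T}"
      then obtain t where t: "0 < t" "t < T" "y = q n t" by auto
      have "N n * t \<le> N n * T" using t N[of n] by (intro mult_left_mono) auto
      then have "\<lfloor>N n * t\<rfloor> \<le> \<lceil>N n * T\<rceil>" by linarith
      moreover have "0 \<le> \<lfloor>N n * t\<rfloor>" using t N[of n] by simp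
      ultimately show "y \<in> (\<lambda>i. real_of_int i / N n) ` {0..\<lceil>N n * T\<rceil>}"
        using t(3) unfolding q_def by auto
    qed
    then show "finite (q n ` space (lebesgue_on {0<..<T}))"
      using finite_subset[OF _ finite_imageI[OF finite_atLeastAtMost_int]] by simp
  qed
  then have "simple_function (lebesgue_on {0<..<T}) (\<lambda>t. g (q n t))" for n
    by (rule simple_function_compose1)
  moreover have "AE t in lebesgue_on {0<..<T}. (\<lambda>n. g (q n t)) \<longlonglongrightarrow> g t"
  proof (rule AE_I2)
    fix t assume "t \<in> space (lebesgue_on {0<..<T})"
    then have t: "0 < t" "t < T" by auto
    have "(\<lambda>n. t - q n t) \<longlonglongrightarrow> 0"
      by (rule tendsto_sandwich[of "\<lambda>_. 0" _ _ "\<lambda>n. inverse (N n)"])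
         (use q LIMSEQ_inverse_real_of_nat in \<open>auto simp: N_def\<close>)
    then have "(\<lambda>n. q n t) \<longlonglongrightarrow> t" using tendsto_diff[OF tendsto_const[of t]] by fastforce
    moreover have "q n t \<in> {0..T}" for n
      using q(1)[of n t] q(3)[of t n] t by simp
    ultimately show "(\<lambda>n. g (q n t)) \<longlonglongrightarrow> g t"
      using t by (intro continuous_on_tendsto_compose[OF g]) auto
  qed
  ultimately show ?thesis
    unfolding strongly_measurable_def by (intro exI[of _ "\<lambda>n t. g (q n t)"]) auto
qed

section \<open>Square integrable functions on an interval\<close>

abbreviation Ioo_measure :: "real \<Rightarrow> real measure" where "Ioo_measure T \<equiv> lebesgue_on {0<..<T}"

text \<open>The problem is stated with gauge integrals over closed intervals, the estimates below
  use Lebesgue integrals over open ones. A nonnegative gauge integrable function is absolutely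
  integrable, which links the two.\<close>

lemma integrable_on_iff_integrable_nonneg:
  fixes f :: "real \<Rightarrow> real"
  assumes "\<And>t. 0 \<le> f t"
  shows "f integrable_on {0..T} \<longleftrightarrow> integrable (Ioo_measure T) f"
proof -
  have "f integrable_on {0..T} \<longleftrightarrow> f absolutely_integrable_on {0<..<T}"
    using assms by (simp add: integrable_on_open_interval_real[symmetric] absolutely_integrable_on_iff_nonneg)
  then show ?thesis by (simp add: integrable_restrict_space set_integrable_def)
qed

lemma integral_eq_lebesgue_integral:
  fixes f :: "real \<Rightarrow> real"
  assumes "integrable (Ioo_measure T) f"
  shows "integral {0..T} f = integral\<^sup>L (Ioo_measure T) f"
  using lebesgue_integral_eq_integral[OF assms] by (simp add: integral_open_interval_real)

lemma L2_iff: "v \<in> L2 T \<longleftrightarrow> strongly_measurable (Ioo_measure T) v \<and> integrable (Ioo_measure T) (\<lambda>t. (norm (v t))\<^sup>2)"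
  by (simp add: L2_def integrable_on_iff_integrable_nonneg)

definition L2_sq :: "real \<Rightarrow> (real \<Rightarrow> 'u::real_normed_vector) \<Rightarrow> real" where
  "L2_sq T v = integral {0..T} (\<lambda>t. (norm (v t))\<^sup>2)"

lemma L2_sq_nonneg: "0 \<le> L2_sq T v"
proof (cases "(\<lambda>t. (norm (v t))\<^sup>2) integrable_on {0..T}")
  case True
  then show ?thesis unfolding L2_sq_def by (rule Henstock_Kurzweil_Integration.integral_nonneg) simp
qed (simp add: L2_sq_def not_integrable_integral)

lemma L2_norm_on_sqrt: "L2_norm_on T v = sqrt (L2_sq T v)"
  by (simp add: L2_norm_on_def L2_sq_def)

lemma L2_sq_eq: "v \<in> L2 T \<Longrightarrow> L2_sq T v = (\<integral>t. (norm (v t))\<^sup>2 \<partial>Ioo_measure T)"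
  by (simp add: L2_sq_def L2_iff integral_eq_lebesgue_integral)

lemma L2_norm_measurable: "v \<in> L2 T \<Longrightarrow> (\<lambda>t. norm (v t)) \<in> borel_measurable (Ioo_measure T)"
  by (auto simp: L2_iff intro: strongly_measurable_norm_borel)

lemma L2_I:
  assumes v: "strongly_measurable (Ioo_measure T) v" and g: "integrable (Ioo_measure T) g"
    and le: "AE t in Ioo_measure T. (norm (v t))\<^sup>2 \<le> g t"
  shows "v \<in> L2 T"
  unfolding L2_iff
proof
  have [measurable]: "(\<lambda>t. norm (v t)) \<in> borel_measurable (Ioo_measure T)"
    by (intro strongly_measurable_norm_borel v) simp
  show "integrable (Ioo_measure T) (\<lambda>t. (norm (v t))\<^sup>2)"
    by (rule Bochner_Integration.integrable_bound[OF g]) (use le in auto)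
qed (fact v)

lemma norm_add_sq_le: "(norm (x + y))\<^sup>2 \<le> 2 * (norm x)\<^sup>2 + 2 * (norm y)\<^sup>2"
  for x y :: "'a::real_normed_vector"
proof -
  have "(norm (x + y))\<^sup>2 \<le> (norm x + norm y)\<^sup>2" by (intro power_mono norm_triangle_ineq) simp
  moreover have "0 \<le> (norm x - norm y)\<^sup>2" by simp
  ultimately show ?thesis by (simp add: power2_eq_square algebra_simps)
qed

lemma L2_add: assumes "u \<in> L2 T" "v \<in> L2 T"
  shows "(\<lambda>t. u t + v t) \<in> L2 T" "L2_sq T (\<lambda>t. u t + v t) \<le> 2 * L2_sq T u + 2 * L2_sq T v"
proof -
  have int: "integrable (Ioo_measure T) (\<lambda>t. 2 * (norm (u t))\<^sup>2 + 2 * (norm (v t))\<^sup>2)"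
    using assms by (simp add: L2_iff)
  show mem: "(\<lambda>t. u t + v t) \<in> L2 T"
    using assms by (intro L2_I[OF strongly_measurable_add int]) (auto simp: L2_iff intro: norm_add_sq_le)
  have "(\<integral>t. (norm (u t + v t))\<^sup>2 \<partial>Ioo_measure T) \<le> (\<integral>t. 2 * (norm (u t))\<^sup>2 + 2 * (norm (v t))\<^sup>2 \<partial>Ioo_measure T)"
    using mem int by (intro integral_mono) (auto simp: L2_iff norm_add_sq_le)
  then show "L2_sq T (\<lambda>t. u t + v t) \<le> 2 * L2_sq T u + 2 * L2_sq T v"
    using assms mem by (simp add: L2_sq_eq) (simp add: L2_iff)
qed

lemma L2_scaleR: assumes "u \<in> L2 T"
  shows "(\<lambda>t. c *\<^sub>R u t) \<in> L2 T" "L2_sq T (\<lambda>t. c *\<^sub>R u t) = c\<^sup>2 * L2_sq T u"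
proof -
  show "(\<lambda>t. c *\<^sub>R u t) \<in> L2 T"
    using assms by (simp add: L2_iff strongly_measurable_scaleR power_mult_distrib)
  show "L2_sq T (\<lambda>t. c *\<^sub>R u t) = c\<^sup>2 * L2_sq T u"
    by (simp add: L2_sq_def power_mult_distrib)
qed

lemma L2_diff: assumes "u \<in> L2 T" "v \<in> L2 T"
  shows "(\<lambda>t. u t - v t) \<in> L2 T" "L2_sq T (\<lambda>t. u t - v t) \<le> 2 * L2_sq T u + 2 * L2_sq T v"
  using L2_add[OF assms(1) L2_scaleR(1)[OF assms(2), of "-1"]] L2_scaleR(2)[OF assms(2), of "-1"]
  by simp_all

lemma L2_sq_commute: "L2_sq T (\<lambda>t. u t - v t) = L2_sq T (\<lambda>t. v t - u t)"
  by (simp add: L2_sq_def norm_minus_commute)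

text \<open>A triangle inequality for squares. Its factor 2 is the origin of the factors 2 and 4 in
  the construction of the extended observation.\<close>

lemma L2_sq_triangle: assumes "u \<in> L2 T" "v \<in> L2 T" "w \<in> L2 T"
  shows "L2_sq T (\<lambda>t. u t - w t) \<le> 2 * L2_sq T (\<lambda>t. u t - v t) + 2 * L2_sq T (\<lambda>t. v t - w t)"
  using L2_add(2)[OF L2_diff(1)[OF assms(1,2)] L2_diff(1)[OF assms(2,3)]] by simp

lemma L2_sq_cong: assumes "AE t in Ioo_measure T. u t = v t" "u \<in> L2 T"
  shows "v \<in> L2 T" "L2_sq T v = L2_sq T u"
proof -
  have sm: "strongly_measurable (Ioo_measure T) v"
    using assms strongly_measurable_AE_cong L2_iff by blast
  show v: "v \<in> L2 T"
    using assms by (intro L2_I[OF sm, of "\<lambda>t. (norm (u t))\<^sup>2"]) (auto simp: L2_iff elim: eventually_mono)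
  have "(\<integral>t. (norm (v t))\<^sup>2 \<partial>Ioo_measure T) = (\<integral>t. (norm (u t))\<^sup>2 \<partial>Ioo_measure T)"
    using assms L2_norm_measurable[OF v] L2_norm_measurable[OF assms(2)]
    by (intro integral_cong_AE) (auto elim: eventually_mono)
  then show "L2_sq T v = L2_sq T u" using v assms(2) by (simp add: L2_sq_eq)
qed

lemma L2_sq_zero_iff: assumes "v \<in> L2 T"
  shows "L2_sq T v = 0 \<longleftrightarrow> (AE t in Ioo_measure T. v t = 0)"
  using assms by (simp add: L2_sq_eq L2_iff integral_nonneg_eq_0_iff_AE)

lemma L2_imp_norm_integrable: assumes v: "v \<in> L2 T" shows "integrable (Ioo_measure T) (\<lambda>t. norm (v t))"
proof -
  interpret finite_measure "Ioo_measure T" by (rule finite_measure_lebesgue_on_Ioo)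
  have g: "integrable (Ioo_measure T) (\<lambda>t. (norm (v t))\<^sup>2 + 1)" using v by (simp add: L2_iff)
  show ?thesis
  proof (rule Bochner_Integration.integrable_bound[OF g L2_norm_measurable[OF v]])
    have "x \<le> x\<^sup>2 + 1" for x :: real
    proof -
      have "0 \<le> (x - 1/2)\<^sup>2" by simp
      then show ?thesis by (simp add: power2_eq_square algebra_simps)
    qed
    then show "AE t in Ioo_measure T. norm (norm (v t)) \<le> norm ((norm (v t))\<^sup>2 + 1)" by simp
  qed
qed

lemma measure_Ioo: "0 \<le> T \<Longrightarrow> measure (Ioo_measure T) (space (Ioo_measure T)) = T"
  by (simp add: measure_restrict_space)

text \<open>Cauchy-Schwarz as nonnegativity of a variance: \<open>c\<close> is the mean of
  \<open>norm (v t)\<close> over the interval.\<close>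

lemma integral_norm_sq_le: assumes T: "0 < T" and v: "v \<in> L2 T"
  shows "(integral {0..T} (\<lambda>t. norm (v t)))\<^sup>2 \<le> T * L2_sq T v"
proof -
  interpret finite_measure "Ioo_measure T" by (rule finite_measure_lebesgue_on_Ioo)
  let ?M = "Ioo_measure T"
  have int: "integrable ?M (\<lambda>t. (norm (v t))\<^sup>2)" "integrable ?M (\<lambda>t. norm (v t))"
    using v L2_imp_norm_integrable by (auto simp: L2_iff)
  define a where "a = (\<integral>t. norm (v t) \<partial>?M)"
  define c where "c = a / T"
  have "0 \<le> (\<integral>t. (norm (v t) - c)\<^sup>2 \<partial>?M)" by (rule Bochner_Integration.integral_nonneg) simp
  also have "\<dots> = (\<integral>t. (norm (v t))\<^sup>2 + (- 2 * c * norm (v t) + c\<^sup>2) \<partial>?M)"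
    by (rule Bochner_Integration.integral_cong) (auto simp: power2_eq_square algebra_simps)
  also have "\<dots> = L2_sq T v - 2 * c * a + c\<^sup>2 * T"
    using int measure_Ioo[of T] T by (simp add: L2_sq_eq[OF v] a_def)
  also have "\<dots> = L2_sq T v - a\<^sup>2 / T" using T by (simp add: c_def power2_eq_square field_simps)
  finally have "a\<^sup>2 \<le> T * L2_sq T v" using T by (simp add: field_simps)
  then show ?thesis using integral_eq_lebesgue_integral[OF int(2)] by (simp add: a_def)
qed

lemma integral_norm_le: assumes T: "0 < T" and v: "v \<in> L2 T"
  shows "integral {0..T} (\<lambda>t. norm (v t)) \<le> sqrt T * L2_norm_on T v"
  unfolding L2_norm_on_sqrt real_sqrt_mult[symmetric]
  by (rule real_le_rsqrt[OF integral_norm_sq_le[OF assms]])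

text \<open>Riesz-Fischer. Two modes of convergence are recorded: almost everywhere along a
  subsequence, to preserve pointwise bounds on controls, and in squared norm for the whole sequence,
  to pass to the limit in the input map.\<close>

lemma L2_complete:
  fixes v :: "nat \<Rightarrow> real \<Rightarrow> 'u::banach"
  assumes T: "0 \<le> T" and v: "\<And>n. v n \<in> L2 T"
    and cauchy: "\<And>e. e > 0 \<Longrightarrow> \<exists>N. \<forall>m\<ge>N. \<forall>n\<ge>N. L2_sq T (\<lambda>t. v m t - v n t) < e"
  shows "\<exists>w r. w \<in> L2 T \<and> strict_mono (r :: nat \<Rightarrow> nat) \<and> (AE t in Ioo_measure T. (\<lambda>k. v (r k) t) \<longlonglongrightarrow> w t)
     \<and> (\<lambda>n. L2_sq T (\<lambda>t. v n t - w t)) \<longlonglongrightarrow> 0"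
proof -
  interpret finite_measure "Ioo_measure T" by (rule finite_measure_lebesgue_on_Ioo)
  let ?M = "Ioo_measure T"
  have "\<exists>N. \<forall>m\<ge>N. \<forall>n\<ge>N. L2_sq T (\<lambda>t. v m t - v n t) < (1/4) ^ k" for k :: nat
    by (rule cauchy) simp
  then obtain N where N: "\<And>k m n. m \<ge> N k \<Longrightarrow> n \<ge> N k \<Longrightarrow> L2_sq T (\<lambda>t. v m t - v n t) < (1/4) ^ k" by metis
  define r where "r = rec_nat (N 0) (\<lambda>k x. max (Suc x) (N (Suc k)))"
  have rS: "r (Suc k) = max (Suc (r k)) (N (Suc k))" for k by (simp add: r_def)
  have rN: "r k \<ge> N k" for k by (cases k) (simp_all add: r_def)
  have sm: "strict_mono r" by (rule strict_monoI_Suc) (simp add: rS)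
  define d where "d k t = v (r (Suc k)) t - v (r k) t" for k t
  have d: "d k \<in> L2 T" for k unfolding d_def by (intro L2_diff v)
  have dsq: "L2_sq T (d k) \<le> (1/4) ^ k" for k
  proof -
    have "N k \<le> r (Suc k)" using rN[of k] rS[of k] by simp
    then show ?thesis unfolding d_def using N[of k "r (Suc k)" "r k"] rN[of k] by (simp add: less_imp_le)
  qed
  \<comment> \<open>Young's inequality with weight \<open>2^k\<close>: the squared distance is at
    most \<open>4^-k\<close>, so both terms are of order \<open>2^-k\<close> and the increments are
    summable in \<open>L^1\<close>.\<close>
  have dnorm: "(\<integral>t. norm (d k t) \<partial>?M) \<le> (1 + T) * (1/2) ^ k" for k
  proof -
    have "(\<integral>t. norm (d k t) \<partial>?M) \<le> (\<integral>t. 2 ^ k * (norm (d k t))\<^sup>2 + (1/2) ^ k \<partial>?M)"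
    proof (rule integral_mono)
      show "norm (d k t) \<le> 2 ^ k * (norm (d k t))\<^sup>2 + (1/2) ^ k" for t
      proof -
        have "0 \<le> 2 ^ k * (norm (d k t) - (1/2) ^ k)\<^sup>2" by simp
        also have "\<dots> = 2 ^ k * (norm (d k t))\<^sup>2 - 2 * norm (d k t) + (1/2) ^ k"
          by (simp add: power2_eq_square algebra_simps power_mult_distrib[symmetric])
        finally show ?thesis using norm_ge_zero[of "d k t"] by linarith
      qed
    qed (use d L2_imp_norm_integrable in \<open>auto simp: L2_iff\<close>)
    also have "\<dots> = 2 ^ k * L2_sq T (d k) + (1/2) ^ k * T"
      using d measure_Ioo[OF T] by (simp add: L2_sq_eq L2_iff)
    also have "\<dots> \<le> 2 ^ k * (1/4) ^ k + (1/2) ^ k * T"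
      using dsq by simp
    also have "2 ^ k * (1/4) ^ k = (1/2::real) ^ k" by (simp flip: power_mult_distrib)
    finally show ?thesis by (simp add: algebra_simps)
  qed
  have [measurable]: "(\<lambda>t. norm (d k t)) \<in> borel_measurable ?M" for k by (rule L2_norm_measurable[OF d])
  have "(\<integral>\<^sup>+t. (\<Sum>k. ennreal (norm (d k t))) \<partial>?M) = (\<Sum>k. \<integral>\<^sup>+t. ennreal (norm (d k t)) \<partial>?M)"
    by (rule nn_integral_suminf) measurable
  also have "\<dots> = (\<Sum>k. ennreal (\<integral>t. norm (d k t) \<partial>?M))"
    using L2_imp_norm_integrable[OF d] by (intro suminf_cong nn_integral_eq_integral) auto
  also have "\<dots> \<le> (\<Sum>k. ennreal ((1 + T) * (1/2) ^ k))"
    using dnorm by (intro suminf_le ennreal_leI) auto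
  also have "\<dots> = ennreal (\<Sum>k. (1 + T) * (1/2) ^ k)"
    using T by (intro suminf_ennreal2) (auto intro: summable_mult summable_geometric)
  also have "\<dots> < \<infinity>" by simp
  finally have "(\<integral>\<^sup>+t. (\<Sum>k. ennreal (norm (d k t))) \<partial>?M) \<noteq> \<infinity>" by simp
  then have "AE t in ?M. (\<Sum>k. ennreal (norm (d k t))) \<noteq> \<infinity>"
    by (intro nn_integral_PInf_AE) measurable
  then have conv: "AE t in ?M. convergent (\<lambda>k. v (r k) t)"
  proof eventually_elim
    fix t assume "(\<Sum>k. ennreal (norm (d k t))) \<noteq> \<infinity>"
    then have "summable (\<lambda>k. norm (d k t))" by (intro summable_suminf_not_top) auto
    then have "(\<lambda>n. \<Sum>k<n. d k t) \<longlonglongrightarrow> (\<Sum>k. d k t)" by (rule summable_LIMSEQ[OF summable_norm_cancel])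
    then have "(\<lambda>n. (\<Sum>k<n. d k t) + v (r 0) t) \<longlonglongrightarrow> (\<Sum>k. d k t) + v (r 0) t" by (intro tendsto_intros)
    moreover have "(\<Sum>k<n. d k t) + v (r 0) t = v (r n) t" for n
      unfolding d_def using sum_lessThan_telescope[of "\<lambda>k. v (r k) t" n] by simp
    ultimately show "convergent (\<lambda>k. v (r k) t)" unfolding convergent_def by auto
  qed
  define w where "w t = lim (\<lambda>k. v (r k) t)" for t
  have lim: "AE t in ?M. (\<lambda>k. v (r k) t) \<longlonglongrightarrow> w t"
    using conv unfolding w_def by eventually_elim (simp add: convergent_LIMSEQ_iff)
  have w: "strongly_measurable ?M w"
    using v by (intro strongly_measurable_lim[OF finite_measure_axioms _ lim]) (simp add: L2_iff)
  \<comment> \<open>Fatou's lemma along the subsequence: a bound on the distance from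
    \<open>v n\<close> to all later members carries over to the limit.\<close>
  have bound: "(\<lambda>t. v n t - w t) \<in> L2 T \<and> L2_sq T (\<lambda>t. v n t - w t) \<le> e"
    if e: "e > 0" and n: "\<And>m. m \<ge> M \<Longrightarrow> L2_sq T (\<lambda>t. v n t - v m t) < e" for n e M
  proof -
    have vw: "strongly_measurable ?M (\<lambda>t. v n t - w t)"
      using v w by (intro strongly_measurable_diff) (auto simp: L2_iff)
    have [measurable]: "(\<lambda>t. norm (v n t - w t)) \<in> borel_measurable ?M"
      by (intro strongly_measurable_norm_borel vw) simp
    have [measurable]: "(\<lambda>t. norm (v n t - v (r k) t)) \<in> borel_measurable ?M" for k
      by (intro L2_norm_measurable L2_diff v)
    have "(\<integral>\<^sup>+t. ennreal ((norm (v n t - w t))\<^sup>2) \<partial>?M) =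
        (\<integral>\<^sup>+t. liminf (\<lambda>k. ennreal ((norm (v n t - v (r k) t))\<^sup>2)) \<partial>?M)"
    proof (rule nn_integral_cong_AE)
      show "AE t in ?M. ennreal ((norm (v n t - w t))\<^sup>2) = liminf (\<lambda>k. ennreal ((norm (v n t - v (r k) t))\<^sup>2))"
        using lim
      proof eventually_elim
        fix t assume "(\<lambda>k. v (r k) t) \<longlonglongrightarrow> w t"
        then have "(\<lambda>k. ennreal ((norm (v n t - v (r k) t))\<^sup>2)) \<longlonglongrightarrow> ennreal ((norm (v n t - w t))\<^sup>2)"
          by (intro tendsto_ennrealI tendsto_intros)
        then show "ennreal ((norm (v n t - w t))\<^sup>2) = liminf (\<lambda>k. ennreal ((norm (v n t - v (r k) t))\<^sup>2))"
          by (intro lim_imp_Liminf[symmetric] trivial_limit_sequentially)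
      qed
    qed
    also have "\<dots> \<le> liminf (\<lambda>k. \<integral>\<^sup>+t. ennreal ((norm (v n t - v (r k) t))\<^sup>2) \<partial>?M)"
      by (rule nn_integral_liminf) measurable
    also have "\<dots> = liminf (\<lambda>k. ennreal (L2_sq T (\<lambda>t. v n t - v (r k) t)))"
      using L2_diff(1)[OF v v] by (simp add: L2_sq_eq nn_integral_eq_integral L2_iff)
    also have "\<dots> \<le> ennreal e"
    proof (rule Liminf_le)
      have "r k \<ge> M" if "k \<ge> M" for k using seq_suble[OF sm, of k] that by linarith
      then show "\<forall>\<^sub>F k in sequentially. ennreal (L2_sq T (\<lambda>t. v n t - v (r k) t)) \<le> ennreal e"
        unfolding eventually_sequentially by (intro exI[of _ M]) (auto intro!: ennreal_leI less_imp_le[OF n])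
    qed simp
    finally have le: "(\<integral>\<^sup>+t. ennreal ((norm (v n t - w t))\<^sup>2) \<partial>?M) \<le> ennreal e" .
    have int: "integrable ?M (\<lambda>t. (norm (v n t - w t))\<^sup>2)"
      by (rule integrableI_nonneg) (use le in \<open>auto simp: less_top[symmetric] top_unique\<close>)
    have "ennreal (\<integral>t. (norm (v n t - w t))\<^sup>2 \<partial>?M) \<le> ennreal e"
      using le nn_integral_eq_integral[OF int] by simp
    then show ?thesis using vw int e by (auto simp: L2_iff L2_sq_eq ennreal_le_iff)
  qed
  have "w \<in> L2 T"
  proof -
    obtain M where "\<forall>m\<ge>M. \<forall>n\<ge>M. L2_sq T (\<lambda>t. v m t - v n t) < 1" using cauchy[of 1] by auto
    then have "(\<lambda>t. v M t - w t) \<in> L2 T" using bound[of 1 M M] by simp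
    from L2_diff(1)[OF v[of M] this] show ?thesis by simp
  qed
  moreover have "(\<lambda>n. L2_sq T (\<lambda>t. v n t - w t)) \<longlonglongrightarrow> 0"
  proof (rule LIMSEQ_I)
    fix e :: real assume e: "e > 0"
    obtain M where M: "\<forall>m\<ge>M. \<forall>n\<ge>M. L2_sq T (\<lambda>t. v m t - v n t) < e / 2" using cauchy[of "e / 2"] e by auto
    have "norm (L2_sq T (\<lambda>t. v n t - w t) - 0) < e" if "n \<ge> M" for n
      using bound[of "e / 2" M n] M that e L2_sq_nonneg[of T "\<lambda>t. v n t - w t"] by simp
    then show "\<exists>M. \<forall>n\<ge>M. norm (L2_sq T (\<lambda>t. v n t - w t) - 0) < e" by blast
  qed
  ultimately show ?thesis using sm lim by blast
qed

lemma L2_continuous: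
  assumes "continuous_on {0..T} g" shows "g \<in> L2 T"
proof -
  have "(\<lambda>t. (norm (g t))\<^sup>2) integrable_on {0..T}"
    by (intro integrable_continuous_interval continuous_intros assms)
  then show ?thesis by (simp add: L2_def strongly_measurable_continuous assms)
qed

text \<open>Controls bounded by \<open>M\<close> are represented by functions on the whole line, so that they can be
  translated and concatenated freely.\<close>

definition bctrl :: "real \<Rightarrow> (real \<Rightarrow> 'u::real_normed_vector) set" where
  "bctrl M = {u. strongly_measurable lebesgue u \<and> (AE t in lebesgue. norm (u t) \<le> M)}"

definition cutoff :: "real \<Rightarrow> (real \<Rightarrow> 'u::real_normed_vector) \<Rightarrow> real \<Rightarrow> 'u" where
  "cutoff T v t = (if t \<in> {0<..<T} then v t else 0)"

lemma bctrl_nonneg: "u \<in> bctrl M \<Longrightarrow> 0 \<le> M"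
proof -
  assume "u \<in> bctrl M"
  then have "AE t in (lebesgue :: real measure). 0 \<le> M"
    unfolding bctrl_def by (auto elim!: eventually_mono intro: order_trans[OF norm_ge_zero])
  then show ?thesis by (simp add: eventually_const_iff ae_filter_eq_bot_iff)
qed

lemma bctrl_L2: assumes u: "u \<in> bctrl M" and T: "0 \<le> T"
  shows "u \<in> L2 T" "L2_sq T u \<le> M\<^sup>2 * T"
proof -
  interpret finite_measure "Ioo_measure T" by (rule finite_measure_lebesgue_on_Ioo)
  have sm: "strongly_measurable (Ioo_measure T) u"
    using u by (intro strongly_measurable_restrict) (auto simp: bctrl_def)
  have "AE t in lebesgue. norm (u t) \<le> M" using u by (simp add: bctrl_def)
  then have le: "AE t in Ioo_measure T. (norm (u t))\<^sup>2 \<le> M\<^sup>2"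
    by (simp add: AE_lebesgue_on_iff) (auto elim!: eventually_mono intro: power_mono)
  show mem: "u \<in> L2 T" by (rule L2_I[OF sm _ le]) simp
  have "L2_sq T u \<le> (\<integral>t. M\<^sup>2 \<partial>Ioo_measure T)"
    unfolding L2_sq_eq[OF mem] using mem le by (intro integral_mono_AE) (auto simp: L2_iff)
  then show "L2_sq T u \<le> M\<^sup>2 * T" using measure_Ioo[OF T] by (simp add: mult.commute)
qed

lemma bctrl_cutoff:
  assumes "strongly_measurable (Ioo_measure T) v" "AE t in Ioo_measure T. norm (v t) \<le> M" "0 \<le> M"
  shows "cutoff T v \<in> bctrl M"
  unfolding bctrl_def cutoff_def using assms strongly_measurable_extend[of "{0<..<T}" v]
  by (auto simp: AE_lebesgue_on_iff elim: eventually_mono)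

lemma bctrl_add: "u \<in> bctrl M \<Longrightarrow> v \<in> bctrl N \<Longrightarrow> (\<lambda>t. u t + v t) \<in> bctrl (M + N)"
  unfolding bctrl_def
  by (auto intro: strongly_measurable_add norm_triangle_mono elim: eventually_elim2)

lemma bctrl_scaleR: "u \<in> bctrl M \<Longrightarrow> (\<lambda>t. c *\<^sub>R u t) \<in> bctrl (\<bar>c\<bar> * M)"
  unfolding bctrl_def
  by (auto intro!: strongly_measurable_scaleR elim!: eventually_mono intro: mult_left_mono)

lemma bctrl_mono: "u \<in> bctrl M \<Longrightarrow> M \<le> N \<Longrightarrow> u \<in> bctrl N"
  unfolding bctrl_def by (auto elim: eventually_mono)

lemma bctrl_0 [simp]: "0 \<le> M \<Longrightarrow> (\<lambda>_. 0) \<in> bctrl M"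
  by (simp add: bctrl_def)

lemma bctrl_translate: "u \<in> bctrl M \<Longrightarrow> (\<lambda>t. u (t + c)) \<in> bctrl M"
  unfolding bctrl_def using AE_lebesgue_translate[of "\<lambda>t. norm (u t) \<le> M" c]
  by (simp add: strongly_measurable_translate)

lemma bctrl_concat:
  assumes "u \<in> bctrl M" "v \<in> bctrl M"
  shows "(\<lambda>t. if t < s then u t else v (t - s)) \<in> bctrl M"
proof -
  have v: "(\<lambda>t. v (t - s)) \<in> bctrl M" using bctrl_translate[OF assms(2), of "- s"] by simp
  have "strongly_measurable lebesgue (\<lambda>t. if t \<in> {..<s} then u t else v (t - s))"
    using assms v by (intro strongly_measurable_If) (auto simp: bctrl_def)
  moreover have "AE t in lebesgue. norm (if t < s then u t else v (t - s)) \<le> M"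
    using assms(1) v unfolding bctrl_def by (auto elim: eventually_elim2)
  ultimately show ?thesis by (simp add: bctrl_def)
qed

lemma bctrl_convex:
  assumes "u \<in> bctrl M" "v \<in> bctrl M" "0 \<le> a" "0 \<le> b" "a + b = 1"
  shows "(\<lambda>t. a *\<^sub>R u t + b *\<^sub>R v t) \<in> bctrl M"
proof -
  have "a * M + b * M = M" using assms(5) by (simp flip: distrib_right)
  then show ?thesis using bctrl_add[OF bctrl_scaleR[OF assms(1), of a] bctrl_scaleR[OF assms(2), of b]] assms(3,4)
    by simp
qed

section \<open>The extrapolation space\<close>

locale control_sys =
  fixes P :: "('x::{real_inner,banach}, 'u::{real_inner,banach}, 'v::banach) csys"
  assumes setting: "control_setting P"
begin

sublocale hilbert_semigroup "sgp P" "dom P" "gen P"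
  using setting by unfold_locales (auto simp: control_setting_def)

lemma adj_domain_eq: "adj_domain P = D'"
  by (simp add: adj_domain_def)

lemma adj_sgp_eq: "adj_sgp P t = S' t"
  by (simp add: adj_sgp_def)

lemma graph_norm_eq: "graph_norm P z = norm (z, A' z)"
  by (simp add: graph_norm_def norm_Pair)

lemma pairing: "dual_pairing D' (graph_norm P) (dpair P)"
  using setting by (simp add: control_setting_def adj_domain_eq)

lemma dpair_add: "z \<in> D' \<Longrightarrow> dpair P (f + g) z = dpair P f z + dpair P g z"
  using pairing by (simp add: dual_pairing_def)

lemma dpair_scale: "z \<in> D' \<Longrightarrow> dpair P (c *\<^sub>R f) z = c * dpair P f z"
  using pairing by (simp add: dual_pairing_def)

lemma dpair_diff: "z \<in> D' \<Longrightarrow> dpair P (f - g) z = dpair P f z - dpair P g z"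
  using dpair_add[of z f "(-1) *\<^sub>R g"] dpair_scale[of z "-1" g] by simp

lemma dpair_linear: "linear_functional_on D' (dpair P f)"
  using pairing by (simp add: dual_pairing_def)

lemma dpair_ex:
  assumes "linear_functional_on D' \<phi>" "\<And>z. z \<in> D' \<Longrightarrow> \<bar>\<phi> z\<bar> \<le> C * graph_norm P z"
  shows "\<exists>f. \<forall>z\<in>D'. dpair P f z = \<phi> z"
  using pairing assms unfolding dual_pairing_def bounded_functional_on_def by blast

lemma dpair_norm: "norm f = (SUP z\<in>{z\<in>D'. graph_norm P z \<le> 1}. \<bar>dpair P f z\<bar>)"
  using pairing by (simp add: dual_pairing_def)

lemma graph_norm_scale: "z \<in> D' \<Longrightarrow> graph_norm P (c *\<^sub>R z) = \<bar>c\<bar> * graph_norm P z"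
  using A'_scale[of z c] norm_scaleR[of c "(z, A' z)"] by (simp add: graph_norm_eq)

lemma graph_norm_nonneg: "0 \<le> graph_norm P z"
  by (simp add: graph_norm_eq)

lemma norm_le_graph_norm: "norm z \<le> graph_norm P z" "norm (A' z) \<le> graph_norm P z"
  using norm_fst_le[of z "A' z"] norm_snd_le[of "A' z" z] by (simp_all add: graph_norm_eq)

text \<open>The real supremum in \<open>dual_pairing\<close> carries information only over a set
  that is bounded above. Boundedness of the functional is checked for this first; then the
  inequality follows by rescaling \<open>z\<close> to graph norm 1.\<close>

lemma dpair_bound:
  assumes z: "z \<in> D'" shows "\<bar>dpair P f z\<bar> \<le> norm f * graph_norm P z"
proof (cases "z = 0")
  case True
  have "dpair P f (0 *\<^sub>R 0) = 0 * dpair P f 0"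
    using dpair_linear[of f] A'_0 unfolding linear_functional_on_def by blast
  then show ?thesis using True by (simp add: graph_norm_nonneg)
next
  case False
  obtain C where C: "\<And>z. z \<in> D' \<Longrightarrow> \<bar>dpair P f z\<bar> \<le> C * graph_norm P z"
    using pairing unfolding dual_pairing_def bounded_functional_on_def by metis
  define n where "n = graph_norm P z"
  have n: "n > 0" unfolding n_def by (rule less_le_trans[OF _ norm_le_graph_norm(1)]) (use False in simp)
  define y where "y = inverse n *\<^sub>R z"
  have y: "y \<in> D'" "graph_norm P y = 1"
    using z A'_scale n graph_norm_scale[OF z, of "inverse n"] by (simp_all add: y_def flip: n_def)
  have "bdd_above ((\<lambda>z. \<bar>dpair P f z\<bar>) ` {z\<in>D'. graph_norm P z \<le> 1})"
  proof (rule bdd_aboveI2)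
    fix w assume w: "w \<in> {z\<in>D'. graph_norm P z \<le> 1}"
    then have "C * graph_norm P w \<le> \<bar>C\<bar> * 1" using graph_norm_nonneg[of w]
      by (intro mult_mono) auto
    with C[of w] w show "\<bar>dpair P f w\<bar> \<le> \<bar>C\<bar> * 1" by simp
  qed
  then have "\<bar>dpair P f y\<bar> \<le> norm f" unfolding dpair_norm[of f] using y by (intro cSUP_upper) auto
  moreover have "dpair P f y = inverse n * dpair P f z"
    unfolding y_def using dpair_linear[of f] z unfolding linear_functional_on_def by blast
  ultimately have "inverse n * \<bar>dpair P f z\<bar> \<le> norm f" using n by (simp add: abs_mult)
  then show ?thesis using n by (simp add: n_def[symmetric] field_simps)
qed

lemma dpair_norm_le:
  assumes "\<And>z. z \<in> D' \<Longrightarrow> \<bar>dpair P f z\<bar> \<le> C * graph_norm P z" "0 \<le> C"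
  shows "norm f \<le> C"
  unfolding dpair_norm[of f]
proof (rule cSUP_least)
  show "{z\<in>D'. graph_norm P z \<le> 1} \<noteq> {}"
    using A'_0 by (auto simp: graph_norm_eq intro!: exI[of _ 0])
  fix z assume "z \<in> {z\<in>D'. graph_norm P z \<le> 1}"
  then show "\<bar>dpair P f z\<bar> \<le> C"
    using assms(1)[of z] mult_left_le[of "graph_norm P z" C] assms(2) by force
qed

lemma dpair_eqI: assumes "\<And>z. z \<in> D' \<Longrightarrow> dpair P f z = dpair P g z" shows "f = g"
proof -
  have "norm (f - g) \<le> 0" by (rule dpair_norm_le) (use assms in \<open>auto simp: dpair_diff\<close>)
  then show ?thesis by simp
qed

lemma bounded_linear_dpair: "z \<in> D' \<Longrightarrow> bounded_linear (\<lambda>f. dpair P f z)"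
  by (rule bounded_linear_intro[where K = "graph_norm P z"])
     (auto simp: dpair_add dpair_scale dpair_bound)

section \<open>Embedding of the pivot space and extension of the semigroup\<close>

lemma dpair_emb: assumes "z \<in> D'" shows "dpair P (emb P x) z = x \<bullet> z"
proof -
  have "linear_functional_on D' (\<lambda>z. x \<bullet> z)"
    by (simp add: linear_functional_on_def inner_add_right)
  moreover have "\<bar>x \<bullet> z\<bar> \<le> norm x * graph_norm P z" for z
    using Cauchy_Schwarz_ineq2[of x z] mult_left_mono[OF norm_le_graph_norm(1)[of z], of "norm x"] by simp
  ultimately have "\<exists>f. \<forall>z\<in>D'. dpair P f z = x \<bullet> z" by (rule dpair_ex)
  then have "\<exists>!f. \<forall>z\<in>D'. dpair P f z = x \<bullet> z" using dpair_eqI by metis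
  from theI'[OF this] assms show ?thesis by (simp add: emb_def adj_domain_eq)
qed

lemma emb_add: "emb P (x + y) = emb P x + emb P y"
  by (rule dpair_eqI) (simp add: dpair_emb dpair_add inner_add_left)

lemma emb_scale: "emb P (c *\<^sub>R x) = c *\<^sub>R emb P x"
  by (rule dpair_eqI) (simp add: dpair_emb dpair_scale)

lemma emb_0 [simp]: "emb P 0 = 0"
  using emb_scale[of 0 0] by simp

lemma eq_if_inner_D': assumes "\<And>z. z \<in> D' \<Longrightarrow> a \<bullet> z = b \<bullet> z" shows "a = b"
proof -
  obtain y where y: "\<And>n::nat. y n \<in> D'" "y \<longlonglongrightarrow> a - b" using D'_approx[of "a - b"] by blast
  have "(\<lambda>n. (a - b) \<bullet> y n) \<longlonglongrightarrow> (a - b) \<bullet> (a - b)" by (intro tendsto_intros y)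
  moreover have "(a - b) \<bullet> y n = 0" for n using assms[OF y(1)] by (simp add: inner_diff_left)
  ultimately show ?thesis by (simp add: LIMSEQ_const_iff)
qed

lemma emb_inject: "emb P x = emb P y \<longleftrightarrow> x = y"
proof
  assume "emb P x = emb P y"
  then show "x = y" by (intro eq_if_inner_D') (metis dpair_emb)
qed simp

text \<open>Riesz representation on the graph of \<open>A'\<close> writes a functional on the domain as
  \<open>z \<mapsto> \<langle>z, a\<rangle> + \<langle>A' z, b\<rangle>\<close>; approximating \<open>b\<close> by elements of the domain of \<open>A\<close> gives density
  of the pivot space.\<close>

lemma emb_dense: "\<exists>x. (\<lambda>n. emb P (x n)) \<longlonglongrightarrow> f"
proof -
  define E where "E = (\<lambda>z. (z, A' z)) ` D'"
  define \<phi> where "\<phi> = (\<lambda>q :: 'x \<times> 'x. dpair P f (fst q))"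
  have "\<exists>w. \<forall>q\<in>E. \<phi> q = q \<bullet> w"
  proof (rule riesz_on_subspace[where K = "norm f"])
    show "subspace E"
    proof (rule subspaceI)
      show "0 \<in> E" unfolding E_def using A'_0 by (intro image_eqI[of _ _ 0]) (auto simp: zero_prod_def)
      show "x + y \<in> E" if "x \<in> E" "y \<in> E" for x y
        using that unfolding E_def by (auto simp: A'_add intro!: image_eqI)
      show "c *\<^sub>R x \<in> E" if "x \<in> E" for c x
        using that unfolding E_def by (auto simp: A'_scale intro!: image_eqI)
    qed
    show "linear_functional_on E \<phi>"
      using dpair_linear[of f] unfolding linear_functional_on_def E_def \<phi>_def by auto
    show "\<bar>\<phi> q\<bar> \<le> norm f * norm q" if "q \<in> E" for q
      using that dpair_bound[of _ f] unfolding E_def \<phi>_def by (auto simp: graph_norm_eq)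
  qed
  then obtain a b where ab: "\<And>z. z \<in> D' \<Longrightarrow> dpair P f z = z \<bullet> a + A' z \<bullet> b"
    unfolding E_def \<phi>_def by (auto simp: inner_prod_def)
  obtain y where y: "\<And>n. y n \<in> dom P" "y \<longlonglongrightarrow> b" using closure_D closure_sequential[of b "dom P"] by blast
  have "norm (emb P (a + gen P (y n)) - f) \<le> norm (y n - b)" for n
  proof (rule dpair_norm_le)
    fix z assume z: "z \<in> D'"
    have "dpair P (emb P (a + gen P (y n)) - f) z = (y n - b) \<bullet> A' z"
      using A'_inner[OF z y(1)] z
      by (simp add: dpair_diff dpair_emb ab inner_add_left inner_add_right inner_diff_left inner_commute)
    then show "\<bar>dpair P (emb P (a + gen P (y n)) - f) z\<bar> \<le> norm (y n - b) * graph_norm P z"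
      using Cauchy_Schwarz_ineq2[of "y n - b" "A' z"]
        mult_left_mono[OF norm_le_graph_norm(2)[of z], of "norm (y n - b)"] by simp
  qed simp
  then have "\<forall>\<^sub>F n in sequentially. norm (emb P (a + gen P (y n)) - f) \<le> norm (y n - b)" by simp
  then have "(\<lambda>n. emb P (a + gen P (y n)) - f) \<longlonglongrightarrow> 0"
    by (rule Lim_null_comparison) (intro tendsto_norm_zero LIM_zero y)
  then have "(\<lambda>n. emb P (a + gen P (y n))) \<longlonglongrightarrow> f" by (rule LIM_zero_cancel)
  then show ?thesis by (rule exI[of "\<lambda>x. (\<lambda>n. emb P (x n)) \<longlonglongrightarrow> f"])
qed

lemma S'_graph_bound:
  assumes "0 \<le> t" obtains C where "0 \<le> C" "\<And>z. z \<in> D' \<Longrightarrow> graph_norm P (S' t z) \<le> C * graph_norm P z"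
proof -
  obtain C where C: "C \<ge> 1" "\<And>s z. 0 \<le> s \<Longrightarrow> s \<le> t \<Longrightarrow> norm (S' s z) \<le> C * norm z"
    using S'_bound[of t] by blast
  have "graph_norm P (S' t z) \<le> C * graph_norm P z" if "z \<in> D'" for z
  proof -
    have "(graph_norm P (S' t z))\<^sup>2 = (norm (S' t z))\<^sup>2 + (norm (S' t (A' z)))\<^sup>2"
      using A'_S'[OF assms that] by (simp add: graph_norm_eq norm_Pair)
    also have "\<dots> \<le> (C * norm z)\<^sup>2 + (C * norm (A' z))\<^sup>2"
      using C(2)[of t] assms by (intro add_mono power_mono) auto
    also have "\<dots> = (C * graph_norm P z)\<^sup>2"
      by (simp add: graph_norm_eq norm_Pair power_mult_distrib algebra_simps)
    finally show ?thesis
      by (rule power2_le_imp_le) (use C(1) graph_norm_nonneg[of z] in simp)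
  qed
  then show ?thesis using that[of C] C(1) by simp
qed

text \<open>The extended semigroup is the transpose of \<open>S' t\<close> on \<open>D'\<close> with
  its graph norm. This transpose extends \<open>S t\<close>, and density of the pivot space makes it
  the only bounded extension, so the description in \<open>ext_sgp\<close> denotes it.\<close>

lemma dpair_ext_sgp:
  assumes t: "0 \<le> t" and z: "z \<in> D'"
  shows "dpair P (ext_sgp P t f) z = dpair P f (S' t z)"
proof -
  obtain C where C: "0 \<le> C" "\<And>z. z \<in> D' \<Longrightarrow> graph_norm P (S' t z) \<le> C * graph_norm P z"
    using S'_graph_bound[OF t] by blast
  have bd: "\<bar>dpair P f (S' t z)\<bar> \<le> norm f * C * graph_norm P z" if "z \<in> D'" for f z
  proof -
    have "\<bar>dpair P f (S' t z)\<bar> \<le> norm f * graph_norm P (S' t z)"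
      using A'_S'[OF t that] by (intro dpair_bound) auto
    also have "\<dots> \<le> norm f * (C * graph_norm P z)" using C that by (intro mult_left_mono) auto
    finally show ?thesis by simp
  qed
  have "\<exists>g. \<forall>z\<in>D'. dpair P g z = dpair P f (S' t z)" for f
  proof (rule dpair_ex)
    show "linear_functional_on D' (\<lambda>z. dpair P f (S' t z))"
      using dpair_linear[of f] A'_S'[OF t] linear_add[OF S'_linear] linear_scale[OF S'_linear]
      unfolding linear_functional_on_def by simp
  qed (rule bd)
  then obtain R where R: "\<And>f z. z \<in> D' \<Longrightarrow> dpair P (R f) z = dpair P f (S' t z)" by metis
  have "bounded_linear R"
  proof (rule bounded_linear_intro[where K = C])
    show "R (f + g) = R f + R g" for f g
      using A'_S'[OF t] by (intro dpair_eqI) (simp add: R dpair_add)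
    show "R (c *\<^sub>R f) = c *\<^sub>R R f" for c f
      using A'_S'[OF t] by (intro dpair_eqI) (simp add: R dpair_scale)
    show "norm (R f) \<le> norm f * C" for f
      using bd C by (intro dpair_norm_le) (auto simp: R)
  qed
  then have Rb: "blinfun_apply (Blinfun R) = R" by (rule bounded_linear_Blinfun_apply)
  have R_emb: "\<forall>x. Blinfun R (emb P x) = emb P (sgp P t x)"
  proof
    fix x show "Blinfun R (emb P x) = emb P (sgp P t x)"
      unfolding Rb using A'_S'[OF t] by (intro dpair_eqI) (simp add: R dpair_emb S'_inner)
  qed
  have "ext_sgp P t = Blinfun R"
    unfolding ext_sgp_def
  proof (rule the_equality)
    show "\<forall>x. Blinfun R (emb P x) = emb P (sgp P t x)" by (rule R_emb)
  next
    fix Q :: "'v \<Rightarrow>\<^sub>L 'v" assume Q: "\<forall>x. Q (emb P x) = emb P (sgp P t x)"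
    show "Q = Blinfun R"
    proof (rule blinfun_eqI)
      fix f
      obtain x where x: "(\<lambda>n. emb P (x n)) \<longlonglongrightarrow> f" using emb_dense by blast
      have "(\<lambda>n. Q (emb P (x n))) \<longlonglongrightarrow> Q f" "(\<lambda>n. Blinfun R (emb P (x n))) \<longlonglongrightarrow> Blinfun R f"
        by (intro tendsto_intros x)+
      then show "Q f = Blinfun R f" using Q R_emb LIMSEQ_unique by fastforce
    qed
  qed
  then show ?thesis using R[OF z] Rb by simp
qed

lemma ext_sgp_emb: "0 \<le> t \<Longrightarrow> ext_sgp P t (emb P x) = emb P (sgp P t x)"
  using A'_S' by (intro dpair_eqI) (simp add: dpair_ext_sgp dpair_emb S'_inner)

lemma ext_sgp_add: "0 \<le> s \<Longrightarrow> 0 \<le> t \<Longrightarrow> ext_sgp P (s + t) f = ext_sgp P s (ext_sgp P t f)"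
  using A'_S' S'_add[of t s] by (intro dpair_eqI) (simp add: dpair_ext_sgp add.commute)

section \<open>The adjoint control operator and the observation of smooth states\<close>

lemma dpair_ctrl: assumes z: "z \<in> D'" shows "dpair P (ctrl P u) z = u \<bullet> adj_ctrl P z"
proof -
  have "\<exists>w. \<forall>u\<in>UNIV. dpair P (ctrl P u) z = u \<bullet> w"
  proof (rule riesz_on_subspace[where K = "norm (ctrl P) * graph_norm P z"])
    show "linear_functional_on UNIV (\<lambda>u. dpair P (ctrl P u) z)"
      using z by (simp add: linear_functional_on_def blinfun.add_right blinfun.scaleR_right dpair_add dpair_scale)
    show "\<bar>dpair P (ctrl P u) z\<bar> \<le> norm (ctrl P) * graph_norm P z * norm u" for u
    proof -
      have "\<bar>dpair P (ctrl P u) z\<bar> \<le> norm (ctrl P u) * graph_norm P z" by (rule dpair_bound[OF z])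
      also have "\<dots> \<le> norm (ctrl P) * norm u * graph_norm P z"
        by (intro mult_right_mono norm_blinfun graph_norm_nonneg)
      finally show ?thesis by (simp add: ac_simps)
    qed
  qed simp
  then obtain w where w: "\<forall>u. dpair P (ctrl P u) z = u \<bullet> w" by auto
  moreover have "w' = w" if "\<forall>u. dpair P (ctrl P u) z = u \<bullet> w'" for w'
  proof -
    have "(w' - w) \<bullet> w' = (w' - w) \<bullet> w" using w that by simp
    then have "(w' - w) \<bullet> (w' - w) = 0" by (simp add: inner_diff_right)
    then show ?thesis by simp
  qed
  ultimately have "adj_ctrl P z = w" unfolding adj_ctrl_def by (intro the_equality) auto
  with w show ?thesis by simp
qed

lemma eq_if_inner_left: "(\<And>u :: 'b :: real_inner. u \<bullet> a = u \<bullet> b) \<Longrightarrow> a = b"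
proof -
  assume *: "\<And>u. u \<bullet> a = u \<bullet> b"
  have "(a - b) \<bullet> (a - b) = 0" using *[of "a - b"] by (simp add: inner_diff_right)
  then show ?thesis by simp
qed

lemma adj_ctrl_add: assumes "z \<in> D'" "w \<in> D'" shows "adj_ctrl P (z + w) = adj_ctrl P z + adj_ctrl P w"
proof (rule eq_if_inner_left)
  fix u
  have "dpair P (ctrl P u) (z + w) = dpair P (ctrl P u) z + dpair P (ctrl P u) w"
    using dpair_linear assms unfolding linear_functional_on_def by blast
  then show "u \<bullet> adj_ctrl P (z + w) = u \<bullet> (adj_ctrl P z + adj_ctrl P w)"
    using assms A'_add[OF assms] by (simp add: dpair_ctrl inner_add_right)
qed

lemma adj_ctrl_scale: assumes "z \<in> D'" shows "adj_ctrl P (c *\<^sub>R z) = c *\<^sub>R adj_ctrl P z"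
proof (rule eq_if_inner_left)
  fix u
  have "dpair P (ctrl P u) (c *\<^sub>R z) = c * dpair P (ctrl P u) z"
    using dpair_linear assms unfolding linear_functional_on_def by blast
  then show "u \<bullet> adj_ctrl P (c *\<^sub>R z) = u \<bullet> (c *\<^sub>R adj_ctrl P z)"
    using assms A'_scale[OF assms] by (simp add: dpair_ctrl)
qed

lemma adj_ctrl_diff: "z \<in> D' \<Longrightarrow> w \<in> D' \<Longrightarrow> adj_ctrl P (z - w) = adj_ctrl P z - adj_ctrl P w"
  using adj_ctrl_add[of z "(-1) *\<^sub>R w"] adj_ctrl_scale[of w "-1"] A'_scale[of w "-1"] by simp

lemma adj_ctrl_bound: assumes "z \<in> D'" shows "norm (adj_ctrl P z) \<le> norm (ctrl P) * graph_norm P z"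
proof (cases "adj_ctrl P z = 0")
  case False
  let ?w = "adj_ctrl P z"
  have "norm ?w * norm ?w = dpair P (ctrl P ?w) z"
    using dpair_ctrl[OF assms] by (simp add: power2_norm_eq_inner flip: power2_eq_square)
  also have "\<dots> \<le> norm (ctrl P ?w) * graph_norm P z" using dpair_bound[OF assms, of "ctrl P ?w"] by linarith
  also have "\<dots> \<le> norm (ctrl P) * norm ?w * graph_norm P z"
    by (intro mult_right_mono norm_blinfun graph_norm_nonneg)
  also have "\<dots> = norm ?w * (norm (ctrl P) * graph_norm P z)" by simp
  finally show ?thesis using False by (subst (asm) mult_le_cancel_left_pos) auto
qed (simp add: graph_norm_nonneg)

definition ob :: "real \<Rightarrow> 'x \<Rightarrow> real \<Rightarrow> 'u" where
  "ob T z t = adj_ctrl P (S' (T - t) z)"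

lemma ob_add: "z \<in> D' \<Longrightarrow> w \<in> D' \<Longrightarrow> t \<le> T \<Longrightarrow> ob T (z + w) t = ob T z t + ob T w t"
  using A'_S'[of "T - t"] by (simp add: ob_def linear_add[OF S'_linear] adj_ctrl_add)

lemma ob_scale: "z \<in> D' \<Longrightarrow> t \<le> T \<Longrightarrow> ob T (c *\<^sub>R z) t = c *\<^sub>R ob T z t"
  using A'_S'[of "T - t"] by (simp add: ob_def linear_scale[OF S'_linear] adj_ctrl_scale)

lemma ob_diff: "z \<in> D' \<Longrightarrow> w \<in> D' \<Longrightarrow> t \<le> T \<Longrightarrow> ob T (z - w) t = ob T z t - ob T w t"
  using A'_S'[of "T - t"] by (simp add: ob_def S'_diff adj_ctrl_diff)

text \<open>\<open>adj_ctrl\<close> is bounded in the graph norm, and the adjoint orbit of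
  \<open>z\<close> is continuous in that norm because \<open>A'\<close> commutes with the adjoint
  semigroup.\<close>

lemma ob_continuous: assumes z: "z \<in> D'" shows "continuous_on {0..T} (ob T z)"
proof -
  have "continuous_on {0..} (\<lambda>s. adj_ctrl P (S' s z))"
    unfolding continuous_on_def
  proof
    fix s :: real assume s: "s \<in> {0..}"
    have 1: "((\<lambda>r. (S' r z - S' s z, S' r (A' z) - S' s (A' z))) \<longlongrightarrow>
        (S' s z - S' s z, S' s (A' z) - S' s (A' z))) (at s within {0..})"
      using S'_cont s unfolding continuous_on_def by (intro tendsto_intros) blast+
    have 2: "((\<lambda>r. norm (ctrl P) * norm (S' r z - S' s z, S' r (A' z) - S' s (A' z))) \<longlongrightarrow> 0) (at s within {0..})"
      using tendsto_mult[OF tendsto_const[of "norm (ctrl P)"] tendsto_norm[OF 1]] by simp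
    have "((\<lambda>r. adj_ctrl P (S' r z) - adj_ctrl P (S' s z)) \<longlongrightarrow> 0) (at s within {0..})"
    proof (rule Lim_null_comparison[OF _ 2])
      have "norm (adj_ctrl P (S' r z) - adj_ctrl P (S' s z)) \<le>
          norm (ctrl P) * norm (S' r z - S' s z, S' r (A' z) - S' s (A' z))" if "r \<in> {0..}" for r
      proof -
        have *: "S' r z \<in> D'" "S' s z \<in> D'" "A' (S' r z) = S' r (A' z)" "A' (S' s z) = S' s (A' z)"
          using A'_S'[of _ z] z s that by auto
        show ?thesis using adj_ctrl_bound[of "S' r z - S' s z"] A'_diff[OF *(1,2)] *
          by (simp add: adj_ctrl_diff graph_norm_eq)
      qed
      then show "\<forall>\<^sub>F r in at s within {0..}. norm (adj_ctrl P (S' r z) - adj_ctrl P (S' s z)) \<le>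
          norm (ctrl P) * norm (S' r z - S' s z, S' r (A' z) - S' s (A' z))"
        by (simp add: eventually_at_filter)
    qed
    then show "((\<lambda>r. adj_ctrl P (S' r z)) \<longlongrightarrow> adj_ctrl P (S' s z)) (at s within {0..})"
      by (rule LIM_zero_cancel)
  qed
  then have "continuous_on {0..T} ((\<lambda>s. adj_ctrl P (S' s z)) \<circ> (\<lambda>t. T - t))"
    by (intro continuous_on_compose continuous_intros) (auto intro: continuous_on_subset)
  then show ?thesis by (simp add: o_def ob_def)
qed

lemma ob_S': "0 \<le> s \<Longrightarrow> t \<le> T \<Longrightarrow> ob T (S' s z) t = ob (T + s) z t"
  using S'_add[of "T - t" s z] by (simp add: ob_def algebra_simps)

lemma ob_L2: "z \<in> D' \<Longrightarrow> ob T z \<in> L2 T"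
  by (intro L2_continuous ob_continuous)

section \<open>The input operator and its duality with the observation\<close>

text \<open>Admissibility speaks of locally square integrable controls on the half line; a control
  given on \<open>(0,T)\<close> is brought into that class by extension by zero.\<close>

lemma cutoff_L2_loc: assumes u: "u \<in> L2 T" shows "cutoff T u \<in> L2_loc"
  unfolding L2_loc_def
proof (intro CollectI allI impI)
  fix R :: real assume "R > 0"
  have sm: "strongly_measurable lebesgue (cutoff T u)"
    unfolding cutoff_def using u by (intro strongly_measurable_extend) (auto simp: L2_iff)
  have "integrable lebesgue (\<lambda>t. indicator {0<..<T} t *\<^sub>R (norm (u t))\<^sup>2)"
    using u by (simp add: L2_iff integrable_restrict_space)
  then have "integrable lebesgue (\<lambda>t. indicator {0<..<R} t *\<^sub>R (indicator {0<..<T} t *\<^sub>R (norm (u t))\<^sup>2))"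
    by (rule integrable_mult_indicator[rotated]) simp
  then have "integrable (Ioo_measure R) (\<lambda>t. indicator {0<..<T} t *\<^sub>R (norm (u t))\<^sup>2)"
    by (simp add: integrable_restrict_space)
  moreover have "(\<lambda>t. indicator {0<..<T} t *\<^sub>R (norm (u t))\<^sup>2) = (\<lambda>t. (norm (cutoff T u t))\<^sup>2)"
    by (auto simp: cutoff_def indicator_def)
  ultimately show "cutoff T u \<in> L2 R"
    using strongly_measurable_restrict[OF sm] by (simp add: L2_iff)
qed

text \<open>The input map with values in the pivot space. Admissibility places the integral in the
  image of \<open>emb\<close>, and injectivity of \<open>emb\<close> makes the preimage
  unique.\<close>

definition L :: "real \<Rightarrow> (real \<Rightarrow> 'u) \<Rightarrow> 'x" where
  "L T u = (THE x. ((\<lambda>\<tau>. ext_sgp P (T - \<tau>) (ctrl P (u \<tau>))) has_integral emb P x) {0..T})"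

lemma L_unique:
  assumes "((\<lambda>\<tau>. ext_sgp P (T - \<tau>) (ctrl P (u \<tau>))) has_integral emb P x) {0..T}"
  shows "L T u = x"
  unfolding L_def
proof (rule the_equality)
  show "((\<lambda>\<tau>. ext_sgp P (T - \<tau>) (ctrl P (u \<tau>))) has_integral emb P x) {0..T}" by (rule assms)
next
  fix y assume "((\<lambda>\<tau>. ext_sgp P (T - \<tau>) (ctrl P (u \<tau>))) has_integral emb P y) {0..T}"
  from has_integral_unique[OF this assms] show "y = x" by (simp add: emb_inject)
qed

lemma L_exists:
  assumes T: "0 < T"
  shows "\<exists>C>0. \<forall>u\<in>L2 T. ((\<lambda>\<tau>. ext_sgp P (T - \<tau>) (ctrl P (u \<tau>))) has_integral emb P (L T u)) {0..T} \<and>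
     norm (L T u) \<le> C * L2_norm_on T u"
proof -
  obtain C where C: "C > 0" "\<forall>u\<in>L2_loc. \<exists>x.
        ((\<lambda>\<tau>. ext_sgp P (T - \<tau>) (ctrl P (u \<tau>))) has_integral emb P x) {0..T} \<and>
        norm x \<le> C * L2_norm_on T u"
    using setting T by (auto simp: control_setting_def admissible_ctrl_def)
  have "((\<lambda>\<tau>. ext_sgp P (T - \<tau>) (ctrl P (u \<tau>))) has_integral emb P (L T u)) {0..T} \<and>
     norm (L T u) \<le> C * L2_norm_on T u" if u: "u \<in> L2 T" for u
  proof -
    obtain x where x: "((\<lambda>\<tau>. ext_sgp P (T - \<tau>) (ctrl P (cutoff T u \<tau>))) has_integral emb P x) {0..T}"
        "norm x \<le> C * L2_norm_on T (cutoff T u)"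
      using C(2) cutoff_L2_loc[OF u] by blast
    \<comment> \<open>On \<open>{0..T}\<close> a control and its cutoff differ at the end points at
      most.\<close>
    have neg: "negligible {0, T}" by simp
    have hi: "((\<lambda>\<tau>. ext_sgp P (T - \<tau>) (ctrl P (u \<tau>))) has_integral emb P x) {0..T}"
      by (rule has_integral_spike[OF neg _ x(1)]) (auto simp: cutoff_def)
    have "integral {0..T} (\<lambda>t. (norm (cutoff T u t))\<^sup>2) = integral {0..T} (\<lambda>t. (norm (u t))\<^sup>2)"
      by (rule integral_spike[OF neg]) (auto simp: cutoff_def)
    then have "L2_norm_on T (cutoff T u) = L2_norm_on T u" by (simp add: L2_norm_on_def)
    with x(2) hi L_unique[OF hi] show ?thesis by simp
  qed
  with C(1) show ?thesis by blast
qed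

lemma L_has_integral: "0 < T \<Longrightarrow> u \<in> L2 T \<Longrightarrow>
    ((\<lambda>\<tau>. ext_sgp P (T - \<tau>) (ctrl P (u \<tau>))) has_integral emb P (L T u)) {0..T}"
  using L_exists[of T] by blast

lemma L_bound: assumes "0 < T" obtains C where "C > 0" "\<And>u. u \<in> L2 T \<Longrightarrow> norm (L T u) \<le> C * L2_norm_on T u"
  using L_exists[OF assms] by blast

lemma state_eq: "0 < T \<Longrightarrow> u \<in> L2 T \<Longrightarrow> state P T y u = emb P (sgp P T y + L T u)"
  using integral_unique[OF L_has_integral] by (simp add: state_def emb_add)

lemma state_eq_0_iff: "0 < T \<Longrightarrow> u \<in> L2 T \<Longrightarrow> state P T y u = 0 \<longleftrightarrow> sgp P T y + L T u = 0"
  using emb_inject[of _ 0] by (simp add: state_eq)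

lemma L_add: assumes "0 < T" "u \<in> L2 T" "v \<in> L2 T"
  shows "L T (\<lambda>t. u t + v t) = L T u + L T v"
proof (rule L_unique)
  have "((\<lambda>\<tau>. ext_sgp P (T - \<tau>) (ctrl P (u \<tau>)) + ext_sgp P (T - \<tau>) (ctrl P (v \<tau>))) has_integral
      emb P (L T u) + emb P (L T v)) {0..T}"
    by (intro has_integral_add L_has_integral assms)
  then show "((\<lambda>\<tau>. ext_sgp P (T - \<tau>) (ctrl P (u \<tau> + v \<tau>))) has_integral emb P (L T u + L T v)) {0..T}"
    by (simp add: blinfun.add_right emb_add)
qed

lemma L_scaleR: assumes "0 < T" "u \<in> L2 T"
  shows "L T (\<lambda>t. c *\<^sub>R u t) = c *\<^sub>R L T u"
proof (rule L_unique)
  have "((\<lambda>\<tau>. c *\<^sub>R ext_sgp P (T - \<tau>) (ctrl P (u \<tau>))) has_integral c *\<^sub>R emb P (L T u)) {0..T}"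
    by (intro has_integral_cmul L_has_integral assms)
  then show "((\<lambda>\<tau>. ext_sgp P (T - \<tau>) (ctrl P (c *\<^sub>R u \<tau>))) has_integral emb P (c *\<^sub>R L T u)) {0..T}"
    by (simp add: blinfun.scaleR_right emb_scale)
qed

lemma L_diff: assumes "0 < T" "u \<in> L2 T" "v \<in> L2 T"
  shows "L T (\<lambda>t. u t - v t) = L T u - L T v"
  using L_add[OF assms(1,2) L2_scaleR(1)[OF assms(3), of "-1"]] L_scaleR[OF assms(1,3), of "-1"] by simp

lemma L2_0 [simp]: "(\<lambda>_. 0) \<in> L2 T"
  by (rule L2_continuous) simp

lemma L_0: "L T (\<lambda>_. 0) = 0"
  by (rule L_unique) simp

lemma L_cong: assumes "0 < T" "u \<in> L2 T" "AE t in Ioo_measure T. u t = v t"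
  shows "L T v = L T u"
proof -
  have v: "v \<in> L2 T" by (rule L2_sq_cong(1)[OF assms(3,2)])
  have "AE t in Ioo_measure T. u t - v t = 0" using assms(3) by eventually_elim simp
  then have "L2_sq T (\<lambda>t. u t - v t) = 0" using L2_sq_zero_iff[OF L2_diff(1)[OF assms(2) v]] by blast
  then have "L2_norm_on T (\<lambda>t. u t - v t) = 0" by (simp add: L2_norm_on_sqrt)
  moreover obtain C where "C > 0" "\<And>u. u \<in> L2 T \<Longrightarrow> norm (L T u) \<le> C * L2_norm_on T u"
    using L_bound[OF assms(1)] by blast
  ultimately have "norm (L T (\<lambda>t. u t - v t)) \<le> 0" using L2_diff(1)[OF assms(2) v] by fastforce
  then show ?thesis using L_diff[OF assms(1,2) v] by simp
qed

lemma cutoff_AE: "AE t in Ioo_measure T. cutoff T v t = v t"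
  by (rule AE_I2) (simp add: cutoff_def)

lemma L_cutoff: assumes "0 < T" "v \<in> L2 T" shows "L T (cutoff T v) = L T v" "cutoff T v \<in> L2 T"
proof -
  have "AE t in Ioo_measure T. v t = cutoff T v t" using cutoff_AE[of T v] by eventually_elim simp
  then show "L T (cutoff T v) = L T v" "cutoff T v \<in> L2 T"
    using L_cong assms L2_sq_cong(1) by blast+
qed

text \<open>Pairing with \<open>z\<close> passes through the integral; there the extended semigroup
  turns into \<open>S'\<close> and the control operator into its adjoint.\<close>

lemma L_inner: assumes T: "0 < T" and u: "u \<in> L2 T" and z: "z \<in> D'"
  shows "((\<lambda>\<tau>. u \<tau> \<bullet> ob T z \<tau>) has_integral L T u \<bullet> z) {0..T}"
proof -
  have "((\<lambda>f. dpair P f z) \<circ> (\<lambda>\<tau>. ext_sgp P (T - \<tau>) (ctrl P (u \<tau>))) has_integral dpair P (emb P (L T u)) z) {0..T}"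
    by (rule has_integral_linear[OF L_has_integral[OF T u] bounded_linear_dpair[OF z]])
  then have "((\<lambda>\<tau>. dpair P (ext_sgp P (T - \<tau>) (ctrl P (u \<tau>))) z) has_integral L T u \<bullet> z) {0..T}"
    by (simp add: o_def dpair_emb[OF z])
  then show ?thesis
    by (rule has_integral_eq[rotated]) (use z A'_S' in \<open>simp add: dpair_ext_sgp dpair_ctrl ob_def\<close>)
qed

lemma L_split: assumes st: "0 < s" "s < t" and u: "u \<in> bctrl M"
  shows "L t u = sgp P (t - s) (L s u) + L (t - s) (\<lambda>\<tau>. u (\<tau> + s))"
proof (rule L_unique)
  let ?f = "\<lambda>\<tau>. ext_sgp P (t - \<tau>) (ctrl P (u \<tau>))"
  have us: "u \<in> L2 s" using u st by (intro bctrl_L2) auto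
  have ut: "(\<lambda>\<tau>. u (\<tau> + s)) \<in> L2 (t - s)" using u st by (intro bctrl_L2 bctrl_translate) auto
  have "((\<lambda>\<tau>. ext_sgp P (t - s) (ext_sgp P (s - \<tau>) (ctrl P (u \<tau>)))) has_integral
      ext_sgp P (t - s) (emb P (L s u))) {0..s}"
    using has_integral_linear[OF L_has_integral[OF st(1) us] blinfun.bounded_linear_right[of "ext_sgp P (t - s)"]]
    by (simp add: o_def)
  then have "((\<lambda>\<tau>. ext_sgp P (t - s) (ext_sgp P (s - \<tau>) (ctrl P (u \<tau>)))) has_integral
      emb P (sgp P (t - s) (L s u))) {0..s}"
    using st by (simp add: ext_sgp_emb)
  then have 1: "(?f has_integral emb P (sgp P (t - s) (L s u))) {0..s}"
    by (rule has_integral_eq[rotated]) (use st ext_sgp_add[of "t - s"] in \<open>simp flip: ext_sgp_add\<close>)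
  have "((\<lambda>\<tau>. ext_sgp P ((t - s) - \<tau>) (ctrl P (u (\<tau> + s)))) has_integral emb P (L (t - s) (\<lambda>\<tau>. u (\<tau> + s)))) {0..t - s}"
    using st ut by (intro L_has_integral) auto
  then have "((?f \<circ> (+) s) has_integral emb P (L (t - s) (\<lambda>\<tau>. u (\<tau> + s)))) {0..t - s}"
    by (rule has_integral_eq[rotated]) (simp add: algebra_simps)
  then have 2: "(?f has_integral emb P (L (t - s) (\<lambda>\<tau>. u (\<tau> + s)))) {s..t}"
    by (simp add: has_integral_shift_Icc_real)
  show "(?f has_integral emb P (sgp P (t - s) (L s u) + L (t - s) (\<lambda>\<tau>. u (\<tau> + s)))) {0..t}"
    unfolding emb_add by (rule has_integral_combine[OF _ _ 1 2]) (use st in auto)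
qed

text \<open>The admissibility constant at time 1 serves all shorter times: postpone \<open>u\<close>
  to the last \<delta> units of \<open>(0,1)\<close> and use the zero control before. The state at
  time 1 is then \<open>L \<delta> u\<close>, and the \<open>L^2\<close> norm is at most
  \<open>M * sqrt \<delta>\<close>.\<close>

lemma L_short_time:
  obtains C where "C > 0" "\<And>\<delta> M u. 0 < \<delta> \<Longrightarrow> \<delta> < 1 \<Longrightarrow> u \<in> bctrl M \<Longrightarrow> norm (L \<delta> u) \<le> C * (M * sqrt \<delta>)"
proof -
  obtain C where C: "C > 0" "\<And>u. u \<in> L2 1 \<Longrightarrow> norm (L 1 u) \<le> C * L2_norm_on 1 u"
    using L_bound[of 1] by auto
  have "norm (L \<delta> u) \<le> C * (M * sqrt \<delta>)" if d: "0 < \<delta>" "\<delta> < 1" and u: "u \<in> bctrl M" for \<delta> M u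
  proof -
    have M: "0 \<le> M" by (rule bctrl_nonneg[OF u])
    define s where "s = 1 - \<delta>"
    have s: "0 < s" "s < 1" using d by (auto simp: s_def)
    define w where "w t = (if t < s then 0 else u (t - s))" for t
    have w: "w \<in> bctrl M" unfolding w_def using u M by (intro bctrl_concat) auto
    have w2: "w \<in> L2 1" by (rule bctrl_L2[OF w]) simp
    have u2: "u \<in> L2 \<delta>" using u d by (intro bctrl_L2) auto
    have "L s w = L s (\<lambda>_. 0)"
      using s by (intro L_cong AE_I2) (auto simp: w_def)
    moreover have "L \<delta> (\<lambda>t. w (t + s)) = L \<delta> u"
      using d u2 by (intro L_cong AE_I2) (auto simp: w_def)
    ultimately have "L 1 w = L \<delta> u" using L_split[OF s w] by (simp add: L_0 s_def)
    moreover have "L2_sq 1 w \<le> M\<^sup>2 * \<delta>"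
    proof -
      have int: "(\<lambda>t. (norm (w t))\<^sup>2) integrable_on {0..1}" using w2 by (simp add: L2_def)
      have "L2_sq 1 w = integral {0..s} (\<lambda>t. (norm (w t))\<^sup>2) + integral {s..1} (\<lambda>t. (norm (w t))\<^sup>2)"
        unfolding L2_sq_def using s int by (intro Henstock_Kurzweil_Integration.integral_combine[symmetric]) auto
      also have "integral {0..s} (\<lambda>t. (norm (w t))\<^sup>2) = integral {0..s} (\<lambda>t. 0)"
        by (rule integral_spike[of "{s}"]) (auto simp: w_def)
      also have "integral {s..1} (\<lambda>t. (norm (w t))\<^sup>2) = integral {0..\<delta>} ((\<lambda>t. (norm (w t))\<^sup>2) \<circ> (+) s)"
        using integral_shift_Icc_real[of 0 \<delta> "\<lambda>t. (norm (w t))\<^sup>2" s] by (simp add: s_def)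
      also have "\<dots> = L2_sq \<delta> u"
        unfolding L2_sq_def by (rule Henstock_Kurzweil_Integration.integral_cong) (simp add: w_def)
      finally show ?thesis using bctrl_L2(2)[OF u, of \<delta>] d by simp
    qed
    then have "L2_norm_on 1 w \<le> M * sqrt \<delta>"
      using M unfolding L2_norm_on_sqrt by (metis real_sqrt_le_mono real_sqrt_mult real_sqrt_abs abs_of_nonneg)
    then have "C * L2_norm_on 1 w \<le> C * (M * sqrt \<delta>)" using C(1) by (intro mult_left_mono) auto
    ultimately show ?thesis using C(2)[OF w2] by simp
  qed
  with C(1) show ?thesis using that by blast
qed

text \<open>The observation is the transpose of the input map: apply the admissibility estimate to
  the control \<open>ob T z\<close> itself.\<close>

lemma ob_bound: assumes T: "0 < T"
  obtains C where "C > 0" "\<And>z. z \<in> D' \<Longrightarrow> L2_norm_on T (ob T z) \<le> C * norm z"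
proof -
  obtain C where C: "C > 0" "\<And>u. u \<in> L2 T \<Longrightarrow> norm (L T u) \<le> C * L2_norm_on T u"
    using L_bound[OF T] by blast
  have "L2_norm_on T (ob T z) \<le> C * norm z" if z: "z \<in> D'" for z
  proof (cases "L2_norm_on T (ob T z) = 0")
    case False
    let ?g = "ob T z"
    let ?n = "L2_norm_on T ?g"
    have n: "?n > 0" using False L2_sq_nonneg[of T ?g] by (simp add: L2_norm_on_sqrt)
    have "?n * ?n = integral {0..T} (\<lambda>t. ?g t \<bullet> ?g t)"
      using L2_sq_nonneg[of T ?g] by (simp add: L2_norm_on_sqrt L2_sq_def power2_norm_eq_inner)
    also have "\<dots> = L T ?g \<bullet> z" by (rule integral_unique[OF L_inner[OF T ob_L2[OF z] z]])
    also have "\<dots> \<le> norm (L T ?g) * norm z" by (rule norm_cauchy_schwarz)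
    also have "\<dots> \<le> C * ?n * norm z" using C(2)[OF ob_L2[OF z]] by (intro mult_right_mono) auto
    also have "\<dots> = ?n * (C * norm z)" by simp
    finally show ?thesis using n by (subst (asm) mult_le_cancel_left_pos) auto
  qed (use C(1) in simp)
  with C(1) show ?thesis using that by blast
qed

text \<open>For \<open>z\<close> in \<open>D'\<close>, \<open>M * ob_L1 T z\<close> is the supremum
  of \<open>L T u \<bullet> z\<close> over all controls bounded by \<open>M\<close>.\<close>

definition ob_L1 :: "real \<Rightarrow> 'x \<Rightarrow> real" where
  "ob_L1 T z = integral {0..T} (\<lambda>t. norm (ob T z t))"

lemma ob_norm_integrable: "z \<in> D' \<Longrightarrow> (\<lambda>t. norm (ob T z t)) integrable_on {0..T}"
  by (intro integrable_continuous_interval continuous_intros ob_continuous)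

lemma ob_L1_nonneg: "z \<in> D' \<Longrightarrow> 0 \<le> ob_L1 T z"
  unfolding ob_L1_def by (intro Henstock_Kurzweil_Integration.integral_nonneg ob_norm_integrable) auto

lemma ob_L1_add: assumes "z \<in> D'" "w \<in> D'" shows "ob_L1 T (z + w) \<le> ob_L1 T z + ob_L1 T w"
proof -
  have "ob_L1 T (z + w) \<le> integral {0..T} (\<lambda>t. norm (ob T z t) + norm (ob T w t))"
    unfolding ob_L1_def using assms A'_add[OF assms]
    by (intro integral_le integrable_add ob_norm_integrable) (auto simp: ob_add norm_triangle_ineq)
  also have "\<dots> = ob_L1 T z + ob_L1 T w"
    unfolding ob_L1_def using assms by (intro integral_add ob_norm_integrable)
  finally show ?thesis .
qed

lemma ob_L1_scale: assumes "z \<in> D'" shows "ob_L1 T (c *\<^sub>R z) = \<bar>c\<bar> * ob_L1 T z"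
proof -
  have "ob_L1 T (c *\<^sub>R z) = integral {0..T} (\<lambda>t. \<bar>c\<bar> * norm (ob T z t))"
    unfolding ob_L1_def using assms by (intro Henstock_Kurzweil_Integration.integral_cong) (auto simp: ob_scale)
  then show ?thesis by (simp add: ob_L1_def)
qed

text \<open>Nearly extremal controls are obtained from the continuous functions \<open>M g / (|g| + d)\<close>, so that no
  measurable sign function is needed.\<close>

lemma sup_L_inner: assumes T: "0 < T" and M: "0 \<le> M" and z: "z \<in> D'" and e: "0 < e"
  shows "\<exists>u\<in>bctrl M. M * ob_L1 T z - e \<le> L T u \<bullet> z"
proof -
  \<comment> \<open>The smoothed control loses at most \<open>M * d\<close> at each time,
    \<open>M * d * T \<le> e\<close> in total; the added 1 keeps the denominator positive when
    \<open>M = 0\<close>.\<close>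
  define d where "d = e / (M * T + 1)"
  have MT: "0 \<le> M * T" using M T by simp
  have d: "d > 0" using e MT by (simp add: d_def)
  have dM: "d * (M * T) \<le> e"
  proof -
    have "M * T \<le> M * T + 1" by simp
    then have "d * (M * T) \<le> d * (M * T + 1)" using d by (intro mult_left_mono) auto
    then show ?thesis using MT by (simp add: d_def)
  qed
  let ?g = "ob T z"
  define v where "v t = (M / (norm (?g t) + d)) *\<^sub>R ?g t" for t
  have pos: "norm (?g t) + d > 0" for t using d by (simp add: add_nonneg_pos)
  have "continuous_on {0..T} v" unfolding v_def using pos
    by (intro continuous_intros ob_continuous z) (metis less_irrefl)
  then have v2: "v \<in> L2 T" by (rule L2_continuous)
  have nv: "norm (v t) \<le> M" for t
  proof -
    have "M * norm (?g t) \<le> M * (norm (?g t) + d)" using M d by (intro mult_left_mono) auto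
    then show ?thesis using pos[of t] M by (simp add: v_def divide_le_eq)
  qed
  have "cutoff T v \<in> bctrl M" using v2 nv M by (intro bctrl_cutoff) (auto simp: L2_iff)
  moreover have "M * ob_L1 T z - e \<le> L T v \<bullet> z"
  proof -
    have "((\<lambda>t. M * norm (?g t) - M * d) has_integral M * ob_L1 T z - M * d * T) {0..T}"
      using has_integral_diff[OF has_integral_mult_right[OF integrable_integral[OF ob_norm_integrable[OF z, of T]], of M]
         has_integral_const_real[of "M * d" 0 T]] T by (simp add: ob_L1_def mult.commute)
    from this L_inner[OF T v2 z] have "M * ob_L1 T z - M * d * T \<le> L T v \<bullet> z"
    proof (rule has_integral_le)
      fix t assume "t \<in> {0..T}"
      let ?n = "norm (?g t)"
      have "v t \<bullet> ?g t = M * (?n * ?n / (?n + d))"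
        by (simp add: v_def power2_norm_eq_inner flip: power2_eq_square)
      moreover have "?n - d \<le> ?n * ?n / (?n + d)"
        using pos[of t] d by (simp add: le_divide_eq algebra_simps)
      then have "M * (?n - d) \<le> M * (?n * ?n / (?n + d))" using M by (intro mult_left_mono)
      ultimately show "M * ?n - M * d \<le> v t \<bullet> ?g t" by (simp only: right_diff_distrib)
    qed
    then show ?thesis using dM by (simp add: mult.commute mult.left_commute)
  qed
  ultimately show ?thesis using L_cutoff(1)[OF T v2] by metis
qed

text \<open>Minimizing the \<open>L\<^sup>2\<close> norm among nearly optimal controls makes these converge strongly.\<close>

lemma L_image_closed:
  assumes T: "0 < T" and M: "0 \<le> M" and lim: "p \<in> closure (L T ` bctrl M)"
  shows "\<exists>u\<in>bctrl M. L T u = p"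
proof -
  define C where "C n = {u \<in> bctrl M. norm (L T u - p) \<le> inverse (real (Suc n))}" for n :: nat
  have b2: "u \<in> L2 T" if "u \<in> bctrl M" for u using bctrl_L2(1)[OF that] T by simp
  define mid where "mid u v = (\<lambda>t. (1/2) *\<^sub>R ((u::real \<Rightarrow> 'u) t + v t))" for u v
  have Ib: "L2_sq T u \<le> M\<^sup>2 * T" if "u \<in> bctrl M" for u using bctrl_L2(2)[OF that] T by simp
  have ne: "C n \<noteq> {}" for n
  proof -
    have "\<exists>y\<in>L T ` bctrl M. dist y p < inverse (real (Suc n))"
      using lim unfolding closure_approachable by (metis inverse_positive_iff_positive of_nat_0_less_iff zero_less_Suc)
    then show ?thesis by (force simp: C_def dist_norm)
  qed
  have CM: "u \<in> bctrl M" if "u \<in> C n" for u n using that by (simp add: C_def)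
  have "\<exists>w. (\<forall>n. w n \<in> C n) \<and> (\<forall>e>0. \<exists>N. \<forall>m\<ge>N. \<forall>n\<ge>N. L2_sq T (\<lambda>t. w m t - w n t) < e) \<and>
     (\<forall>n. \<forall>x\<in>C n. L2_sq T (w n) < L2_sq T x + inverse (real (Suc n)))"
  proof (rule nested_minimizing_sequence[where mid = mid and L = 0 and B = "M\<^sup>2 * T"])
    show "C n \<subseteq> C m" if "m \<le> n" for m n
    proof -
      have "inverse (real (Suc n)) \<le> inverse (real (Suc m))" using that by (intro le_imp_inverse_le) auto
      then show ?thesis unfolding C_def by (blast intro: order_trans)
    qed
    show "\<exists>x\<in>C n. L2_sq T x \<le> M\<^sup>2 * T" for n using ne[of n] Ib CM by blast
    show "mid u v \<in> C n" if uv: "u \<in> C n" "v \<in> C n" for n u v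
    proof -
      have "mid u v \<in> bctrl M"
        using bctrl_convex[OF CM[OF uv(1)] CM[OF uv(2)], of "1/2" "1/2"] by (simp add: mid_def scaleR_add_right)
      moreover have "L T (mid u v) - p = (1/2) *\<^sub>R ((L T u - p) + (L T v - p))"
        unfolding mid_def using L_scaleR[OF T L2_add(1)[OF b2[OF CM[OF uv(1)]] b2[OF CM[OF uv(2)]]], of "1/2"]
          L_add[OF T b2[OF CM[OF uv(1)]] b2[OF CM[OF uv(2)]]]
        by (simp add: algebra_simps flip: scaleR_add_left)
      moreover have "norm ((L T u - p) + (L T v - p)) \<le> 2 * inverse (real (Suc n))"
        using uv norm_triangle_ineq[of "L T u - p" "L T v - p"] by (simp add: C_def)
      ultimately show ?thesis by (simp add: C_def)
    qed
    show "L2_sq T (\<lambda>t. u t - v t) = 2 * L2_sq T u + 2 * L2_sq T v - 4 * L2_sq T (mid u v)"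
      if uv: "u \<in> C 0" "v \<in> C 0" for u v
    proof -
      have u2: "u \<in> L2 T" and v2: "v \<in> L2 T" using uv b2 CM by blast+
      have m2: "mid u v \<in> L2 T" unfolding mid_def by (intro L2_scaleR(1) L2_add(1) u2 v2)
      have "L2_sq T (\<lambda>t. u t - v t) =
          (\<integral>t. 2 * (norm (u t))\<^sup>2 + 2 * (norm (v t))\<^sup>2 - 4 * (norm (mid u v t))\<^sup>2 \<partial>Ioo_measure T)"
        unfolding L2_sq_eq[OF L2_diff(1)[OF u2 v2]] mid_def norm_parallelogram ..
      also have "\<dots> = 2 * L2_sq T u + 2 * L2_sq T v - 4 * L2_sq T (mid u v)"
        using u2 v2 m2 by (simp add: L2_sq_eq L2_iff)
      finally show ?thesis .
    qed
  qed (use ne L2_sq_nonneg in auto)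
  then obtain w where w: "\<And>n. w n \<in> C n"
      and cauchy: "\<And>e. e > 0 \<Longrightarrow> \<exists>N. \<forall>m\<ge>N. \<forall>n\<ge>N. L2_sq T (\<lambda>t. w m t - w n t) < e" by blast
  have w2: "w n \<in> L2 T" for n using b2 CM w by blast
  obtain u r where u: "u \<in> L2 T" and r: "strict_mono (r :: nat \<Rightarrow> nat)"
      and conv: "AE t in Ioo_measure T. (\<lambda>k. w (r k) t) \<longlonglongrightarrow> u t"
      and L2conv: "(\<lambda>n. L2_sq T (\<lambda>t. w n t - u t)) \<longlonglongrightarrow> 0"
    using L2_complete[OF less_imp_le[OF T] w2 cauchy] by blast
  \<comment> \<open>Convergence in \<open>L^2\<close> settles the image, while the pointwise bound
    passes to the limit along the almost everywhere convergent subsequence.\<close>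
  have "AE t in lebesgue. norm (w n t) \<le> M" for n using CM[OF w[of n]] by (simp add: bctrl_def)
  then have "AE t in lebesgue. \<forall>n. norm (w n t) \<le> M" by (simp add: AE_all_countable)
  then have "AE t in Ioo_measure T. \<forall>n. norm (w n t) \<le> M"
    by (subst AE_lebesgue_on_iff) (auto elim: eventually_mono)
  with conv have "AE t in Ioo_measure T. norm (u t) \<le> M"
  proof eventually_elim
    fix t assume "(\<lambda>k. w (r k) t) \<longlonglongrightarrow> u t" and b: "\<forall>n. norm (w n t) \<le> M"
    then have "(\<lambda>k. norm (w (r k) t)) \<longlonglongrightarrow> norm (u t)" by (intro tendsto_norm)
    then show "norm (u t) \<le> M" using b by (intro LIMSEQ_le_const2) auto
  qed
  then have cu: "cutoff T u \<in> bctrl M" using u M by (intro bctrl_cutoff) (auto simp: L2_iff)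
  obtain K where K: "K > 0" "\<And>u. u \<in> L2 T \<Longrightarrow> norm (L T u) \<le> K * L2_norm_on T u"
    using L_bound[OF T] by blast
  have *: "norm (L T (w n) - L T u) \<le> K * sqrt (L2_sq T (\<lambda>t. w n t - u t))" for n
    using K(2)[OF L2_diff(1)[OF w2[of n] u]] L_diff[OF T w2[of n] u] by (simp add: L2_norm_on_sqrt)
  have "(\<lambda>n. K * sqrt (L2_sq T (\<lambda>t. w n t - u t))) \<longlonglongrightarrow> K * sqrt 0"
    by (intro tendsto_intros L2conv)
  then have "(\<lambda>n. K * sqrt (L2_sq T (\<lambda>t. w n t - u t))) \<longlonglongrightarrow> 0" by simp
  then have "(\<lambda>n. L T (w n) - L T u) \<longlonglongrightarrow> 0"
    by (rule Lim_null_comparison[OF always_eventually[OF allI[OF *]]])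
  then have lim1: "(\<lambda>n. L T (w n)) \<longlonglongrightarrow> L T u" by (rule LIM_zero_cancel)
  have "\<forall>n. norm (L T (w n) - p) \<le> inverse (real (Suc n))" using w by (simp add: C_def)
  then have "(\<lambda>n. L T (w n) - p) \<longlonglongrightarrow> 0"
    by (rule Lim_null_comparison[OF always_eventually LIMSEQ_inverse_real_of_nat])
  then have "(\<lambda>n. L T (w n)) \<longlonglongrightarrow> p" by (rule LIM_zero_cancel)
  then have "L T u = p" using lim1 LIMSEQ_unique by blast
  then show ?thesis using cu L_cutoff(1)[OF T u] by metis
qed

text \<open>Project \<open>x\<close> onto the closure of the convex image; by
  \<open>L_image_closed\<close> the projection \<open>p\<close> is itself attained. If
  \<open>x \<noteq> p\<close>, the direction \<open>x - p\<close> contradicts the hypothesis. That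
  direction need not lie in \<open>D'\<close>, where the hypothesis is available, so it is
  approximated by \<open>y n\<close>.\<close>

lemma reachable_if_inner_le:
  assumes T: "0 < T" and M: "0 \<le> M" and le: "\<And>z. z \<in> D' \<Longrightarrow> x \<bullet> z \<le> M * ob_L1 T z"
  shows "\<exists>u\<in>bctrl M. L T u = x"
proof -
  let ?K = "L T ` bctrl M"
  have b2: "u \<in> L2 T" if "u \<in> bctrl M" for u using bctrl_L2(1)[OF that] T by simp
  have cvx: "convex ?K"
  proof (rule convexI)
    fix x y and a b :: real assume xy: "x \<in> ?K" "y \<in> ?K" and ab: "0 \<le> a" "0 \<le> b" "a + b = 1"
    obtain u v where uv: "u \<in> bctrl M" "v \<in> bctrl M" "x = L T u" "y = L T v" using xy by auto
    have "a *\<^sub>R x + b *\<^sub>R y = L T (\<lambda>t. a *\<^sub>R u t + b *\<^sub>R v t)"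
      using L_add[OF T L2_scaleR(1)[OF b2[OF uv(1)]] L2_scaleR(1)[OF b2[OF uv(2)]]]
        L_scaleR[OF T b2[OF uv(1)]] L_scaleR[OF T b2[OF uv(2)]] uv(3,4) by simp
    then show "a *\<^sub>R x + b *\<^sub>R y \<in> ?K" using bctrl_convex[OF uv(1,2) ab] by blast
  qed
  have "?K \<noteq> {}" using bctrl_0[OF M] by blast
  from exists_projection[OF cvx this, of x]
  obtain p where p: "p \<in> closure ?K" "\<And>c. c \<in> ?K \<Longrightarrow> (x - p) \<bullet> (c - p) \<le> 0"
    by blast
  obtain u where u: "u \<in> bctrl M" "L T u = p" using L_image_closed[OF T M p(1)] by blast
  have "x = p"
  proof (rule ccontr)
    assume "x \<noteq> p"
    let ?z = "x - p"
    have pos: "?z \<bullet> ?z > 0" using \<open>x \<noteq> p\<close> by simp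
    obtain y where y: "\<And>n::nat. y n \<in> D'" "y \<longlonglongrightarrow> ?z" using D'_approx by blast
    obtain C where C: "C > 0" "\<And>u. u \<in> L2 T \<Longrightarrow> norm (L T u) \<le> C * L2_norm_on T u"
      using L_bound[OF T] by blast
    define R where "R = C * sqrt (M\<^sup>2 * T)"
    have R: "norm (L T v) \<le> R" if "v \<in> bctrl M" for v
    proof -
      have "C * L2_norm_on T v \<le> R"
        unfolding R_def L2_norm_on_sqrt using C(1) bctrl_L2(2)[OF that, of T] T by (intro mult_left_mono) auto
      then show ?thesis using C(2)[OF b2[OF that]] by linarith
    qed
    \<comment> \<open>Choose \<open>v\<close> almost optimal for \<open>y n\<close>. The pairing of
      \<open>L T v - p\<close> with \<open>x - p\<close> is not positive, so only the approximation
      error of \<open>y n\<close> remains, against two points of the image, which lies in a ball of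
      radius \<open>R\<close>.\<close>
    have ineq: "(x - p) \<bullet> y n \<le> 2 * R * norm (y n - ?z)" for n
    proof (rule field_le_epsilon)
      fix e :: real assume e: "e > 0"
      obtain v where v: "v \<in> bctrl M" "M * ob_L1 T (y n) - e \<le> L T v \<bullet> y n"
        using sup_L_inner[OF T M y(1) e] by blast
      have "x \<bullet> y n \<le> L T v \<bullet> y n + e" using le[OF y(1)[of n]] v(2) by linarith
      moreover have "(L T v - p) \<bullet> y n \<le> (L T v - p) \<bullet> (y n - ?z)"
        using p(2)[of "L T v"] v(1) by (simp add: inner_diff_right inner_commute)
      moreover have "(L T v - p) \<bullet> (y n - ?z) \<le> norm (L T v - p) * norm (y n - ?z)" by (rule norm_cauchy_schwarz)
      moreover have "norm (L T v - p) * norm (y n - ?z) \<le> (2 * R) * norm (y n - ?z)"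
        using R[OF v(1)] R[OF u(1)] u(2) norm_triangle_ineq4[of "L T v" p]
        by (intro mult_right_mono) auto
      ultimately show "(x - p) \<bullet> y n \<le> 2 * R * norm (y n - ?z) + e"
        by (simp add: inner_diff_left)
    qed
    have "(\<lambda>n. (x - p) \<bullet> y n) \<longlonglongrightarrow> (x - p) \<bullet> ?z" by (intro tendsto_intros y)
    moreover have "(\<lambda>n. 2 * R * norm (y n - ?z)) \<longlonglongrightarrow> 2 * R * norm (?z - ?z)" by (intro tendsto_intros y)
    ultimately have "(x - p) \<bullet> ?z \<le> 2 * R * norm (?z - ?z)"
      using ineq by (intro LIMSEQ_le) auto
    then show False using pos by simp
  qed
  with u show ?thesis by blast
qed

section \<open>Null controllability and the minimal norm function\<close>

definition ctrlable :: "real \<Rightarrow> real \<Rightarrow> 'x \<Rightarrow> bool" where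
  "ctrlable T M y \<longleftrightarrow> (\<exists>u\<in>bctrl M. sgp P T y + L T u = 0)"

lemma bctrl_L2': "0 < T \<Longrightarrow> u \<in> bctrl M \<Longrightarrow> u \<in> L2 T"
  by (rule bctrl_L2(1)) auto

lemma concat_control:
  assumes st: "0 < s" "s < t" and u: "u \<in> bctrl M" and v: "v \<in> bctrl M"
  shows "\<exists>w\<in>bctrl M. L t w = sgp P (t - s) (L s u) + L (t - s) v"
proof
  let ?w = "\<lambda>\<tau>. if \<tau> < s then u \<tau> else v (\<tau> - s)"
  show w: "?w \<in> bctrl M" by (rule bctrl_concat[OF u v])
  have "L s ?w = L s u"
    using st bctrl_L2'[OF st(1) u] by (intro L_cong AE_I2) auto
  moreover have "L (t - s) (\<lambda>\<tau>. ?w (\<tau> + s)) = L (t - s) v"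
    using st bctrl_L2'[OF _ v, of "t - s"] by (intro L_cong AE_I2) auto
  ultimately show "L t ?w = sgp P (t - s) (L s u) + L (t - s) v"
    using L_split[OF st w] by simp
qed

lemma S_split: "0 \<le> s \<Longrightarrow> s \<le> t \<Longrightarrow> sgp P t y = sgp P (t - s) (sgp P s y)"
  using S_add[of "t - s" s y] by simp

lemma ctrlable_later:
  assumes "0 < s" "s \<le> t" "ctrlable s M y" shows "ctrlable t M y"
proof (cases "s = t")
  case False
  then have st: "0 < s" "s < t" using assms by auto
  obtain u where u: "u \<in> bctrl M" "sgp P s y + L s u = 0" using assms by (auto simp: ctrlable_def)
  have M: "0 \<le> M" by (rule bctrl_nonneg[OF u(1)])
  obtain w where w: "w \<in> bctrl M" "L t w = sgp P (t - s) (L s u) + L (t - s) (\<lambda>_. 0)"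
    using concat_control[OF st u(1) bctrl_0[OF M]] by blast
  have "sgp P t y + L t w = sgp P (t - s) (sgp P s y + L s u)"
    using S_split[of s t y] st w(2) by (simp add: blinfun.add_right L_0)
  then show ?thesis using u(2) w(1) by (auto simp: ctrlable_def)
qed (use assms in simp)

lemma cond_cD: assumes "cond_c P" "0 < T"
  obtains C where "C > 0" "\<And>z. z \<in> D' \<Longrightarrow> norm (S' T z) \<le> C * ob_L1 T z"
  using assms unfolding cond_c_def adj_domain_eq adj_sgp_eq ob_L1_def ob_def by blast

lemma null_control:
  assumes "cond_c P" and T: "0 < T"
  obtains C where "C > 0" "\<And>y. ctrlable T (C * norm y) y"
proof -
  obtain C where C: "C > 0" "\<And>z. z \<in> D' \<Longrightarrow> norm (S' T z) \<le> C * ob_L1 T z"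
    using cond_cD[OF assms] by blast
  have "ctrlable T (C * norm y) y" for y
  proof -
    have "\<exists>u\<in>bctrl (C * norm y). L T u = - sgp P T y"
    proof (rule reachable_if_inner_le[OF T])
      fix z assume z: "z \<in> D'"
      have "- sgp P T y \<bullet> z = - y \<bullet> S' T z" by (simp add: S'_inner)
      also have "\<dots> \<le> norm (- y) * norm (S' T z)" by (rule norm_cauchy_schwarz)
      also have "\<dots> \<le> norm (- y) * (C * ob_L1 T z)" using C(2)[OF z] by (intro mult_left_mono) auto
      finally show "- sgp P T y \<bullet> z \<le> C * norm y * ob_L1 T z" by (simp add: ac_simps)
    qed (use C(1) in simp)
    then obtain u where "u \<in> bctrl (C * norm y)" "L T u = - sgp P T y" by blast
    then show ?thesis unfolding ctrlable_def by (intro bexI[of _ u]) auto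
  qed
  with C(1) show ?thesis using that by blast
qed

text \<open>Use the scaled control \<open>(1 - l) u\<close> up to time \<open>s\<close>. This leaves
  \<open>l\<close> times the free state, which is steered to 0 during the remaining time at cost
  \<open>l * k\<close>.\<close>

lemma ctrlable_strict:
  assumes c: "cond_c P" and st: "0 < s" "s < t" and cs: "ctrlable s M y" and M: "0 < M"
  shows "\<exists>N<M. ctrlable t N y"
proof -
  obtain u where u: "u \<in> bctrl M" "sgp P s y + L s u = 0" using cs by (auto simp: ctrlable_def)
  obtain C where C: "C > 0" "\<And>y. ctrlable (t - s) (C * norm y) y"
    using null_control[OF c, of "t - s"] st by auto
  define k where "k = C * norm (sgp P s y)"
  have k: "0 \<le> k" using C by (simp add: k_def)
  \<comment> \<open>Any small positive \<open>l\<close> makes \<open>(1 - l) * M < M\<close>; this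
    choice also gives \<open>l * k < M\<close>, and the added 1 keeps it below 1 even for
    \<open>k = 0\<close>.\<close>
  define l where "l = M / (M + k + 1)"
  have l: "0 < l" "l < 1" using M k by (auto simp: l_def)
  have lk: "l * k < M"
  proof -
    have "M * k < M * (M + k + 1)" using M by (intro mult_strict_left_mono) auto
    then show ?thesis using M k by (simp add: l_def divide_less_eq)
  qed
  define N where "N = max ((1 - l) * M) (l * k)"
  have N: "N < M" using l M lk by (simp add: N_def)
  obtain v where v: "v \<in> bctrl (C * norm (l *\<^sub>R sgp P s y))" "sgp P (t - s) (l *\<^sub>R sgp P s y) + L (t - s) v = 0"
    using C(2)[of "l *\<^sub>R sgp P s y"] by (auto simp: ctrlable_def)
  have "v \<in> bctrl N" using v(1) l by (rule_tac bctrl_mono) (auto simp: N_def k_def ac_simps)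
  moreover have "(\<lambda>t. (1 - l) *\<^sub>R u t) \<in> bctrl N"
    using bctrl_scaleR[OF u(1), of "1 - l"] l by (rule_tac bctrl_mono) (auto simp: N_def)
  ultimately obtain w where w: "w \<in> bctrl N"
      "L t w = sgp P (t - s) (L s (\<lambda>t. (1 - l) *\<^sub>R u t)) + L (t - s) v"
    using concat_control[OF st] by blast
  have Ls: "L s (\<lambda>t. (1 - l) *\<^sub>R u t) = (1 - l) *\<^sub>R L s u"
    using L_scaleR[OF st(1) bctrl_L2'[OF st(1) u(1)]] .
  have "L s u = - sgp P s y" using u(2) by (simp add: eq_neg_iff_add_eq_0 add.commute)
  then have "sgp P s y + (1 - l) *\<^sub>R L s u = l *\<^sub>R sgp P s y" by (simp add: algebra_simps)
  then have "sgp P t y + L t w = sgp P (t - s) (l *\<^sub>R sgp P s y) + L (t - s) v"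
    using S_split[of s t y] st w(2) Ls by (simp add: add.assoc[symmetric] flip: blinfun.add_right)
  then have "ctrlable t N y" using v(2) w(1) by (auto simp: ctrlable_def)
  with N show ?thesis by blast
qed

text \<open>Shifting a control by a short time \<open>\<delta>\<close> leaves a small final state, which is cancelled by a
  small control.\<close>

lemma ctrlable_earlier:
  assumes c: "cond_c P" and t: "0 < t" and ct: "ctrlable t M y" and MN: "M < N"
  shows "\<exists>s. 0 < s \<and> s < t \<and> ctrlable s N y"
proof -
  obtain u where u: "u \<in> bctrl M" "sgp P t y + L t u = 0" using ct by (auto simp: ctrlable_def)
  have M: "0 \<le> M" by (rule bctrl_nonneg[OF u(1)])
  \<comment> \<open>The correction acts during the fixed time \<open>t / 2\<close>, so that its cost
    constant does not depend on \<delta>.\<close>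
  obtain C where C: "C > 0" "\<And>y. ctrlable (t / 2) (C * norm y) y"
    using null_control[OF c, of "t / 2"] t by auto
  obtain K where K: "K > 0" "\<And>\<delta> M u. 0 < \<delta> \<Longrightarrow> \<delta> < 1 \<Longrightarrow> u \<in> bctrl M \<Longrightarrow> norm (L \<delta> u) \<le> K * (M * sqrt \<delta>)"
    using L_short_time by blast
  have "((\<lambda>\<delta>. C * (norm (y - sgp P \<delta> y) + K * (M * sqrt \<delta>))) \<longlongrightarrow> C * (norm (y - y) + K * (M * sqrt 0))) (at_right 0)"
    by (intro tendsto_intros S_right)
  then have "\<forall>\<^sub>F \<delta> in at_right 0. C * (norm (y - sgp P \<delta> y) + K * (M * sqrt \<delta>)) < N - M"
    using MN by (intro order_tendstoD) auto
  moreover have "\<forall>\<^sub>F \<delta> in at_right 0. 0 < \<delta> \<and> \<delta> < min (t / 2) 1"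
    using t by (intro eventually_at_rightI[of 0 "min (t / 2) 1"]) auto
  ultimately have "\<forall>\<^sub>F \<delta> in at_right 0. C * (norm (y - sgp P \<delta> y) + K * (M * sqrt \<delta>)) < N - M \<and>
      0 < \<delta> \<and> \<delta> < min (t / 2) 1" by eventually_elim simp
  then obtain \<delta> where small: "C * (norm (y - sgp P \<delta> y) + K * (M * sqrt \<delta>)) < N - M"
      and d: "0 < \<delta>" "\<delta> < t / 2" "\<delta> < 1"
    using eventually_happens[of _ "at_right (0::real)"] by auto
  define s where "s = t - \<delta>"
  have s: "t / 2 < s" "s < t" "0 < s" using d t by (auto simp: s_def)
  \<comment> \<open>Dropping the first \<delta> units of \<open>u\<close> and starting from
    \<open>y\<close> ends at time \<open>s\<close> in \<open>S s e\<close> instead of 0. The control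
    \<open>w\<close> steers \<open>e\<close> to 0 by time \<open>t / 2\<close> and is zero
    afterwards, which removes this error.\<close>
  define e where "e = y - sgp P \<delta> y - L \<delta> u"
  have e: "C * norm e < N - M"
  proof -
    have "norm e \<le> norm (y - sgp P \<delta> y) + K * (M * sqrt \<delta>)"
      unfolding e_def using norm_triangle_ineq4[of "y - sgp P \<delta> y" "L \<delta> u"] K(2)[OF d(1,3) u(1)] by linarith
    then have "C * norm e \<le> C * (norm (y - sgp P \<delta> y) + K * (M * sqrt \<delta>))" using C(1) by (intro mult_left_mono) auto
    with small show ?thesis by linarith
  qed
  obtain v where v: "v \<in> bctrl (C * norm e)" "sgp P (t / 2) e + L (t / 2) v = 0"
    using C(2)[of e] by (auto simp: ctrlable_def)
  have "0 \<le> C * norm e" using C(1) by simp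
  then obtain w where w: "w \<in> bctrl (C * norm e)"
     "L s w = sgp P (s - t / 2) (L (t / 2) v) + L (s - t / 2) (\<lambda>_. 0)"
    using concat_control[OF _ s(1) v(1) bctrl_0] t by auto
  have "L (t / 2) v = - sgp P (t / 2) e" using v(2) by (simp add: eq_neg_iff_add_eq_0 add.commute)
  then have Lw: "L s w = - sgp P s e"
    using w(2) S_split[of "t / 2" s e] s t by (simp add: L_0 blinfun.minus_right)
  define u' where "u' = (\<lambda>\<tau>. u (\<tau> + \<delta>))"
  have u': "u' \<in> bctrl M" unfolding u'_def by (rule bctrl_translate[OF u(1)])
  have "L t u = sgp P s (L \<delta> u) + L s u'"
    using L_split[of \<delta> t u M] d u(1) by (simp add: s_def u'_def)
  then have Lu': "sgp P t y + sgp P s (L \<delta> u) + L s u' = 0" using u(2) by (simp add: add.assoc)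
  have St: "sgp P t y = sgp P s (sgp P \<delta> y)" using S_split[of \<delta> t y] d by (simp add: s_def)
  have "sgp P s y + (L s u' + L s w) = 0"
    using Lu' St unfolding Lw e_def by (simp add: blinfun.diff_right blinfun.add_right algebra_simps)
  moreover have "L s (\<lambda>\<tau>. u' \<tau> + w \<tau>) = L s u' + L s w"
    using bctrl_L2'[OF s(3) u'] bctrl_L2'[OF s(3) w(1)] by (intro L_add s)
  moreover have "(\<lambda>\<tau>. u' \<tau> + w \<tau>) \<in> bctrl N"
    using bctrl_mono[OF bctrl_add[OF u' w(1)]] e by simp
  ultimately have "ctrlable s N y"
    unfolding ctrlable_def by (intro bexI[of _ "\<lambda>\<tau>. u' \<tau> + w \<tau>"]) auto
  with s show ?thesis by blast
qed

lemma not_ctrlable_short_time: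
  assumes y: "y \<noteq> 0"
  shows "\<forall>\<^sub>F \<delta> in at_right 0. \<not> ctrlable \<delta> M y"
proof -
  obtain K where K: "K > 0" "\<And>\<delta> M u. 0 < \<delta> \<Longrightarrow> \<delta> < 1 \<Longrightarrow> u \<in> bctrl M \<Longrightarrow> norm (L \<delta> u) \<le> K * (M * sqrt \<delta>)"
    using L_short_time by blast
  have "((\<lambda>\<delta>. norm (sgp P \<delta> y) - K * (M * sqrt \<delta>)) \<longlongrightarrow> norm y - K * (M * sqrt 0)) (at_right 0)"
    by (intro tendsto_intros S_right)
  then have "\<forall>\<^sub>F \<delta> in at_right 0. 0 < norm (sgp P \<delta> y) - K * (M * sqrt \<delta>)"
    using y by (intro order_tendstoD) auto
  moreover have "\<forall>\<^sub>F \<delta> in at_right 0. 0 < \<delta> \<and> \<delta> < (1::real)"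
    by (intro eventually_at_rightI[of 0 1]) auto
  ultimately show ?thesis
  proof eventually_elim
    fix \<delta> assume pos: "0 < norm (sgp P \<delta> y) - K * (M * sqrt \<delta>)" and d: "0 < \<delta> \<and> \<delta> < 1"
    show "\<not> ctrlable \<delta> M y"
    proof
      assume "ctrlable \<delta> M y"
      then obtain u where u: "u \<in> bctrl M" "sgp P \<delta> y + L \<delta> u = 0" by (auto simp: ctrlable_def)
      have "sgp P \<delta> y = - L \<delta> u" using u(2) by (simp add: eq_neg_iff_add_eq_0)
      then have "norm (sgp P \<delta> y) = norm (L \<delta> u)" by simp
      then show False using K(2)[of \<delta> u M] d u(1) pos by simp
    qed
  qed
qed

section \<open>Essential bounds and the minimal norm in terms of controllability\<close>

lemma Linf_norm_measurable:
  "strongly_measurable (lebesgue_on S) v \<Longrightarrow> S \<in> sets lebesgue \<Longrightarrow>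
    (\<lambda>t. ereal (norm (v t))) \<in> borel_measurable (lebesgue_on S)"
  using strongly_measurable_norm_borel[of S v] by measurable

lemma Linf_norm_leI:
  assumes "strongly_measurable (lebesgue_on S) v" "S \<in> sets lebesgue" "AE t in lebesgue_on S. norm (v t) \<le> M"
  shows "Linf_norm S v \<le> ereal M"
  unfolding Linf_norm_def
  by (intro esssup_I Linf_norm_measurable assms(1,2)) (use assms(3) in simp)

lemma Linf_norm_leD: assumes "Linf_norm S v \<le> ereal M" shows "AE t in lebesgue_on S. norm (v t) \<le> M"
proof -
  have "AE t in lebesgue_on S. ereal (norm (v t)) \<le> Linf_norm S v"
    unfolding Linf_norm_def by (rule esssup_AE)
  then show ?thesis
  proof eventually_elim
    fix t assume "ereal (norm (v t)) \<le> Linf_norm S v"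
    then have "ereal (norm (v t)) \<le> ereal M" using assms by (rule order_trans)
    then show "norm (v t) \<le> M" by simp
  qed
qed

text \<open>An essential supremum over a space of measure zero could be negative; positivity of
  \<open>T\<close> excludes this.\<close>

lemma Linf_norm_nonneg: assumes "0 < T" shows "0 \<le> Linf_norm {0<..<T} v"
proof -
  have "AE t in Ioo_measure T. ereal (norm (v t)) \<le> Linf_norm {0<..<T} v"
    unfolding Linf_norm_def by (rule esssup_AE)
  then have "AE t in Ioo_measure T. 0 \<le> Linf_norm {0<..<T} v"
    by eventually_elim (meson ereal_less_eq(5) norm_ge_zero order_trans)
  then show ?thesis
    using assms by (simp add: eventually_const_iff ae_filter_eq_bot_iff emeasure_restrict_space)
qed

lemma Linf_finite: assumes v: "v \<in> Linf {0<..<T}" and T: "0 < T"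
  shows "\<exists>M\<ge>0. Linf_norm {0<..<T} v = ereal M"
proof (cases "Linf_norm {0<..<T} v")
  case (real r)
  then show ?thesis using Linf_norm_nonneg[OF T, of v] by auto
next
  case PInf
  then show ?thesis using v by (simp add: Linf_def)
next
  case MInf
  then show ?thesis using Linf_norm_nonneg[OF T, of v] by simp
qed

lemma L2_bounded:
  assumes "strongly_measurable (Ioo_measure T) v" "AE t in Ioo_measure T. norm (v t) \<le> M"
  shows "v \<in> L2 T"
proof -
  interpret finite_measure "Ioo_measure T" by (rule finite_measure_lebesgue_on_Ioo)
  have "AE t in Ioo_measure T. (norm (v t))\<^sup>2 \<le> M\<^sup>2" using assms(2) by eventually_elim (simp add: power_mono)
  then show ?thesis by (intro L2_I[OF assms(1), of "\<lambda>_. M\<^sup>2"]) auto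
qed

lemma ctrlableI:
  assumes T: "0 < T" and v: "strongly_measurable (Ioo_measure T) v" "AE t in Ioo_measure T. norm (v t) \<le> M"
    and M: "0 \<le> M" and st: "state P T y v = 0"
  shows "ctrlable T M y"
proof -
  have v2: "v \<in> L2 T" by (rule L2_bounded[OF v])
  have "sgp P T y + L T v = 0" using st state_eq_0_iff[OF T v2] by simp
  then show ?thesis unfolding ctrlable_def
    using L_cutoff(1)[OF T v2] by (intro bexI[of _ "cutoff T v"] bctrl_cutoff v M) simp
qed

lemma NP_admissible_if_bctrl:
  assumes T: "0 < T" and u: "u \<in> bctrl M" "sgp P T y + L T u = 0"
  shows "NP_admissible P T y u" "Linf_norm {0<..<T} u \<le> ereal M"
proof -
  have sm: "strongly_measurable (Ioo_measure T) u"
    using u by (intro strongly_measurable_restrict) (auto simp: bctrl_def)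
  have "AE t in lebesgue. norm (u t) \<le> M" using u by (simp add: bctrl_def)
  then have "AE t in Ioo_measure T. norm (u t) \<le> M"
    by (subst AE_lebesgue_on_iff) (auto elim: eventually_mono)
  then show le: "Linf_norm {0<..<T} u \<le> ereal M" by (intro Linf_norm_leI sm) auto
  then have "Linf_norm {0<..<T} u < \<infinity>" by auto
  then show "NP_admissible P T y u"
    using sm u(2) state_eq_0_iff[OF T bctrl_L2'[OF T u(1)]] by (simp add: NP_admissible_def Linf_def)
qed

lemma NP_value_le: assumes "0 < T" "ctrlable T M y" shows "NP_value P T y \<le> ereal M"
proof -
  obtain u where u: "u \<in> bctrl M" "sgp P T y + L T u = 0" using assms by (auto simp: ctrlable_def)
  have "NP_value P T y \<le> Linf_norm {0<..<T} u"
    unfolding NP_value_def using NP_admissible_if_bctrl(1)[OF assms(1) u] by (intro Inf_lower) auto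
  also have "\<dots> \<le> ereal M" by (rule NP_admissible_if_bctrl(2)[OF assms(1) u])
  finally show ?thesis .
qed

lemma NP_value_nonneg: "0 < T \<Longrightarrow> 0 \<le> NP_value P T y"
  unfolding NP_value_def by (rule Inf_greatest) (use Linf_norm_nonneg in auto)

lemma NP_admissible_imp_ctrlable:
  assumes T: "0 < T" and v: "NP_admissible P T y v" "Linf_norm {0<..<T} v \<le> ereal M"
  shows "ctrlable T M y"
proof -
  have "0 \<le> ereal M" using Linf_norm_nonneg[OF T, of v] v(2) by (rule order_trans)
  then show ?thesis
    using v Linf_norm_leD[OF v(2)] by (intro ctrlableI[OF T]) (auto simp: NP_admissible_def Linf_def)
qed

lemma NP_value_less_imp_ctrlable:
  assumes T: "0 < T" and "NP_value P T y < ereal M"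
  shows "ctrlable T M y"
proof -
  obtain v where v: "NP_admissible P T y v" "Linf_norm {0<..<T} v < ereal M"
    using assms(2) unfolding NP_value_def Inf_less_iff by auto
  then show ?thesis by (intro NP_admissible_imp_ctrlable[OF T v(1)]) auto
qed

lemma NP_value_antimono: assumes "0 < s" "s \<le> t" shows "NP_value P t y \<le> NP_value P s y"
proof (rule ccontr)
  assume "\<not> ?thesis"
  then obtain M where "NP_value P s y < ereal M" "ereal M < NP_value P t y"
    using ereal_dense2 by (metis not_le)
  moreover from this have "NP_value P t y \<le> ereal M"
    using assms by (intro NP_value_le ctrlable_later[OF assms] NP_value_less_imp_ctrlable) auto
  ultimately show False by simp
qed

text \<open>\<open>min_norm\<close> at infinity is a \<open>Lim\<close>, which can be evaluated only
  after convergence is known; by monotonicity the limit is the infimum over all times.\<close>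

lemma NP_value_tendsto_at_top: "((\<lambda>t. NP_value P t y) \<longlongrightarrow> (INF t\<in>{0<..}. NP_value P t y)) at_top"
proof (rule order_tendstoI)
  fix a assume a: "a < (INF t\<in>{0<..}. NP_value P t y)"
  show "\<forall>\<^sub>F t in at_top. a < NP_value P t y"
    using eventually_gt_at_top[of "0::real"] by eventually_elim (use less_INF_D[OF a] in auto)
next
  fix a assume "(INF t\<in>{0<..}. NP_value P t y) < a"
  then obtain s where s: "s > 0" "NP_value P s y < a" by (auto simp: INF_less_iff)
  show "\<forall>\<^sub>F t in at_top. NP_value P t y < a"
    using eventually_ge_at_top[of s] by eventually_elim (use NP_value_antimono[OF s(1)] s(2) in \<open>auto intro: le_less_trans\<close>)
qed

lemma min_norm_infinity: "min_norm P \<infinity> y = (INF t\<in>{0<..}. NP_value P t y)"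
  unfolding min_norm_def using tendsto_Lim[OF _ NP_value_tendsto_at_top[of y]] by simp

lemma min_norm_real: "0 < T \<Longrightarrow> min_norm P (ereal T) y = NP_value P T y"
  by (simp add: min_norm_def zero_ereal_def)

lemma min_norm_0: assumes "y \<noteq> 0" shows "min_norm P 0 y = \<infinity>"
proof -
  have "((\<lambda>t. NP_value P t y) \<longlongrightarrow> \<infinity>) (at_right 0)"
    unfolding tendsto_PInfty
  proof
    fix r
    have "\<forall>\<^sub>F t in at_right 0. 0 < (t::real)" by (intro eventually_at_rightI[of 0 1]) auto
    \<comment> \<open>The shift to \<open>r + 1\<close> provides the strict inequality from which
      controllability follows.\<close>
    with not_ctrlable_short_time[OF assms, of "r + 1"] show "\<forall>\<^sub>F t in at_right 0. ereal r < NP_value P t y"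
    proof eventually_elim
      fix t assume *: "\<not> ctrlable t (r + 1) y" "0 < t"
      show "ereal r < NP_value P t y"
      proof (rule ccontr)
        assume "\<not> ?thesis"
        then have "NP_value P t y \<le> ereal r" by simp
        also have "\<dots> < ereal (r + 1)" by simp
        finally show False using NP_value_less_imp_ctrlable[OF *(2)] *(1) by blast
      qed
    qed
  qed
  then show ?thesis
    unfolding min_norm_def using tendsto_Lim[OF trivial_limit_at_right_real] by simp
qed

section \<open>The critical times\<close>

lemma T0_eq_0: assumes c: "cond_c P" shows "T0 P y = 0"
proof (rule antisym)
  have le: "T0 P y \<le> ereal t" if t: "0 < t" for t
  proof -
    obtain C where "ctrlable t (C * norm y) y" using null_control[OF c t] by blast
    then obtain M u where u: "u \<in> bctrl M" "sgp P t y + L t u = 0" by (auto simp: ctrlable_def)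
    have sm: "strongly_measurable (lebesgue_on {0..}) u"
      using u by (intro strongly_measurable_restrict) (auto simp: bctrl_def)
    have "AE s in lebesgue. norm (u s) \<le> M" using u by (simp add: bctrl_def)
    then have "AE s in lebesgue_on {0..}. norm (u s) \<le> M"
      by (subst AE_lebesgue_on_iff) (auto elim: eventually_mono)
    then have "Linf_norm {0..} u \<le> ereal M" by (intro Linf_norm_leI sm) auto
    then have "Linf_norm {0..} u < \<infinity>" by auto
    then have "u \<in> Linf {0..}" using sm by (simp add: Linf_def)
    moreover have "state P t y u = 0" using u state_eq_0_iff[OF t bctrl_L2'[OF t u(1)]] by simp
    ultimately show ?thesis unfolding T0_def using t by (intro Inf_lower) auto
  qed
  show "T0 P y \<le> 0"
  proof (rule ccontr)
    assume "\<not> ?thesis"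
    then obtain r where "0 < ereal r" "ereal r < T0 P y" using ereal_dense2[of 0 "T0 P y"] by (auto simp: not_le)
    then show False using le[of r] by simp
  qed
  show "0 \<le> T0 P y" unfolding T0_def by (rule Inf_greatest) auto
qed

text \<open>A free trajectory that has reached 0 stays there, so it vanishes at all times after the
  infimum; right continuity then gives the infimum itself.\<close>

lemma T1_le_iff: assumes T: "0 \<le> T" shows "T1 P y \<le> ereal T \<longleftrightarrow> sgp P T y = 0"
proof
  assume le: "T1 P y \<le> ereal T"
  have zero: "sgp P (T + h) y = 0" if h: "h > 0" for h
  proof -
    have "T1 P y < ereal (T + h)" using le h by (metis ereal_less(2) less_add_same_cancel1 less_ereal.simps(1) order_le_less_trans)
    then obtain t where t: "0 \<le> t" "sgp P t y = 0" "t < T + h" unfolding T1_def Inf_less_iff by auto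
    then show ?thesis using S_split[of t "T + h" y] by (simp add: blinfun.zero_right)
  qed
  have "\<forall>\<^sub>F h in at_right 0. sgp P h (sgp P T y) = 0"
    using zero T S_add[of _ T y] by (intro eventually_at_rightI[of 0 1]) (auto simp: add.commute)
  then have "((\<lambda>h::real. 0::'x) \<longlongrightarrow> sgp P T y) (at_right 0)"
    using S_right[of "sgp P T y"] tendsto_cong by fast
  then show "sgp P T y = 0" using tendsto_unique[OF trivial_limit_at_right_real _ tendsto_const] by blast
next
  assume "sgp P T y = 0"
  then show "T1 P y \<le> ereal T" unfolding T1_def using T by (intro Inf_lower) auto
qed

lemma T1_cases: assumes y: "y \<noteq> 0" shows "T1 P y = \<infinity> \<or> (\<exists>r>0. T1 P y = ereal r)"
proof (cases "T1 P y")
  case (real r)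
  have "0 \<le> T1 P y" unfolding T1_def by (rule Inf_greatest) auto
  moreover have "r \<noteq> 0" using T1_le_iff[of 0 y] y real by auto
  ultimately show ?thesis using real by auto
next
  case MInf
  have "0 \<le> T1 P y" unfolding T1_def by (rule Inf_greatest) auto
  with MInf show ?thesis by simp
qed simp

lemma ctrlable_0: "sgp P T y = 0 \<Longrightarrow> ctrlable T 0 y"
  unfolding ctrlable_def by (intro bexI[of _ "\<lambda>_. 0"]) (auto simp: L_0)

lemma NP_value_0: assumes "0 < T" "sgp P T y = 0" shows "NP_value P T y = 0"
  using NP_value_le[OF assms(1) ctrlable_0[OF assms(2)]] NP_value_nonneg[OF assms(1)]
  by (simp add: zero_ereal_def antisym)

section \<open>Extension of the observation to the whole space\<close>

text \<open>The extended observation \<open>g\<close> of \<open>z\<close> is characterized up to null sets by a Lipschitz estimate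
  against all observations from the domain.\<close>

lemma obs_extension_ex: assumes T: "0 < T" shows "\<exists>G. obs_extension P T G"
proof -
  obtain C where C: "C > 0" "\<And>z. z \<in> D' \<Longrightarrow> L2_norm_on T (ob T z) \<le> C * norm z"
    using ob_bound[OF T] by blast
  have Csq: "L2_sq T (ob T z) \<le> (C * norm z)\<^sup>2" if "z \<in> D'" for z
    using C(2)[OF that] C(1) by (simp add: L2_norm_on_sqrt real_sqrt_le_iff sqrt_le_D)
  have diff: "L2_sq T (\<lambda>t. ob T z t - ob T w t) \<le> (C * norm (z - w))\<^sup>2" if zw: "z \<in> D'" "w \<in> D'" for z w
  proof -
    have "L2_sq T (\<lambda>t. ob T z t - ob T w t) = L2_sq T (ob T (z - w))"
      unfolding L2_sq_def using zw by (intro Henstock_Kurzweil_Integration.integral_cong) (simp add: ob_diff)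
    then show ?thesis using Csq[of "z - w"] A'_diff[OF zw] by simp
  qed
  \<comment> \<open>The factor 2 is that of \<open>L2_sq_triangle\<close>, used between the
    observations of \<open>y\<close> and of an approximation of \<open>z\<close>.\<close>
  define Q where "Q z g \<longleftrightarrow> g \<in> L2 T \<and> (\<forall>y\<in>D'. L2_sq T (\<lambda>t. ob T y t - g t) \<le> 2 * (C * norm (y - z))\<^sup>2)" for z g
  have "\<exists>g. Q z g" for z
  proof -
    obtain y where y: "\<And>n::nat. y n \<in> D'" "y \<longlonglongrightarrow> z" using D'_approx by blast
    have yL: "ob T (y n) \<in> L2 T" for n by (rule ob_L2[OF y(1)])
    have "\<exists>N. \<forall>m\<ge>N. \<forall>n\<ge>N. L2_sq T (\<lambda>t. ob T (y m) t - ob T (y n) t) < e" if e: "e > 0" for e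
    proof -
      have "Cauchy y" using y(2) by (rule LIMSEQ_imp_Cauchy)
      then obtain N where N: "\<forall>m\<ge>N. \<forall>n\<ge>N. norm (y m - y n) < sqrt e / C"
        using e C(1) unfolding Cauchy_def dist_norm by (meson divide_pos_pos real_sqrt_gt_zero)
      have "L2_sq T (\<lambda>t. ob T (y m) t - ob T (y n) t) < e" if "m \<ge> N" "n \<ge> N" for m n
      proof -
        have "C * norm (y m - y n) < sqrt e" using N that C(1) by (simp add: less_divide_eq mult.commute)
        then have "(C * norm (y m - y n))\<^sup>2 < (sqrt e)\<^sup>2" using C(1) by (intro power_strict_mono) auto
        then show ?thesis using diff[OF y(1) y(1), of m n] e by simp
      qed
      then show ?thesis by blast
    qed
    from L2_complete[OF less_imp_le[OF T] yL this]
    obtain g where g: "g \<in> L2 T" "(\<lambda>n. L2_sq T (\<lambda>t. ob T (y n) t - g t)) \<longlonglongrightarrow> 0" by blast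
    have "L2_sq T (\<lambda>t. ob T x t - g t) \<le> 2 * (C * norm (x - z))\<^sup>2" if x: "x \<in> D'" for x
    proof -
      have *: "L2_sq T (\<lambda>t. ob T x t - g t) \<le> 2 * (C * norm (x - y n))\<^sup>2 + 2 * L2_sq T (\<lambda>t. ob T (y n) t - g t)" for n
        using L2_sq_triangle[OF ob_L2[OF x] yL[of n] g(1)] diff[OF x y(1)[of n]] by simp
      have "(\<lambda>n. 2 * (C * norm (x - y n))\<^sup>2 + 2 * L2_sq T (\<lambda>t. ob T (y n) t - g t)) \<longlonglongrightarrow>
          2 * (C * norm (x - z))\<^sup>2 + 2 * 0"
        by (intro tendsto_intros y g)
      then have "L2_sq T (\<lambda>t. ob T x t - g t) \<le> 2 * (C * norm (x - z))\<^sup>2 + 2 * 0"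
        using * by (intro LIMSEQ_le_const) auto
      then show ?thesis by simp
    qed
    with g(1) show ?thesis unfolding Q_def by blast
  qed
  then obtain G where G: "\<And>z. Q z (G z)" by metis
  have GL: "G z \<in> L2 T" for z using G by (simp add: Q_def)
  have GQ: "L2_sq T (\<lambda>t. ob T y t - G z t) \<le> 2 * (C * norm (y - z))\<^sup>2" if "y \<in> D'" for y z
    using G that by (simp add: Q_def)
  \<comment> \<open>Linearity and the extension property are all equalities up to null sets; each is
    obtained by bounding the squared distance of both sides by a null sequence.\<close>
  have AE0: "AE t in Ioo_measure T. f t = g t"
    if f: "f \<in> L2 T" and g: "g \<in> L2 T" and lim: "c \<longlonglongrightarrow> 0" and le: "\<And>n. L2_sq T (\<lambda>t. f t - g t) \<le> c n" for f g :: "real \<Rightarrow> 'u" and c :: "nat \<Rightarrow> real"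
  proof -
    have "L2_sq T (\<lambda>t. f t - g t) \<le> 0" by (rule LIMSEQ_le_const[OF lim]) (use le in auto)
    then have "AE t in Ioo_measure T. f t - g t = 0"
      using L2_sq_zero_iff[OF L2_diff(1)[OF f g]] L2_sq_nonneg[of T "\<lambda>t. f t - g t"] by simp
    then show ?thesis by eventually_elim simp
  qed
  have add: "AE t in Ioo_measure T. G (z + w) t = G z t + G w t" for z w
  proof -
    obtain y where y: "\<And>n::nat. y n \<in> D'" "y \<longlonglongrightarrow> z" using D'_approx by blast
    obtain x where x: "\<And>n::nat. x n \<in> D'" "x \<longlonglongrightarrow> w" using D'_approx by blast
    define c where "c n = 4 * (C * norm ((y n + x n) - (z + w)))\<^sup>2 +
        2 * (4 * (C * norm (y n - z))\<^sup>2 + 4 * (C * norm (x n - w))\<^sup>2)" for n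
    have lim: "c \<longlonglongrightarrow> 0"
    proof -
      have "c \<longlonglongrightarrow> 4 * (C * norm ((z + w) - (z + w)))\<^sup>2 + 2 * (4 * (C * norm (z - z))\<^sup>2 + 4 * (C * norm (w - w))\<^sup>2)"
        unfolding c_def by (intro tendsto_intros y x)
      then show ?thesis by simp
    qed
    have GzwL: "(\<lambda>t. G z t + G w t) \<in> L2 T" by (intro L2_add GL)
    have le: "L2_sq T (\<lambda>t. G (z + w) t - (G z t + G w t)) \<le> c n" for n
    proof -
      have yx: "y n + x n \<in> D'" using A'_add y x by blast
      have "L2_sq T (\<lambda>t. G (z + w) t - (G z t + G w t)) \<le>
         2 * L2_sq T (\<lambda>t. G (z + w) t - ob T (y n + x n) t) +
         2 * L2_sq T (\<lambda>t. ob T (y n + x n) t - (G z t + G w t))"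
        by (rule L2_sq_triangle[OF GL ob_L2[OF yx] GzwL])
      moreover have "L2_sq T (\<lambda>t. G (z + w) t - ob T (y n + x n) t) \<le> 2 * (C * norm ((y n + x n) - (z + w)))\<^sup>2"
        using GQ[OF yx] by (subst L2_sq_commute)
      moreover have "L2_sq T (\<lambda>t. ob T (y n + x n) t - (G z t + G w t)) =
          L2_sq T (\<lambda>t. (ob T (y n) t - G z t) + (ob T (x n) t - G w t))"
        unfolding L2_sq_def using y x by (intro Henstock_Kurzweil_Integration.integral_cong) (simp add: ob_add algebra_simps)
      moreover have "L2_sq T (\<lambda>t. (ob T (y n) t - G z t) + (ob T (x n) t - G w t)) \<le>
          2 * L2_sq T (\<lambda>t. ob T (y n) t - G z t) + 2 * L2_sq T (\<lambda>t. ob T (x n) t - G w t)"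
        by (intro L2_add L2_diff ob_L2 y x GL)
      ultimately show ?thesis using GQ[OF y(1)[of n], of z] GQ[OF x(1)[of n], of w] unfolding c_def by argo
    qed
    show ?thesis by (rule AE0[OF GL GzwL lim le])
  qed
  have scale: "AE t in Ioo_measure T. G (a *\<^sub>R z) t = a *\<^sub>R G z t" for a z
  proof -
    obtain y where y: "\<And>n::nat. y n \<in> D'" "y \<longlonglongrightarrow> z" using D'_approx by blast
    define c where "c n = 4 * (C * norm (a *\<^sub>R y n - a *\<^sub>R z))\<^sup>2 + 2 * (a\<^sup>2 * (2 * (C * norm (y n - z))\<^sup>2))" for n
    have lim: "c \<longlonglongrightarrow> 0"
    proof -
      have "c \<longlonglongrightarrow> 4 * (C * norm (a *\<^sub>R z - a *\<^sub>R z))\<^sup>2 + 2 * (a\<^sup>2 * (2 * (C * norm (z - z))\<^sup>2))"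
        unfolding c_def by (intro tendsto_intros y)
      then show ?thesis by simp
    qed
    have GaL: "(\<lambda>t. a *\<^sub>R G z t) \<in> L2 T" by (intro L2_scaleR GL)
    have le: "L2_sq T (\<lambda>t. G (a *\<^sub>R z) t - a *\<^sub>R G z t) \<le> c n" for n
    proof -
      have ay: "a *\<^sub>R y n \<in> D'" using A'_scale y by blast
      have "L2_sq T (\<lambda>t. G (a *\<^sub>R z) t - a *\<^sub>R G z t) \<le>
         2 * L2_sq T (\<lambda>t. G (a *\<^sub>R z) t - ob T (a *\<^sub>R y n) t) +
         2 * L2_sq T (\<lambda>t. ob T (a *\<^sub>R y n) t - a *\<^sub>R G z t)"
        by (rule L2_sq_triangle[OF GL ob_L2[OF ay] GaL])
      moreover have "L2_sq T (\<lambda>t. G (a *\<^sub>R z) t - ob T (a *\<^sub>R y n) t) \<le> 2 * (C * norm (a *\<^sub>R y n - a *\<^sub>R z))\<^sup>2"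
        using GQ[OF ay] by (subst L2_sq_commute)
      moreover have "L2_sq T (\<lambda>t. ob T (a *\<^sub>R y n) t - a *\<^sub>R G z t) =
          L2_sq T (\<lambda>t. a *\<^sub>R (ob T (y n) t - G z t))"
        unfolding L2_sq_def using y by (intro Henstock_Kurzweil_Integration.integral_cong) (simp add: ob_scale algebra_simps)
      moreover have "L2_sq T (\<lambda>t. a *\<^sub>R (ob T (y n) t - G z t)) = a\<^sup>2 * L2_sq T (\<lambda>t. ob T (y n) t - G z t)"
        by (intro L2_scaleR L2_diff ob_L2 y GL)
      moreover have "a\<^sup>2 * L2_sq T (\<lambda>t. ob T (y n) t - G z t) \<le> a\<^sup>2 * (2 * (C * norm (y n - z))\<^sup>2)"
        using GQ[OF y(1)[of n], of z] by (intro mult_left_mono) auto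
      ultimately show ?thesis unfolding c_def by linarith
    qed
    show ?thesis by (rule AE0[OF GL GaL lim le])
  qed
  have ext: "AE t in Ioo_measure T. G z t = adj_ctrl P (adj_sgp P (T - t) z)" if z: "z \<in> adj_domain P" for z
  proof -
    have z': "z \<in> D'" using z by (simp add: adj_domain_eq)
    have "AE t in Ioo_measure T. ob T z t = G z t"
      by (rule AE0[OF ob_L2[OF z'] GL tendsto_const]) (use GQ[OF z', of z] in simp)
    then show ?thesis by eventually_elim (simp add: ob_def adj_sgp_eq)
  qed
  \<comment> \<open>Compare with the observation of 0, which vanishes; the constant
    \<open>2 * C\<close> dominates \<open>sqrt 2 * C\<close>.\<close>
  have bound: "L2_norm_on T (G z) \<le> (2 * C) * norm z" for z
  proof -
    have "L2_sq T (G z) = L2_sq T (\<lambda>t. ob T 0 t - G z t)"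
    proof -
      have "ob T 0 t = 0" if "t \<le> T" for t using ob_scale[of 0 t T 0] A'_0 that by simp
      then show ?thesis unfolding L2_sq_def by (intro Henstock_Kurzweil_Integration.integral_cong) simp
    qed
    also have "\<dots> \<le> 2 * (C * norm z)\<^sup>2" using GQ[of 0 z] A'_0 by simp
    also have "\<dots> \<le> (2 * C * norm z)\<^sup>2" by (simp add: power_mult_distrib)
    finally have "sqrt (L2_sq T (G z)) \<le> sqrt ((2 * C * norm z)\<^sup>2)" by (rule real_sqrt_le_mono)
    then show ?thesis using C(1) by (simp add: L2_norm_on_sqrt)
  qed
  have "obs_extension P T G"
    unfolding obs_extension_def using GL add scale ext bound by blast
  then show ?thesis by blast
qed

text \<open>\<open>obs\<close> is a chosen extension, determined up to null sets. It is handled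
  below through its distance to observations of states in \<open>D'\<close> alone.\<close>

lemma obs_props: assumes T: "0 < T"
  obtains C where "C > 0" "\<And>z. obs P T z \<in> L2 T"
    "\<And>z w. w \<in> D' \<Longrightarrow> L2_norm_on T (\<lambda>t. obs P T z t - ob T w t) \<le> C * norm (z - w)"
proof -
  have G: "obs_extension P T (obs P T)"
    unfolding obs_def using someI_ex[OF obs_extension_ex[OF T]] .
  obtain C where C: "\<And>z. L2_norm_on T (obs P T z) \<le> C * norm z"
    using G unfolding obs_extension_def by blast
  have mem: "obs P T z \<in> L2 T" for z using G by (simp add: obs_extension_def)
  have "L2_norm_on T (\<lambda>t. obs P T z t - ob T w t) \<le> max C 1 * norm (z - w)" if w: "w \<in> D'" for z w
  proof -
    have 1: "AE t in Ioo_measure T. obs P T (z + (-1) *\<^sub>R w) t = obs P T z t + obs P T ((-1) *\<^sub>R w) t"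
      using G unfolding obs_extension_def by blast
    have 2: "AE t in Ioo_measure T. obs P T ((-1) *\<^sub>R w) t = (-1) *\<^sub>R obs P T w t"
      using G unfolding obs_extension_def by blast
    have 3: "AE t in Ioo_measure T. obs P T w t = ob T w t"
      using G w unfolding obs_extension_def adj_domain_eq adj_sgp_eq ob_def by blast
    have eq: "AE t in Ioo_measure T. obs P T (z - w) t = obs P T z t - ob T w t"
      using 1 2 3 by eventually_elim simp
    have "L2_sq T (\<lambda>t. obs P T z t - ob T w t) = L2_sq T (obs P T (z - w))"
      by (rule L2_sq_cong(2)[OF eq mem])
    then have "L2_norm_on T (\<lambda>t. obs P T z t - ob T w t) = L2_norm_on T (obs P T (z - w))"
      by (simp add: L2_norm_on_sqrt)
    also have "\<dots> \<le> C * norm (z - w)" by (rule C)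
    also have "\<dots> \<le> max C 1 * norm (z - w)" by (intro mult_right_mono) auto
    finally show ?thesis .
  qed
  with mem show ?thesis using that[of "max C 1"] by simp
qed

section \<open>The bang-bang property\<close>

text \<open>The observation depends only on the time to go \<open>T - t\<close>, so that over
  \<open>(0,\<tau>)\<close> it is a translate of the one over the last \<tau> units of
  \<open>(0,T)\<close>.\<close>

lemma ob_L1_S': assumes z: "z \<in> D'" and \<tau>: "0 < \<tau>" "\<tau> \<le> T" shows "ob_L1 \<tau> z \<le> ob_L1 T z"
proof -
  have int: "(\<lambda>t. norm (ob T z t)) integrable_on {0..T}" by (rule ob_norm_integrable[OF z])
  have "ob_L1 \<tau> z = integral {0..\<tau>} ((\<lambda>t. norm (ob T z t)) \<circ> (+) (T - \<tau>))"
    unfolding ob_L1_def by (rule Henstock_Kurzweil_Integration.integral_cong) (simp add: ob_def algebra_simps)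
  also have "\<dots> = integral {T - \<tau>..T} (\<lambda>t. norm (ob T z t))"
    using integral_shift_Icc_real[of 0 \<tau> "\<lambda>t. norm (ob T z t)" "T - \<tau>"] by simp
  also have "\<dots> \<le> ob_L1 T z"
    unfolding ob_L1_def using \<tau> int
    by (intro integral_subset_le integrable_on_subinterval[OF int]) auto
  finally show ?thesis .
qed

definition ob_on :: "real set \<Rightarrow> real \<Rightarrow> 'x \<Rightarrow> real" where
  "ob_on E T z = (\<integral>t. indicator E t * norm (ob T z t) \<partial>Ioo_measure T)"

lemma integrable_indicator_norm:
  assumes "v \<in> L2 T" "E \<in> sets lebesgue"
  shows "integrable (Ioo_measure T) (\<lambda>t. indicator E t * norm (v t))"
proof (rule Bochner_Integration.integrable_bound[OF L2_imp_norm_integrable[OF assms(1)]])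
  have "E \<inter> {0<..<T} \<in> sets lebesgue" using assms(2) by (intro sets.Int) auto
  then have [measurable]: "E \<inter> {0<..<T} \<in> sets (Ioo_measure T)" by (simp add: sets_restrict_space_iff)
  have [measurable]: "(\<lambda>t. norm (v t)) \<in> borel_measurable (Ioo_measure T)" by (rule L2_norm_measurable[OF assms(1)])
  have "(\<lambda>t. indicator (E \<inter> {0<..<T}) t * norm (v t)) \<in> borel_measurable (Ioo_measure T)" by measurable
  then show "(\<lambda>t. indicator E t * norm (v t)) \<in> borel_measurable (Ioo_measure T)"
    by (subst measurable_cong[where g = "\<lambda>t. indicator (E \<inter> {0<..<T}) t * norm (v t)"]) (auto simp: indicator_def)
qed (auto simp: indicator_def)

lemma ob_on_midpoint: assumes zw: "z \<in> D'" "w \<in> D'" and E: "E \<in> sets lebesgue"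
  shows "ob_on E T ((1/2) *\<^sub>R (z + w)) \<le> (ob_on E T z + ob_on E T w) / 2"
proof -
  have m: "(1/2) *\<^sub>R (z + w) \<in> D'" using A'_add[OF zw] A'_scale by blast
  have "ob_on E T ((1/2) *\<^sub>R (z + w)) \<le>
     (\<integral>t. (1/2) * (indicator E t * norm (ob T z t)) + (1/2) * (indicator E t * norm (ob T w t)) \<partial>Ioo_measure T)"
    unfolding ob_on_def
  proof (rule integral_mono)
    fix t assume "t \<in> space (Ioo_measure T)"
    then have "ob T ((1/2) *\<^sub>R (z + w)) t = (1/2) *\<^sub>R (ob T z t + ob T w t)"
      using zw A'_add[OF zw] by (simp add: ob_scale ob_add del: scaleR_add_right)
    then have "norm (ob T ((1/2) *\<^sub>R (z + w)) t) \<le> (1/2) * norm (ob T z t) + (1/2) * norm (ob T w t)"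
      using norm_triangle_ineq[of "ob T z t" "ob T w t"] by simp
    then show "indicator E t * norm (ob T ((1/2) *\<^sub>R (z + w)) t) \<le>
       (1/2) * (indicator E t * norm (ob T z t)) + (1/2) * (indicator E t * norm (ob T w t))"
      by (simp add: indicator_def)
  qed (use zw m E in \<open>auto intro!: integrable_indicator_norm ob_L2\<close>)
  also have "\<dots> = (ob_on E T z + ob_on E T w) / 2"
    unfolding ob_on_def using zw E by (simp add: integrable_indicator_norm ob_L2)
  finally show ?thesis .
qed

text \<open>Pointwise Cauchy-Schwarz under the duality integral: where the control stays \<eta>
  below its bound, the pairing falls short of the support function by \<eta> times the norm of the
  observation.\<close>

lemma L_inner_deficit:
  assumes T: "0 < T" and R: "0 < R" "R \<le> T" and v: "v \<in> L2 T" and le: "AE t in Ioo_measure T. norm (v t) \<le> N"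
    and E: "E \<in> sets lebesgue" "E \<subseteq> {0<..<R}" and small: "\<And>t. t \<in> E \<Longrightarrow> norm (v t) \<le> N - \<eta>" and z: "z \<in> D'"
  shows "L T v \<bullet> z + \<eta> * (\<integral>t. indicator E t * norm (ob T z t) \<partial>Ioo_measure T) \<le> N * ob_L1 T z"
proof -
  obtain Z where Z: "{t \<in> {0<..<T}. \<not> norm (v t) \<le> N} \<subseteq> Z" "negligible Z"
  proof -
    have "AE t in lebesgue. t \<in> {0<..<T} \<longrightarrow> norm (v t) \<le> N"
      using le by (subst (asm) AE_lebesgue_on_iff) simp_all
    then show ?thesis using that by (auto simp: eventually_ae_filter negligible_iff_null_sets)
  qed
  \<comment> \<open>The integrals are compared pointwise, so both integrands are set to 0 at the end
    points and on the null set where the bound on \<open>v\<close> fails.\<close>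
  have neg: "negligible (insert 0 (insert T Z))" using Z(2) by simp
  let ?B = "insert 0 (insert T Z)"
  let ?i = "\<integral>t. indicator E t * norm (ob T z t) \<partial>Ioo_measure T"
  have "((\<lambda>t. indicator E t * norm (ob T z t)) has_integral ?i) {0<..<T}"
    by (rule has_integral_integral_lebesgue_on[OF integrable_indicator_norm[OF ob_L2[OF z] E(1)]]) simp
  then have "((\<lambda>t. indicator E t * norm (ob T z t)) has_integral ?i) {0..T}"
    using has_integral_Icc_iff_Ioo by blast
  then have 1: "((\<lambda>t. v t \<bullet> ob T z t + \<eta> * (indicator E t * norm (ob T z t))) has_integral L T v \<bullet> z + \<eta> * ?i) {0..T}"
    by (intro has_integral_add has_integral_mult_right L_inner T v z)
  have 2: "((\<lambda>t. N * norm (ob T z t)) has_integral N * ob_L1 T z) {0..T}"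
    unfolding ob_L1_def by (intro has_integral_mult_right integrable_integral ob_norm_integrable z)
  have 3: "((\<lambda>t. if t \<in> ?B then 0 else v t \<bullet> ob T z t + \<eta> * (indicator E t * norm (ob T z t)))
      has_integral L T v \<bullet> z + \<eta> * ?i) {0..T}"
    by (rule has_integral_spike[OF neg _ 1]) auto
  have 4: "((\<lambda>t. if t \<in> ?B then 0 else N * norm (ob T z t)) has_integral N * ob_L1 T z) {0..T}"
    by (rule has_integral_spike[OF neg _ 2]) auto
  show ?thesis
  proof (rule has_integral_le[OF 3 4])
    fix t assume t: "t \<in> {0..T}"
    have "v t \<bullet> ob T z t + \<eta> * (indicator E t * norm (ob T z t)) \<le> N * norm (ob T z t)" if tB: "t \<notin> ?B"
    proof -
      have "t \<in> {0<..<T}" using tB t by auto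
      then have nN: "norm (v t) \<le> N" using tB Z(1) by blast
      have cs: "v t \<bullet> ob T z t \<le> norm (v t) * norm (ob T z t)" by (rule norm_cauchy_schwarz)
      show ?thesis
      proof (cases "t \<in> E")
        case True
        have "norm (v t) * norm (ob T z t) \<le> (N - \<eta>) * norm (ob T z t)"
          using small[OF True] by (intro mult_right_mono) auto
        then show ?thesis using cs True by (simp add: algebra_simps)
      next
        case False
        have "norm (v t) * norm (ob T z t) \<le> N * norm (ob T z t)" using nN by (intro mult_right_mono) auto
        then show ?thesis using cs False by simp
      qed
    qed
    then show "(if t \<in> ?B then 0 else v t \<bullet> ob T z t + \<eta> * (indicator E t * norm (ob T z t))) \<le>
        (if t \<in> ?B then 0 else N * norm (ob T z t))" by auto
  qed
qed

text \<open>Separating the target from smaller balls gives directions \<open>z\<close> in which \<open>v\<close> is almost extremal, and whose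
  observation is therefore almost zero where \<open>v\<close> is not extremal. By (c) the states \<open>S' \<tau> z\<close> stay bounded; a limit
  has an observation vanishing on \<open>E\<close>, hence everywhere by (d), and then vanishes at time \<open>R\<close> by (c), although it
  still separates.\<close>

lemma no_gap:
  assumes c: "cond_c P" and d: "cond_d P" and R: "0 < R" "R < T"
    and v: "v \<in> L2 T" and le: "AE t in Ioo_measure T. norm (v t) \<le> N" and N: "0 < N"
    and st: "sgp P T y + L T v = 0" and min: "\<And>M. M < N \<Longrightarrow> \<not> ctrlable T M y"
    and E: "E \<in> sets lebesgue" "E \<subseteq> {0<..<R}" and \<eta>: "0 < \<eta>"
    and small: "\<And>t. t \<in> E \<Longrightarrow> norm (v t) \<le> N - \<eta>"
  shows "emeasure lebesgue E = 0"
proof (rule ccontr)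
  assume Epos: "emeasure lebesgue E \<noteq> 0"
  have T: "0 < T" using R by simp
  define \<tau> where "\<tau> = T - R"
  have \<tau>: "0 < \<tau>" "\<tau> \<le> T" using R by (auto simp: \<tau>_def)
  \<comment> \<open>The shift by 2 makes \<open>e n < N\<close> already for \<open>n = 0\<close>, so
    the reduced bounds \<open>N - e n\<close> are positive.\<close>
  define e where "e n = N / (real n + 2)" for n
  have e: "0 < e n" "e n < N" for n using N by (auto simp: e_def divide_less_eq)
  have e_lim: "e \<longlonglongrightarrow> 0"
  proof -
    have "(\<lambda>n. inverse (real (Suc (Suc n)))) \<longlonglongrightarrow> 0" using LIMSEQ_Suc[OF LIMSEQ_inverse_real_of_nat] .
    then have "(\<lambda>n. N * inverse (real (Suc (Suc n)))) \<longlonglongrightarrow> N * 0" by (intro tendsto_intros)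
    moreover have "N * inverse (real (Suc (Suc n))) = e n" for n by (simp add: e_def divide_inverse ac_simps)
    ultimately show ?thesis by simp
  qed
  have e_anti: "e n \<le> e m" if "m \<le> n" for m n
    unfolding e_def using that N by (intro divide_left_mono) auto
  have Lv: "L T v = - sgp P T y" using st by (simp add: eq_neg_iff_add_eq_0 add.commute)
  obtain C\<tau> where C\<tau>: "C\<tau> > 0" "\<And>z. z \<in> D' \<Longrightarrow> norm (S' \<tau> z) \<le> C\<tau> * ob_L1 \<tau> z"
    using cond_cD[OF c \<tau>(1)] by blast
  obtain CR where CR: "CR > 0" "\<And>z. z \<in> D' \<Longrightarrow> norm (S' R z) \<le> CR * ob_L1 R z"
    using cond_cD[OF c R(1)] by blast
  \<comment> \<open>All three conditions survive midpoints; this is why the normalization reads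
    \<open>\<le> 1\<close> and not \<open>= 1\<close>. The last bound is the deficit
    \<open>N - (N - e n)\<close> divided by \<eta>.\<close>
  define Z where "Z n = {z \<in> D'. N - e n \<le> L T v \<bullet> z \<and> ob_L1 T z \<le> 1 \<and> ob_on E R (S' \<tau> z) \<le> e n / \<eta>}" for n
  have ob_E: "ob_on E R (S' \<tau> z) = (\<integral>t. indicator E t * norm (ob T z t) \<partial>Ioo_measure T)" if z: "z \<in> D'" for z
  proof -
    have 1: "((\<lambda>t. indicator E t * norm (ob R (S' \<tau> z) t)) has_integral ob_on E R (S' \<tau> z)) {0<..<R}"
      unfolding ob_on_def using A'_S'[of \<tau> z] z \<tau>(1)
      by (intro has_integral_integral_lebesgue_on integrable_indicator_norm ob_L2 E) auto
    have 2: "((\<lambda>t. indicator E t * norm (ob T z t)) has_integral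
        (\<integral>t. indicator E t * norm (ob T z t) \<partial>Ioo_measure T)) {0<..<T}"
      using z by (intro has_integral_integral_lebesgue_on integrable_indicator_norm ob_L2 E) auto
    have "((\<lambda>t. if t \<in> {0<..<R} then indicator E t * norm (ob R (S' \<tau> z) t) else 0) has_integral ob_on E R (S' \<tau> z)) {0<..<T}"
      using 1 R by (subst has_integral_restrict) auto
    moreover have "(if t \<in> {0<..<R} then indicator E t * norm (ob R (S' \<tau> z) t) else 0) = indicator E t * norm (ob T z t)" for t
      using E(2) \<tau>(1) by (auto simp: ob_S' \<tau>_def indicator_def)
    ultimately show ?thesis using has_integral_unique[OF _ 2] by simp
  qed
  have Z_ne: "Z n \<noteq> {}" for n
  proof -
    define M where "M = N - e n"
    have M: "0 \<le> M" "M < N" using e[of n] by (auto simp: M_def)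
    have "\<not> (\<forall>z\<in>D'. L T v \<bullet> z \<le> M * ob_L1 T z)"
    proof
      assume "\<forall>z\<in>D'. L T v \<bullet> z \<le> M * ob_L1 T z"
      then obtain u where "u \<in> bctrl M" "L T u = L T v"
        using reachable_if_inner_le[OF T M(1), of "L T v"] by blast
      then have "ctrlable T M y" using st unfolding ctrlable_def by (intro bexI[of _ u]) auto
      with min[OF M(2)] show False by blast
    qed
    then obtain z where z: "z \<in> D'" "M * ob_L1 T z < L T v \<bullet> z" by force
    have deficit: "L T v \<bullet> z + \<eta> * ob_on E R (S' \<tau> z) \<le> N * ob_L1 T z"
      unfolding ob_E[OF z(1)] using R small
      by (intro L_inner_deficit[OF T R(1) _ v le E _ z(1)]) auto
    have on0: "0 \<le> ob_on E R (S' \<tau> z)" unfolding ob_on_def by (intro Bochner_Integration.integral_nonneg) simp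
    \<comment> \<open>Strict separation together with the deficit inequality gives
      \<open>0 < N * ob_L1 T z\<close>, without which \<open>z\<close> could not be
      normalized.\<close>
    have "M * ob_L1 T z \<ge> 0" using M ob_L1_nonneg[OF z(1)] by simp
    then have "0 < N * ob_L1 T z" using z(2) deficit on0 \<eta> mult_nonneg_nonneg[of \<eta> "ob_on E R (S' \<tau> z)"] by linarith
    then have l: "0 < ob_L1 T z" using N by (simp add: zero_less_mult_iff)
    define k where "k = inverse (ob_L1 T z)"
    have k: "0 < k" "k * ob_L1 T z = 1" using l by (auto simp: k_def)
    define w where "w = k *\<^sub>R z"
    have wD: "w \<in> D'" using z(1) A'_scale by (simp add: w_def)
    have l1: "ob_L1 T w = 1" using ob_L1_scale[OF z(1), of T k] k by (simp add: w_def)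
    have "k * (M * ob_L1 T z) < k * (L T v \<bullet> z)" using z(2) k by (intro mult_strict_left_mono) auto
    then have big: "M < L T v \<bullet> w" using k by (simp add: w_def mult.left_commute)
    have "L T v \<bullet> w + \<eta> * ob_on E R (S' \<tau> w) \<le> N * ob_L1 T w"
      unfolding ob_E[OF wD] using R small
      by (intro L_inner_deficit[OF T R(1) _ v le E _ wD]) auto
    then have "\<eta> * ob_on E R (S' \<tau> w) \<le> e n" using l1 big by (simp add: M_def)
    then have "ob_on E R (S' \<tau> w) \<le> e n / \<eta>" using \<eta> by (simp add: le_divide_eq mult.commute)
    then have "w \<in> Z n" using wD l1 big by (simp add: Z_def M_def)
    then show ?thesis by blast
  qed
  define C where "C n = S' \<tau> ` Z n" for n
  have bound: "norm x \<le> C\<tau>" if "x \<in> C n" for x n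
  proof -
    obtain z where z: "z \<in> Z n" "x = S' \<tau> z" using \<open>x \<in> C n\<close> by (auto simp: C_def)
    have "norm x \<le> C\<tau> * ob_L1 \<tau> z" using C\<tau>(2)[of z] z by (simp add: Z_def)
    also have "\<dots> \<le> C\<tau> * 1" using C\<tau>(1) ob_L1_S'[OF _ \<tau>, of z] z(1)
      by (intro mult_left_mono) (auto simp: Z_def)
    finally show ?thesis by simp
  qed
  have "\<exists>w. (\<forall>n. w n \<in> C n) \<and> (\<forall>e>0. \<exists>k. \<forall>m\<ge>k. \<forall>n\<ge>k. (norm (w m - w n))\<^sup>2 < e) \<and>
     (\<forall>n. \<forall>x\<in>C n. (norm (w n))\<^sup>2 < (norm x)\<^sup>2 + inverse (real (Suc n)))"
  proof (rule nested_minimizing_sequence[where mid = "\<lambda>x y. (1/2) *\<^sub>R (x + y)" and L = 0 and B = "C\<tau>\<^sup>2"])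
    show "C n \<noteq> {}" for n using Z_ne by (simp add: C_def)
    show "C n \<subseteq> C m" if "m \<le> n" for m n
    proof -
      have "e n / \<eta> \<le> e m / \<eta>" using e_anti[OF that] \<eta> by (intro divide_right_mono) auto
      then have "Z n \<subseteq> Z m" using e_anti[OF that] by (auto simp: Z_def)
      then show ?thesis by (auto simp: C_def)
    qed
    show "\<exists>x\<in>C n. (norm x)\<^sup>2 \<le> C\<tau>\<^sup>2" for n
    proof -
      obtain x where "x \<in> C n" using Z_ne[of n] by (auto simp: C_def)
      then show ?thesis using bound by (intro bexI[of _ x] power_mono) auto
    qed
    show "(1/2) *\<^sub>R (x + x') \<in> C n" if xx: "x \<in> C n" "x' \<in> C n" for n x x'
    proof -
      obtain z z' where z: "z \<in> Z n" "x = S' \<tau> z" and z': "z' \<in> Z n" "x' = S' \<tau> z'" using xx by (auto simp: C_def)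
      have D: "z \<in> D'" "z' \<in> D'" using z z' by (auto simp: Z_def)
      let ?m = "(1/2) *\<^sub>R (z + z')"
      have Sm: "S' \<tau> ?m = (1/2) *\<^sub>R (S' \<tau> z + S' \<tau> z')"
        by (simp only: linear_scale[OF S'_linear] linear_add[OF S'_linear])
      have mD: "?m \<in> D'" using A'_add[OF D] A'_scale by blast
      have "ob_L1 T ?m \<le> (1/2) * (ob_L1 T z + ob_L1 T z')"
        using ob_L1_scale[of "z + z'" T "1/2"] A'_add[OF D] ob_L1_add[OF D, of T] by (simp del: scaleR_add_right)
      moreover have "L T v \<bullet> ?m = (1/2) * (L T v \<bullet> z + L T v \<bullet> z')" by (simp add: inner_add_right)
      moreover have "ob_on E R (S' \<tau> ?m) \<le> (ob_on E R (S' \<tau> z) + ob_on E R (S' \<tau> z')) / 2"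
        unfolding Sm using A'_S'[of \<tau>] \<tau>(1) D by (intro ob_on_midpoint E) auto
      ultimately have "?m \<in> Z n" using z(1) z'(1) mD unfolding Z_def by auto
      then show ?thesis using Sm z(2) z'(2) unfolding C_def by (intro image_eqI[of _ _ ?m]) auto
    qed
    show "(norm (x - x'))\<^sup>2 = 2 * (norm x)\<^sup>2 + 2 * (norm x')\<^sup>2 - 4 * (norm ((1/2) *\<^sub>R (x + x')))\<^sup>2" for x x' :: 'x
      by (rule norm_parallelogram)
  qed simp
  then obtain w where w: "\<And>n::nat. w n \<in> C n" "Cauchy w" using Cauchy_if_norm_sq by metis
  obtain z0 where z0: "w \<longlonglongrightarrow> z0" using w(2) Cauchy_convergent_iff convergent_def by blast
  have "\<exists>z. z \<in> Z n \<and> w n = S' \<tau> z" for n using w(1)[of n] by (auto simp: C_def)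
  then obtain z where z: "\<And>n. z n \<in> Z n" "\<And>n. w n = S' \<tau> (z n)" by metis
  have zD: "z n \<in> D'" for n using z(1)[of n] by (simp add: Z_def)
  have wD: "w n \<in> D'" for n using z(2)[of n] A'_S'[of \<tau> "z n"] zD[of n] \<tau>(1) by simp
  obtain K where K: "K \<ge> 1" "\<And>t z. 0 \<le> t \<Longrightarrow> t \<le> R \<Longrightarrow> norm (S' t z) \<le> K * norm z"
    using S'_bound[of R] by blast
  have diff0: "(\<lambda>n. norm (z0 - w n)) \<longlonglongrightarrow> 0"
    using tendsto_norm[OF tendsto_diff[OF tendsto_const[of z0] z0]] by simp
  have SRlim: "(\<lambda>n. S' R (w n)) \<longlonglongrightarrow> S' R z0"
  proof -
    have *: "norm (S' R (w n) - S' R z0) \<le> K * norm (z0 - w n)" for n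
      using K(2)[of R "w n - z0"] R(1) by (simp add: S'_diff norm_minus_commute)
    have "(\<lambda>n. K * norm (z0 - w n)) \<longlonglongrightarrow> 0" using tendsto_mult[OF tendsto_const[of K] diff0] by simp
    then have "(\<lambda>n. S' R (w n) - S' R z0) \<longlonglongrightarrow> 0"
      by (rule Lim_null_comparison[OF always_eventually[OF allI[OF *]]])
    then show ?thesis by (rule LIM_zero_cancel)
  qed
  \<comment> \<open>Since \<open>R + \<tau> = T\<close>, \<open>S' R (w n)\<close> equals
    \<open>S' T (z n)\<close>. The separation inequality therefore depends on \<open>z n\<close>
    through \<open>w n\<close> only, and persists in the limit although \<open>z n\<close> may
    diverge.\<close>
  have lower: "N - e n \<le> - y \<bullet> S' R (w n)" for n
  proof -
    have "S' R (w n) = S' T (z n)" using S'_add[of R \<tau> "z n"] R \<tau> z(2)[of n] by (simp add: \<tau>_def)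
    then have "- y \<bullet> S' R (w n) = L T v \<bullet> z n" by (simp add: Lv S'_inner)
    then show ?thesis using z(1)[of n] by (simp add: Z_def)
  qed
  have "N - 0 \<le> - y \<bullet> S' R z0"
    by (rule LIMSEQ_le[OF tendsto_diff[OF tendsto_const e_lim] tendsto_inner[OF tendsto_const SRlim]])
       (use lower in blast)
  then have nz: "S' R z0 \<noteq> 0" using N by auto
  obtain Co where Co: "Co > 0" and mem: "\<And>z. obs P R z \<in> L2 R"
    and close: "\<And>z w. w \<in> D' \<Longrightarrow> L2_norm_on R (\<lambda>t. obs P R z t - ob R w t) \<le> Co * norm (z - w)"
    using obs_props[OF R(1)] by blast
  let ?g = "obs P R z0"
  let ?M = "Ioo_measure R"
  have L1: "integral {0..R} (\<lambda>t. norm (?g t - ob R (w n) t)) \<le> sqrt R * (Co * norm (z0 - w n))" for n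
  proof -
    have "integral {0..R} (\<lambda>t. norm (?g t - ob R (w n) t)) \<le> sqrt R * L2_norm_on R (\<lambda>t. ?g t - ob R (w n) t)"
      by (rule integral_norm_le[OF R(1) L2_diff(1)[OF mem ob_L2[OF wD]]])
    also have "\<dots> \<le> sqrt R * (Co * norm (z0 - w n))"
      using close[OF wD, of z0 n] R(1) by (intro mult_left_mono) auto
    finally show ?thesis .
  qed
  have lim0: "(\<lambda>n. sqrt R * (Co * norm (z0 - w n))) \<longlonglongrightarrow> 0"
    using tendsto_mult[OF tendsto_const[of "sqrt R"] tendsto_mult[OF tendsto_const[of Co] diff0]] by simp
  have int: "integrable ?M (\<lambda>t. norm (?g t - ob R (w n) t))" for n
    by (intro L2_imp_norm_integrable L2_diff mem ob_L2 wD)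
  have intE: "integrable ?M (\<lambda>t. indicator E t * norm (?g t))"
    by (rule integrable_indicator_norm[OF mem E(1)])
  \<comment> \<open>Compare \<open>?g\<close> with the observation of \<open>w n\<close>: their
    \<open>L^1\<close> distance tends to 0, and the mass of the latter on \<open>E\<close> is at
    most \<open>e n / \<eta>\<close>.\<close>
  have "(\<integral>t. indicator E t * norm (?g t) \<partial>?M) \<le> sqrt R * (Co * norm (z0 - w n)) + e n / \<eta>" for n
  proof -
    have "(\<integral>t. indicator E t * norm (?g t) \<partial>?M) \<le>
        (\<integral>t. norm (?g t - ob R (w n) t) + indicator E t * norm (ob R (w n) t) \<partial>?M)"
    proof (rule integral_mono[OF intE])
      show "integrable ?M (\<lambda>t. norm (?g t - ob R (w n) t) + indicator E t * norm (ob R (w n) t))"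
        by (intro Bochner_Integration.integrable_add int integrable_indicator_norm ob_L2 wD E)
      show "indicator E t * norm (?g t) \<le> norm (?g t - ob R (w n) t) + indicator E t * norm (ob R (w n) t)" for t
        using norm_triangle_ineq[of "?g t - ob R (w n) t" "ob R (w n) t"] by (simp add: indicator_def)
    qed
    also have "\<dots> = integral {0..R} (\<lambda>t. norm (?g t - ob R (w n) t)) + ob_on E R (w n)"
      unfolding ob_on_def integral_eq_lebesgue_integral[OF int]
      by (intro Bochner_Integration.integral_add int integrable_indicator_norm ob_L2 wD E)
    also have "ob_on E R (w n) \<le> e n / \<eta>" using z(1)[of n] z(2)[of n] by (simp add: Z_def)
    finally show ?thesis using L1[of n] by linarith
  qed
  moreover have "(\<lambda>n. sqrt R * (Co * norm (z0 - w n)) + e n / \<eta>) \<longlonglongrightarrow> 0 + 0 / \<eta>"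
    using \<eta> by (intro tendsto_intros lim0 e_lim) auto
  ultimately have "(\<integral>t. indicator E t * norm (?g t) \<partial>?M) \<le> 0 + 0 / \<eta>"
    by (intro LIMSEQ_le_const) auto
  moreover have "0 \<le> (\<integral>t. indicator E t * norm (?g t) \<partial>?M)"
    by (intro Bochner_Integration.integral_nonneg) simp
  ultimately have "(\<integral>t. indicator E t * norm (?g t) \<partial>?M) = 0" by simp
  then have "AE t in ?M. indicator E t * norm (?g t) = 0"
    using integral_nonneg_eq_0_iff_AE[OF intE] by simp
  then have "AE t in ?M. t \<in> E \<longrightarrow> ?g t = 0" by eventually_elim (simp add: indicator_def)
  then have "AE t in lebesgue. t \<in> {0<..<R} \<longrightarrow> t \<in> E \<longrightarrow> ?g t = 0"
    by (subst (asm) AE_lebesgue_on_iff) simp_all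
  then have "AE t in lebesgue. t \<in> E \<longrightarrow> ?g t = 0"
    by eventually_elim (use E(2) in blast)
  then have "AE t in lebesgue_on E. ?g t = 0" using E(1) by (simp add: AE_lebesgue_on_iff)
  then have "AE t in ?M. ?g t = 0"
    using d R(1) E Epos unfolding cond_d_def by (meson not_gr_zero)
  then have g0: "AE t in ?M. norm (?g t) = 0" by eventually_elim simp
  \<comment> \<open>As the extended observation of \<open>z0\<close> vanishes, the observations of
    \<open>w n\<close> tend to 0 in \<open>L^1\<close>. Then (c) at time \<open>R\<close> sends
    \<open>S' R (w n)\<close> to 0, against \<open>nz\<close>.\<close>
  have "ob_L1 R (w n) \<le> sqrt R * (Co * norm (z0 - w n))" for n
  proof -
    have "ob_L1 R (w n) = integral\<^sup>L ?M (\<lambda>t. norm (ob R (w n) t))"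
      unfolding ob_L1_def by (rule integral_eq_lebesgue_integral[OF L2_imp_norm_integrable[OF ob_L2[OF wD]]])
    also have "\<dots> \<le> integral\<^sup>L ?M (\<lambda>t. norm (?g t - ob R (w n) t))"
    proof (rule integral_mono_AE[OF L2_imp_norm_integrable[OF ob_L2[OF wD]] int])
      show "AE t in ?M. norm (ob R (w n) t) \<le> norm (?g t - ob R (w n) t)"
        using g0 by eventually_elim simp
    qed
    also have "\<dots> = integral {0..R} (\<lambda>t. norm (?g t - ob R (w n) t))"
      by (rule integral_eq_lebesgue_integral[OF int, symmetric])
    finally show ?thesis using L1[of n] by linarith
  qed
  then have "norm (S' R (w n)) \<le> CR * (sqrt R * (Co * norm (z0 - w n)))" for n
    using CR(2)[OF wD[of n]] CR(1) by (meson less_imp_le mult_left_mono order_trans)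
  moreover have "(\<lambda>n. CR * (sqrt R * (Co * norm (z0 - w n)))) \<longlonglongrightarrow> CR * 0"
    by (intro tendsto_intros lim0)
  ultimately have "norm (S' R z0) \<le> CR * 0"
    by (intro LIMSEQ_le[OF tendsto_norm[OF SRlim]]) auto
  with nz show False by simp
qed

text \<open>A control below \<open>N\<close> on a set of positive measure stays below it by a fixed
  gap, and away from the final time, on a smaller set of positive measure. Countably many uses of
  \<open>no_gap\<close> exclude this.\<close>

lemma bang_bang:
  assumes c: "cond_c P" and d: "cond_d P" and T: "0 < T" and y: "sgp P T y \<noteq> 0"
    and v: "v \<in> L2 T" and le: "AE t in Ioo_measure T. norm (v t) \<le> N" and N0: "0 \<le> N"
    and st: "sgp P T y + L T v = 0" and min: "\<And>M. M < N \<Longrightarrow> \<not> ctrlable T M y"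
  shows "AE t in Ioo_measure T. norm (v t) = N"
proof -
  \<comment> \<open>With \<open>N = 0\<close> the control would vanish almost everywhere and the
    free trajectory would reach 0 by itself.\<close>
  have N: "0 < N"
  proof (rule ccontr)
    assume "\<not> 0 < N"
    then have "N = 0" using N0 by simp
    then have "AE t in Ioo_measure T. (0::'u) = v t" using le by auto
    then have "L T v = L T (\<lambda>_. 0)" by (intro L_cong T L2_0)
    then show False using st y by (simp add: L_0)
  qed
  \<comment> \<open>One index serves the gap \<open>N / (n + 2)\<close> and the final piece
    \<open>T / (n + 2)\<close>; the shift by 2 keeps the interval nonempty for
    \<open>n = 0\<close>.\<close>
  define E where "E n = {t \<in> {0<..<T - T / real (n + 2)}. norm (v t) \<le> N - N / real (n + 2)}" for n
  have pos: "0 < T - T / real (n + 2)" "T - T / real (n + 2) < T" for n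
    using T by (auto simp: divide_less_eq)
  have En: "E n \<in> sets lebesgue" for n
  proof -
    have "(\<lambda>t. norm (v t)) \<in> borel_measurable (Ioo_measure T)" by (rule L2_norm_measurable[OF v])
    then have "{t \<in> space (Ioo_measure T). norm (v t) \<le> N - N / real (n + 2)} \<in> sets (Ioo_measure T)"
      by measurable
    then have "{t \<in> {0<..<T}. norm (v t) \<le> N - N / real (n + 2)} \<in> sets lebesgue"
      by (simp add: sets_restrict_space_iff)
    moreover have "{0<..<T - T / real (n + 2)} \<in> sets lebesgue" by simp
    ultimately have "{t \<in> {0<..<T}. norm (v t) \<le> N - N / real (n + 2)} \<inter> {0<..<T - T / real (n + 2)} \<in> sets lebesgue"
      by (rule sets.Int)
    also have "{t \<in> {0<..<T}. norm (v t) \<le> N - N / real (n + 2)} \<inter> {0<..<T - T / real (n + 2)} = E n"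
      unfolding E_def using pos(2)[of n] by (intro set_eqI) (simp, linarith)
    finally show ?thesis .
  qed
  have "emeasure lebesgue (E n) = 0" for n
  proof (rule no_gap[OF c d pos[of n] v le N st min En])
    show "E n \<subseteq> {0<..<T - T / real (n + 2)}" by (auto simp: E_def)
    show "0 < N / real (n + 2)" using N by simp
    show "norm (v t) \<le> N - N / real (n + 2)" if "t \<in> E n" for t using that by (simp add: E_def)
  qed
  then have "E n \<in> null_sets lebesgue" for n using En by (simp add: null_sets_def)
  then have "AE t in lebesgue. t \<notin> E n" for n by (rule AE_not_in)
  then have "AE t in lebesgue. \<forall>n. t \<notin> E n" by (simp add: AE_all_countable)
  moreover have "AE t in lebesgue. t \<in> {0<..<T} \<longrightarrow> norm (v t) \<le> N"
    using le by (subst (asm) AE_lebesgue_on_iff) simp_all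
  ultimately have "AE t in lebesgue. t \<in> {0<..<T} \<longrightarrow> norm (v t) = N"
  proof eventually_elim
    fix t assume nE: "\<forall>n. t \<notin> E n" and nN: "t \<in> {0<..<T} \<longrightarrow> norm (v t) \<le> N"
    show "t \<in> {0<..<T} \<longrightarrow> norm (v t) = N"
    proof (rule impI, rule ccontr)
      assume t: "t \<in> {0<..<T}" and "norm (v t) \<noteq> N"
      then have lt: "norm (v t) < N" using nN by simp
      obtain n where n: "max (T / (T - t)) (N / (N - norm (v t))) < real n" using reals_Archimedean2 by blast
      have "T < (T - t) * real (n + 2)"
      proof -
        have "T < real n * (T - t)" using n t by (simp add: divide_less_eq)
        also have "\<dots> \<le> (T - t) * real (n + 2)" using t by (simp add: algebra_simps)
        finally show ?thesis .
      qed
      then have "T / real (n + 2) < T - t" by (simp add: divide_less_eq)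
      moreover have "N < (N - norm (v t)) * real (n + 2)"
      proof -
        have "N < real n * (N - norm (v t))" using n lt by (simp add: divide_less_eq)
        also have "\<dots> \<le> (N - norm (v t)) * real (n + 2)" using lt by (simp add: algebra_simps)
        finally show ?thesis .
      qed
      then have "N / real (n + 2) < N - norm (v t)" by (simp add: divide_less_eq)
      ultimately have "t \<in> E n" using t by (auto simp: E_def)
      with nE show False by blast
    qed
  qed
  then show ?thesis by (simp add: AE_lebesgue_on_iff)
qed

section \<open>Minimal time problems\<close>

lemma controls_bounded_imp_ctrlable:
  assumes u: "u \<in> controls_bounded_by M" and t: "0 < t" and M: "0 \<le> M" and st: "state P t y u = 0"
  shows "ctrlable t M y" "strongly_measurable (Ioo_measure t) u" "AE s in Ioo_measure t. norm (u s) \<le> M"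
proof -
  show 1: "strongly_measurable (Ioo_measure t) u"
    by (rule strongly_measurable_subset[where S = "{0..}"]) (use u in \<open>auto simp: controls_bounded_by_def\<close>)
  show 2: "AE s in Ioo_measure t. norm (u s) \<le> M"
    by (rule AE_lebesgue_on_subset[where S = "{0..}"]) (use u in \<open>auto simp: controls_bounded_by_def\<close>)
  show "ctrlable t M y" by (rule ctrlableI[OF t 1 2 M st])
qed

lemma ctrlable_imp_controls_bounded:
  assumes t: "0 < t" and "ctrlable t M y"
  shows "\<exists>u\<in>controls_bounded_by M. state P t y u = 0"
proof -
  obtain u where u: "u \<in> bctrl M" "sgp P t y + L t u = 0" using assms by (auto simp: ctrlable_def)
  have "AE s in lebesgue. norm (u s) \<le> M" using u by (simp add: bctrl_def)
  then have "AE s in lebesgue_on {0..}. norm (u s) \<le> M"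
    by (subst AE_lebesgue_on_iff) (auto elim: eventually_mono)
  then have "u \<in> controls_bounded_by M"
    using u strongly_measurable_restrict[of u "{0..}"] by (simp add: controls_bounded_by_def bctrl_def)
  moreover have "state P t y u = 0" using u state_eq_0_iff[OF t bctrl_L2'[OF t u(1)]] by simp
  ultimately show ?thesis by blast
qed

lemma min_time_le: "0 < t \<Longrightarrow> ctrlable t M y \<Longrightarrow> min_time P M y \<le> ereal t"
  unfolding min_time_def using ctrlable_imp_controls_bounded by (intro Inf_lower) auto

lemma TP_admissible_iff: "0 \<le> M \<Longrightarrow> (\<exists>u. TP_admissible P M y u) \<longleftrightarrow> (\<exists>t>0. ctrlable t M y)"
  unfolding TP_admissible_def using controls_bounded_imp_ctrlable(1) ctrlable_imp_controls_bounded by blast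

lemma min_time_pos:
  assumes y: "y \<noteq> 0" and M: "0 \<le> M" shows "0 < min_time P M y"
proof -
  obtain b where b: "b > 0" "\<And>\<delta>. 0 < \<delta> \<Longrightarrow> \<delta> < b \<Longrightarrow> \<not> ctrlable \<delta> M y"
    using not_ctrlable_short_time[OF y, of M] unfolding eventually_at_right_field by auto
  have "ereal b \<le> min_time P M y"
    unfolding min_time_def
  proof (rule Inf_greatest)
    fix x assume "x \<in> {ereal t |t. 0 < t \<and> (\<exists>u\<in>controls_bounded_by M. state P t y u = 0)}"
    then obtain t where t: "x = ereal t" "0 < t" "ctrlable t M y"
      using controls_bounded_imp_ctrlable(1)[OF _ _ M] by blast
    then show "ereal b \<le> x" using b(2)[of t] by force
  qed
  moreover have "0 < ereal b" using b(1) by simp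
  ultimately show ?thesis by (rule less_le_trans[rotated])
qed

lemma not_TP_admissible:
  assumes c: "cond_c P" and M: "0 < M" and y: "y \<noteq> 0" and le: "ereal M \<le> min_norm P (T1 P y) y"
  shows "\<not> (\<exists>u. TP_admissible P M y u)"
proof
  assume "\<exists>u. TP_admissible P M y u"
  then obtain t where t: "t > 0" "ctrlable t M y" using TP_admissible_iff[of M] M by auto
  from T1_cases[OF y] show False
  proof
    assume inf: "T1 P y = \<infinity>"
    \<comment> \<open>The value at an infinite \<open>T1\<close> is an infimum over all times, so a
      strictly smaller bound at a later time contradicts \<open>le\<close>.\<close>
    obtain N where N: "N < M" "ctrlable (t + 1) N y" using ctrlable_strict[OF c t(1) _ t(2) M, of "t + 1"] by auto
    have "min_norm P (T1 P y) y \<le> NP_value P (t + 1) y"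
      unfolding inf min_norm_infinity using t by (intro INF_lower) auto
    also have "\<dots> \<le> ereal N" using t N by (intro NP_value_le) auto
    also have "\<dots> < ereal M" using N by simp
    finally show False using le by simp
  next
    assume "\<exists>r>0. T1 P y = ereal r"
    then obtain r where r: "r > 0" "T1 P y = ereal r" by blast
    have "sgp P r y = 0" using T1_le_iff[of r y] r by simp
    then have "min_norm P (T1 P y) y = 0" using r by (simp add: min_norm_real NP_value_0)
    then show False using le M by (simp add: zero_ereal_def)
  qed
qed

text \<open>At the optimal time \<tau> no bound \<open>N < M\<close> suffices, since otherwise
  \<open>M\<close> would suffice earlier. Every minimal time control thus has minimal norm on
  \<open>(0,\<tau>)\<close>, and \<open>bang_bang\<close> applies because \<tau> lies before
  \<open>T1\<close>.\<close>

lemma TP_bang_bang_holds: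
  assumes c: "cond_c P" and d: "cond_d P" and M: "0 < M" and y: "y \<noteq> 0"
    and less: "min_norm P (T1 P y) y < ereal M"
  shows "TP_bang_bang P M y"
proof -
  have "\<exists>t>0. ctrlable t M y \<and> ereal t < T1 P y"
    using T1_cases[OF y]
  proof
    assume inf: "T1 P y = \<infinity>"
    obtain t where t: "t > 0" "NP_value P t y < ereal M"
      using less unfolding inf min_norm_infinity INF_less_iff by auto
    then show ?thesis using NP_value_less_imp_ctrlable inf by auto
  next
    assume "\<exists>r>0. T1 P y = ereal r"
    then obtain r where r: "r > 0" "T1 P y = ereal r" by blast
    have "sgp P r y = 0" using T1_le_iff[of r y] r by simp
    \<comment> \<open>For finite \<open>T1\<close> the zero control succeeds at \<open>T1\<close>;
      spending the positive bound \<open>M\<close> gains time, which puts the optimal time strictly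
      before \<open>T1\<close>.\<close>
    from ctrlable_earlier[OF c r(1) ctrlable_0[OF this] M] show ?thesis using r by auto
  qed
  then obtain t where t: "t > 0" "ctrlable t M y" "ereal t < T1 P y" by blast
  have "min_time P M y \<le> ereal t" by (rule min_time_le[OF t(1,2)])
  moreover have mt0: "0 < min_time P M y" using min_time_pos[OF y, of M] M by simp
  ultimately obtain \<tau> where \<tau>: "min_time P M y = ereal \<tau>" "\<tau> > 0" "\<tau> \<le> t"
    by (cases "min_time P M y") auto
  have "\<not> T1 P y \<le> ereal \<tau>" using t(3) \<tau>(3) by (meson ereal_less_eq(3) le_less_trans not_less order_trans)
  then have S\<tau>: "sgp P \<tau> y \<noteq> 0" using T1_le_iff[of \<tau> y] \<tau>(2) by simp
  have min: "\<not> ctrlable \<tau> N y" if NM: "N < M" for N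
  proof
    assume "ctrlable \<tau> N y"
    then obtain s where s: "0 < s" "s < \<tau>" "ctrlable s M y" using ctrlable_earlier[OF c \<tau>(2) _ NM] by blast
    then show False using min_time_le[OF s(1,3)] \<tau>(1) by simp
  qed
  have "AE s in lebesgue. 0 < s \<and> ereal s < min_time P M y \<longrightarrow> norm (u s) = M" if u: "min_time_control P M y u" for u
  proof -
    have uc: "u \<in> controls_bounded_by M" "state P \<tau> y u = 0"
      using u by (simp_all add: min_time_control_def \<tau>(1))
    note ub = controls_bounded_imp_ctrlable[OF uc(1) \<tau>(2) less_imp_le[OF M] uc(2)]
    have u2: "u \<in> L2 \<tau>" by (rule L2_bounded[OF ub(2,3)])
    have "AE s in Ioo_measure \<tau>. norm (u s) = M"
      using uc(2) state_eq_0_iff[OF \<tau>(2) u2] M by (intro bang_bang[OF c d \<tau>(2) S\<tau> u2 ub(3) _ _ min]) auto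
    then have "AE s in lebesgue. s \<in> {0<..<\<tau>} \<longrightarrow> norm (u s) = M"
      by (subst (asm) AE_lebesgue_on_iff) simp_all
    then show ?thesis unfolding \<tau>(1) by eventually_elim auto
  qed
  moreover have "\<exists>u. TP_admissible P M y u" using t TP_admissible_iff[of M] M by auto
  ultimately show ?thesis by (simp add: TP_bang_bang_def)
qed

section \<open>Minimal norm problems\<close>

lemma null_control_minimal:
  assumes T: "0 < T" and le: "T1 P y \<le> ereal T"
  shows "min_norm_control P T y (\<lambda>_. 0)"
    "\<And>v. min_norm_control P T y v \<Longrightarrow> AE t in lebesgue_on {0<..<T}. v t = 0"
    "NP_bang_bang P T y"
proof -
  have S0: "sgp P T y = 0" using T1_le_iff[of T y] le T by simp
  have mn: "min_norm P (ereal T) y = 0" using T S0 by (simp add: min_norm_real NP_value_0)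
  have adm: "NP_admissible P T y (\<lambda>_. 0)" "Linf_norm {0<..<T} (\<lambda>_. 0 :: 'u) \<le> ereal 0"
    using NP_admissible_if_bctrl[OF T, of "\<lambda>_. 0" 0 y] S0 by (simp_all add: L_0)
  have "Linf_norm {0<..<T} (\<lambda>_. 0 :: 'u) = 0"
    using adm(2) Linf_norm_nonneg[OF T, of "\<lambda>_. 0 :: 'u"] by (simp add: zero_ereal_def antisym)
  then show "min_norm_control P T y (\<lambda>_. 0)" using adm(1) mn by (simp add: min_norm_control_def)
  show zero: "AE t in lebesgue_on {0<..<T}. v t = 0" if "min_norm_control P T y v" for v
  proof -
    have "Linf_norm {0<..<T} v \<le> ereal 0" using that mn by (simp add: min_norm_control_def zero_ereal_def)
    from Linf_norm_leD[OF this] show ?thesis by eventually_elim simp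
  qed
  show "NP_bang_bang P T y"
    unfolding NP_bang_bang_def mn
  proof (intro conjI allI impI)
    show "\<exists>v. NP_admissible P T y v" using adm(1) by blast
    fix v assume "min_norm_control P T y v"
    from zero[OF this] show "AE t in lebesgue_on {0<..<T}. ereal (norm (v t)) = 0"
      by eventually_elim (simp add: zero_ereal_def)
  qed
qed

lemma NP_bang_bang_holds:
  assumes c: "cond_c P" and d: "cond_d P" and T: "0 < T" and lt: "ereal T < T1 P y"
  shows "NP_bang_bang P T y" "\<not> min_norm_control P T y (\<lambda>_. 0)"
proof -
  have ST: "sgp P T y \<noteq> 0" using T1_le_iff[of T y] lt T by (simp add: not_le[symmetric])
  show "\<not> min_norm_control P T y (\<lambda>_. 0)"
    using ST state_eq_0_iff[OF T L2_0, of y] by (simp add: min_norm_control_def NP_admissible_def L_0)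
  obtain C where "ctrlable T (C * norm y) y" using null_control[OF c T] by blast
  then obtain M u where "u \<in> bctrl M" "sgp P T y + L T u = 0" by (auto simp: ctrlable_def)
  then have adm: "\<exists>v. NP_admissible P T y v" using NP_admissible_if_bctrl(1)[OF T] by blast
  have "AE t in lebesgue_on {0<..<T}. ereal (norm (v t)) = min_norm P (ereal T) y"
    if v: "min_norm_control P T y v" for v
  proof -
    have va: "NP_admissible P T y v" and vn: "Linf_norm {0<..<T} v = min_norm P (ereal T) y"
      using v by (auto simp: min_norm_control_def)
    have vL: "v \<in> Linf {0<..<T}" "state P T y v = 0" using va by (auto simp: NP_admissible_def)
    obtain N where N: "N \<ge> 0" "Linf_norm {0<..<T} v = ereal N" using Linf_finite[OF vL(1) T] by blast
    have le: "AE t in Ioo_measure T. norm (v t) \<le> N" by (rule Linf_norm_leD) (simp add: N)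
    have v2: "v \<in> L2 T" using vL(1) le by (intro L2_bounded) (auto simp: Linf_def)
    have NPN: "NP_value P T y = ereal N" using vn N(2) T by (simp add: min_norm_real)
    have min: "\<not> ctrlable T M y" if "M < N" for M
      using NP_value_le[OF T, of M y] NPN that by auto
    have "AE t in Ioo_measure T. norm (v t) = N"
      using vL(2) state_eq_0_iff[OF T v2] by (intro bang_bang[OF c d T ST v2 le N(1) _ min]) auto
    then show ?thesis unfolding vn[symmetric] N(2) by eventually_elim simp
  qed
  with adm show "NP_bang_bang P T y" by (simp add: NP_bang_bang_def)
qed

end

theorem theorem1p9:
  fixes P :: "('x::{real_inner,banach}, 'u::{real_inner,banach}, 'v::banach) csys"
  assumes "control_setting P"
  shows
    "(cond_c P \<longrightarrow>
        W_all P = W32 P \<union> W33 P \<and> V_all P = V31 P \<union> V32 P \<and>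
        (gamma1 P = W22 P \<and> W22 P = {}) \<and> (gamma2 P = V23 P \<and> V23 P = {}))
     \<and>
     (cond_c P \<longrightarrow>
        (\<forall>(M, y0)\<in>V31 P. \<not> (\<exists>u. TP_admissible P M y0 u) \<and> \<not> TP_bang_bang P M y0) \<and>
        (cond_d P \<longrightarrow> (\<forall>(M, y0)\<in>V32 P. TP_bang_bang P M y0)))
     \<and>
     (\<forall>(T, y0)\<in>W33 P.
        min_norm_control P T y0 (\<lambda>_. 0) \<and>
        (\<forall>v. min_norm_control P T y0 v \<longrightarrow> (AE t in lebesgue_on {0<..<T}. v t = 0)) \<and>
        NP_bang_bang P T y0)
     \<and>
     (cond_c P \<and> cond_d P \<longrightarrow>
        (\<forall>(T, y0)\<in>W32 P. NP_bang_bang P T y0 \<and> \<not> min_norm_control P T y0 (\<lambda>_. 0)))"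
proof -
  interpret control_sys P by (rule control_sys.intro[OF assms])
  \<comment> \<open>Under (c) the critical time is 0 and the minimal norm there is infinite. This
    empties the sets with a finite value and leaves only the comparison with
    \<open>T1\<close>.\<close>
  have inf: "min_norm P (T0 P y) y = \<infinity>" if "cond_c P" "y \<noteq> 0" for y
    using that by (simp add: T0_eq_0 min_norm_0)
  have i: "W_all P = W32 P \<union> W33 P \<and> V_all P = V31 P \<union> V32 P \<and>
        (gamma1 P = W22 P \<and> W22 P = {}) \<and> (gamma2 P = V23 P \<and> V23 P = {})" if c: "cond_c P"
  proof (intro conjI)
    show "W_all P = W32 P \<union> W33 P"
      using inf[OF c] by (auto simp: W_all_def W32_def W33_def T0_eq_0[OF c] zero_ereal_def not_less)
    show "V_all P = V31 P \<union> V32 P"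
      using inf[OF c] by (auto simp: V_all_def V31_def V32_def T0_eq_0[OF c] zero_ereal_def not_le)
    show "W22 P = {}" and "gamma1 P = W22 P"
      using inf[OF c] by (auto simp: W22_def gamma1_def W_all_def)
    show "V23 P = {}" and "gamma2 P = V23 P"
      using inf[OF c] by (auto simp: V23_def gamma2_def V_all_def)
  qed
  have ii: "\<forall>(M, y0)\<in>V31 P. \<not> (\<exists>u. TP_admissible P M y0 u) \<and> \<not> TP_bang_bang P M y0" if c: "cond_c P"
  proof (rule ballI, unfold split_beta)
    fix p assume "p \<in> V31 P"
    then have "\<not> (\<exists>u. TP_admissible P (fst p) (snd p) u)"
      by (intro not_TP_admissible[OF c]) (auto simp: V31_def V_all_def)
    then show "\<not> (\<exists>u. TP_admissible P (fst p) (snd p) u) \<and> \<not> TP_bang_bang P (fst p) (snd p)"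
      by (simp add: TP_bang_bang_def)
  qed
  have ii': "\<forall>(M, y0)\<in>V32 P. TP_bang_bang P M y0" if "cond_c P" "cond_d P"
  proof (rule ballI, unfold split_beta)
    fix p assume "p \<in> V32 P"
    then show "TP_bang_bang P (fst p) (snd p)"
      by (intro TP_bang_bang_holds[OF that]) (auto simp: V32_def V_all_def)
  qed
  have iii: "\<forall>(T, y0)\<in>W33 P. min_norm_control P T y0 (\<lambda>_. 0) \<and>
        (\<forall>v. min_norm_control P T y0 v \<longrightarrow> (AE t in lebesgue_on {0<..<T}. v t = 0)) \<and>
        NP_bang_bang P T y0"
  proof (rule ballI, unfold split_beta)
    fix p assume "p \<in> W33 P"
    then have "0 < fst p" "T1 P (snd p) \<le> ereal (fst p)" by (auto simp: W33_def W_all_def)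
    from null_control_minimal[OF this]
    show "min_norm_control P (fst p) (snd p) (\<lambda>_. 0) \<and>
        (\<forall>v. min_norm_control P (fst p) (snd p) v \<longrightarrow> (AE t in lebesgue_on {0<..<fst p}. v t = 0)) \<and>
        NP_bang_bang P (fst p) (snd p)" by blast
  qed
  have iii': "\<forall>(T, y0)\<in>W32 P. NP_bang_bang P T y0 \<and> \<not> min_norm_control P T y0 (\<lambda>_. 0)"
    if "cond_c P" "cond_d P"
  proof (rule ballI, unfold split_beta)
    fix p assume "p \<in> W32 P"
    then have "0 < fst p" "ereal (fst p) < T1 P (snd p)" by (auto simp: W32_def W_all_def)
    from NP_bang_bang_holds[OF that this]
    show "NP_bang_bang P (fst p) (snd p) \<and> \<not> min_norm_control P (fst p) (snd p) (\<lambda>_. 0)" by blast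
  qed
  from i ii ii' iii iii' show ?thesis by satx
qed

end
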